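(* The GlobalClock model is strictly more powerful than the LocalClock model for acknowledgment-based Contention Resolution, in the following sense. (a) There is an acknowledgment-based GlobalClock protocol $\mathcal D$ with $L^{\mathrm{whp}}_{\mathcal D}(n)\le n(\log\log n)^{1+o(1)}$ (even against adaptive adversaries). (b) Every acknowledgment-based LocalClock protocol must have high-probability latency $\Omega(n\log n/(\log\log n)^2)$; that is, there is no acknowledgment-based LocalClock protocol $\mathcal D$ with $L^{\mathrm{whp}}_{\mathcal D}(n)=o\bigl(n\log n/(\log\log n)^2\bigr)$ (even if only oblivious adversaries are considered).
   Context: Contention Resolution. Time is divided into slots indexed by $\mathbb N$. There are $n$ identical parties; $n$ is unknown to the protocol, so one fixed protocol is used for all $n$. An adversary wakes up the $n$ parties; $t_u$ is the wake-up time of party $u$. An acknowledgment-based LocalClock protocol is a distribution $\mathcal D$ over infinite binary sequences, and each party independently draws $X^{(u)}=(X^{(u)}_1,X^{(u)}_2,\dots)\sim\mathcal D$. An acknowledgment-based GlobalClock protocol is a family $\mathcal D=(\mathcal D_{t^*})_{t^*\in\mathbb N}$ of such distributions, and each party independently draws $X^{(u)}\sim\mathcal D_{t_u}$. In both models $u$ attempts to grab the shared resource in slot $t_u+i$ ($i\ge1$) iff $X^{(u)}_i=1$ and $u$ has not succeeded in an earlier slot. A party succeeds in a slot iff it is the only party attempting to grab in that slot. Parties receive no feedback other than learning of their own success. An oblivious adversary fixes all wake-up times in advance; an adaptive adversary decides in each slot how many parties to wake up based on the state and history of all parties; in total $n$ parties are woken up. The latency of $u$ is $L^{(u)}_{\mathcal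 D,\mathcal A[n]}=t_u^{\mathrm{succ}}-t_u$, where $t_u^{\mathrm{succ}}$ is the slot in which $u$ succeeds ($\infty$ if never). $L_{\mathcal D}(n,q)$ is the least $L\in\mathbb N\cup\{\infty\}$ such that for every adversary $\mathcal A[n]$ (of the considered type) waking up $n$ parties and every party $u$, $\Pr[L^{(u)}_{\mathcal D,\mathcal A[n]}\le L]\ge 1-q$; and $L^{\mathrm{whp}}_{\mathcal D}(n)=L_{\mathcal D}(n,n^{-2})$. *)

theory Defs
  imports "HOL-Probability.Probability" "HOL-Library.Landau_Symbols"
begin

text \<open>
  Slots and parties are natural numbers. Infinite binary sequences are indexed from 0, so that
  \<^term>\<open>x i\<close> is the entry $X_{i+1}$: it governs slot \<open>t + Suc i\<close> for a party woken up in slot \<open>t\<close>.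
\<close>

definition local_clock_protocol :: "(nat \<Rightarrow> bool) measure \<Rightarrow> bool" where
  "local_clock_protocol D \<longleftrightarrow>
     prob_space D \<and> sets D = sets (PiM UNIV (\<lambda>_. count_space UNIV))"

definition global_clock_protocol :: "(nat \<Rightarrow> (nat \<Rightarrow> bool) measure) \<Rightarrow> bool" where
  "global_clock_protocol D \<longleftrightarrow> (\<forall>t. local_clock_protocol (D t))"

text \<open>
  An outcome \<open>Y\<close> of the draws provides an independent sequence \<open>Y (u, t)\<close>, distributed as \<open>D t\<close>, for
  every party \<open>u\<close> and every slot \<open>t\<close>. The sequence actually used by \<open>u\<close> is \<open>Y (u, t)\<close> for the slot
  \<open>t\<close> in which \<open>u\<close> is woken up. The choice of \<open>t\<close> does not depend on \<open>Y (u, t)\<close>, even for an adaptive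
  adversary. A LocalClock protocol \<open>D\<close> is run as the constant family \<open>\<lambda>_. D\<close>.
\<close>

type_synonym draws = "nat \<times> nat \<Rightarrow> nat \<Rightarrow> bool"

definition draw_space :: "(nat \<Rightarrow> (nat \<Rightarrow> bool) measure) \<Rightarrow> draws measure" where
  "draw_space D = PiM UNIV (\<lambda>(u, t). D t)"

text \<open>
  A history of length \<open>s\<close> lists the sets of parties attempting to grab in the slots \<open>0, \<dots>, s - 1\<close>;
  party \<open>u\<close> has succeeded in it iff \<open>{u}\<close> is one of these sets. An adversary maps the history of the
  slots \<open>0, \<dots>, t\<close> to the number of parties it wakes up in slot \<open>t\<close>. (Such parties attempt in slot
  \<open>t + 1\<close> at the earliest. The earlier wake-ups are a function of the history, too.) The parties are
  identical, so they are numbered \<open>0, 1, \<dots>\<close> in the order in which they are woken up.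
\<close>

type_synonym history = "nat set list"
type_synonym adversary = "history \<Rightarrow> nat"

definition adaptive :: "adversary set" where
  "adaptive = UNIV"

definition oblivious :: "adversary set" where
  "oblivious = {A. \<forall>h h'. length h = length h' \<longrightarrow> A h = A h'}"

definition woken_before :: "adversary \<Rightarrow> history \<Rightarrow> nat \<Rightarrow> nat" where
  "woken_before A h t = (\<Sum>t'<t. A (take (Suc t') h))"

definition woken_in :: "adversary \<Rightarrow> history \<Rightarrow> nat \<Rightarrow> nat \<Rightarrow> bool" where
  "woken_in A h u t \<longleftrightarrow> woken_before A h t \<le> u \<and> u < woken_before A h (Suc t)"

text \<open>The parties attempting in slot \<open>length h\<close>, where \<open>h\<close> is the history of all earlier slots.\<close>

definition next_attempts :: "adversary \<Rightarrow> draws \<Rightarrow> history \<Rightarrow> nat set" where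
  "next_attempts A Y h =
     {u. \<exists>t i. woken_in A h u t \<and> length h = t + Suc i \<and> Y (u, t) i \<and> {u} \<notin> set h}"

primrec run :: "adversary \<Rightarrow> draws \<Rightarrow> nat \<Rightarrow> history" where
  "run A Y 0 = []"
| "run A Y (Suc s) = run A Y s @ [next_attempts A Y (run A Y s)]"

definition wakes_up_total :: "adversary \<Rightarrow> draws \<Rightarrow> nat \<Rightarrow> bool" where
  "wakes_up_total A Y n \<longleftrightarrow> (\<forall>\<^sub>F t in sequentially. woken_before A (run A Y t) t = n)"

definition wake_time :: "adversary \<Rightarrow> draws \<Rightarrow> nat \<Rightarrow> nat" where
  "wake_time A Y u = (LEAST t. woken_in A (run A Y (Suc t)) u t)"

definition succeeds_in :: "adversary \<Rightarrow> draws \<Rightarrow> nat \<Rightarrow> nat \<Rightarrow> bool" where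
  "succeeds_in A Y u s \<longleftrightarrow> next_attempts A Y (run A Y s) = {u}"

definition latency :: "adversary \<Rightarrow> draws \<Rightarrow> nat \<Rightarrow> enat" where
  "latency A Y u =
     (if \<exists>s. succeeds_in A Y u s
      then enat ((LEAST s. succeeds_in A Y u s) - wake_time A Y u) else \<infinity>)"

definition protocol_latency ::
  "adversary set \<Rightarrow> (nat \<Rightarrow> (nat \<Rightarrow> bool) measure) \<Rightarrow> nat \<Rightarrow> real \<Rightarrow> enat" where
  "protocol_latency \<A> D n q =
     (LEAST L. \<forall>A\<in>\<A>. (AE Y in draw_space D. wakes_up_total A Y n) \<longrightarrow>
        (\<forall>u<n. \<P>(Y in draw_space D. latency A Y u \<le> L) \<ge> 1 - q))"

definition whp_latency ::
  "adversary set \<Rightarrow> (nat \<Rightarrow> (nat \<Rightarrow> bool) measure) \<Rightarrow> nat \<Rightarrow> enat" where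
  "whp_latency \<A> D n = protocol_latency \<A> D n (1 / real n ^ 2)"

end

theory Submission
  imports Defs "HOL-Real_Asymp.Real_Asymp"
begin

text \<open>
  GlobalClock protocol. In slot \<open>s\<close> a party of age \<open>a\<close> attempts with probability \<open>min 1 (\<mu> s / a)\<close>, where
  the multiplier \<open>\<mu> s\<close>, a power of 2, is determined by the global clock. If the contention
  \<open>c = (\<Sum>u. 1 / age u)\<close> of the live parties is between \<open>1 / polylog n\<close> and \<open>polylog n\<close>, then a slot with
  \<open>\<mu> s * c \<approx> 1 / 2\<close> is successful with constant probability; such a slot occurs in every window of
  \<open>ln (ln n) powr (1 + o(1))\<close> slots. If the contention is smaller, a slot with \<open>\<mu> s = polylog n\<close> gives each
  live party a sufficient chance of its own. The adversary can disturb only \<open>O(n)\<close> windows, since it wakes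
  up \<open>n\<close> parties, there are at most \<open>n\<close> successes, and high contention is rare on average because the
  ages sum up harmonically.

  LocalClock lower bound. Let \<open>L n\<close> be the latency. A burst of \<open>n / 2\<close> parties leaves most of them
  unsuccessful for \<open>n / 8\<close> slots; if one of them made only \<open>ln n / (4 * ln (ln n))\<close> attempts between the
  ages \<open>n / 8\<close> and \<open>L n\<close>, then the first attempts of \<open>n / 2\<close> randomly placed further parties would block
  all of these with probability more than \<open>1 / n\<^sup>2\<close>. As \<open>L n / n\<close> is at most logarithmic, this applies to
  \<open>\<Omega>(ln n / ln (ln n))\<close> disjoint epochs, so that a party makes \<open>\<Omega>((ln n / ln (ln n))\<^sup>2)\<close> attempts in its
  first \<open>O(sqrt n)\<close> slots. Hence waking up one party every \<open>\<Theta>(ln n / (ln (ln n))\<^sup>2)\<close> slots keeps the expected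
  number of attempts at \<open>8 * ln n\<close> or more in every slot, and with high probability nobody ever succeeds.
\<close>

section \<open>Runs\<close>

text \<open>That the protocol does not know \<open>n\<close> shapes both halves. For the lower
  bound, one fixed distribution must be reliable at all sizes at once, so attempts forced at sizes
  between \<open>N powr (1 / 4)\<close> and \<open>sqrt N\<close> can be used against it at size
  \<open>N\<close>. For the upper bound, the multipliers for all guesses of \<open>n\<close> share
  the time axis, and the exponent \<open>v\<^sup>2\<close> is a compromise: if \<open>I\<close>
  multipliers are needed, \<open>v\<close> is about \<open>sqrt (log 2 I)\<close>, so that both the
  dilution of scale \<open>v\<close> and the rounding up of \<open>v\<close> cost factors of the
  form \<open>2 powr O(v)\<close>, which is \<open>I powr o(1)\<close>. With \<open>2 ^ v\<close>
  multipliers the dilution, with \<open>2 ^ 2 ^ v\<close> the rounding would cost a whole power of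
  \<open>I\<close>. An oblivious adversary is deterministic, so random placements become averages
  over finite families of schedules. Against an adaptive adversary the slots are dependent; but all
  entries are independent coins, so given the history the next slot is independent of the past, and
  exponential supermartingales over a finite tree of histories take the place of Chernoff
  bounds.\<close>

lemma length_run [simp]: "length (run A Y s) = s"
  by (induction s) auto

lemma take_run: "s' \<le> s \<Longrightarrow> take s' (run A Y s) = run A Y s'"
  by (induction s) (auto simp: le_Suc_eq)

lemma nth_run: "s' < s \<Longrightarrow> run A Y s ! s' = next_attempts A Y (run A Y s')"
proof (induction s)
  case (Suc s)
  then show ?case
    by (cases "s' = s") (auto simp: nth_append)
qed simp

lemma singleton_in_set_run: "{u} \<in> set (run A Y s) \<longleftrightarrow> (\<exists>s'<s. succeeds_in A Y u s')"
  by (auto simp: in_set_conv_nth nth_run succeeds_in_def)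

lemma woken_before_take: "t \<le> s \<Longrightarrow> woken_before A (take s h) t = woken_before A h t"
  unfolding woken_before_def by (intro sum.cong) (auto simp: min_def)

lemma woken_before_run: "t \<le> s \<Longrightarrow> woken_before A (run A Y s) t = woken_before A (run A Y t) t"
  by (metis order_refl take_run woken_before_take)

lemma woken_before_mono: "t \<le> t' \<Longrightarrow> woken_before A h t \<le> woken_before A h t'"
  unfolding woken_before_def by (intro sum_mono2) auto

lemma woken_in_unique: "woken_in A h u t \<Longrightarrow> woken_in A h u t' \<Longrightarrow> t = t'"
  unfolding woken_in_def
  by (metis Suc_leI linorder_neqE_nat not_less order_trans woken_before_mono)

lemma woken_in_take: "t < s \<Longrightarrow> woken_in A (take s h) u t \<longleftrightarrow> woken_in A h u t"
  by (simp add: woken_in_def woken_before_take)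

lemma woken_in_run: "t < s \<Longrightarrow> woken_in A (run A Y s) u t \<longleftrightarrow> woken_in A (run A Y (Suc t)) u t"
  using woken_in_take[of t "Suc t" A "run A Y s" u] take_run[of "Suc t" s A Y] by simp

lemma ex_woken_in: "u < woken_before A h T \<Longrightarrow> \<exists>t<T. woken_in A h u t"
proof (induction T)
  case 0
  then show ?case by (simp add: woken_before_def)
next
  case (Suc T)
  show ?case
  proof (cases "u < woken_before A h T")
    case True
    then show ?thesis using Suc.IH less_Suc_eq by auto
  next
    case False
    then show ?thesis using Suc.prems by (auto simp: woken_in_def intro!: exI[of _ T])
  qed
qed

lemma woken_in_less: "woken_in A h u t \<Longrightarrow> t < s \<Longrightarrow> u < woken_before A h s"
  unfolding woken_in_def by (meson Suc_leI less_le_trans woken_before_mono)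

lemma mem_next_attempts:
  "u \<in> next_attempts A Y h \<longleftrightarrow>
     {u} \<notin> set h \<and> (\<exists>t<length h. woken_in A h u t \<and> Y (u, t) (length h - Suc t))"
proof -
  have "(\<exists>i. length h = t + Suc i \<and> Y (u, t) i) \<longleftrightarrow> t < length h \<and> Y (u, t) (length h - Suc t)" for t
    by (auto intro!: exI[of _ "length h - Suc t"])
  then show ?thesis unfolding next_attempts_def by auto
qed

lemma next_attempts_subset: "next_attempts A Y h \<subseteq> {..<woken_before A h (length h)}"
  by (auto simp: mem_next_attempts intro: woken_in_less)

lemma finite_next_attempts [simp]: "finite (next_attempts A Y h)"
  by (rule finite_subset[OF next_attempts_subset]) simp

lemma next_attempts_cong:
  assumes "\<And>u t i. t + Suc i = length h \<Longrightarrow> Y (u, t) i = Y' (u, t) i"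
  shows "next_attempts A Y h = next_attempts A Y' h"
proof -
  have "Y (u, t) (length h - Suc t) = Y' (u, t) (length h - Suc t)" if "t < length h" for u t
    using that by (intro assms) simp
  then show ?thesis by (simp add: mem_next_attempts set_eq_iff cong: conj_cong)
qed

text \<open>The first \<open>s\<close> slots read only entries with \<open>t + Suc i < s\<close>,
  and slot \<open>s\<close> only those with \<open>t + Suc i = s\<close>. These index sets are
  disjoint, which later gives the independence in \<open>prob_run_Suc\<close>.\<close>

lemma run_cong:
  assumes "\<And>u t i. t + Suc i < s \<Longrightarrow> Y (u, t) i = Y' (u, t) i"
  shows "run A Y s = run A Y' s"
  using assms
proof (induction s)
  case (Suc s)
  then have "run A Y s = run A Y' s" by simp
  moreover have "next_attempts A Y (run A Y' s) = next_attempts A Y' (run A Y' s)"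
    by (rule next_attempts_cong) (simp add: Suc.prems)
  ultimately show ?case by simp
qed simp

lemma succeeds_in_once:
  assumes "succeeds_in A Y u s" "succeeds_in A Y u s'"
  shows "s = s'"
proof -
  have False if "succeeds_in A Y u r" "succeeds_in A Y u r'" "r < r'" for r r'
    using that singleton_in_set_run[of u A Y r'] by (auto simp: succeeds_in_def mem_next_attempts)
  then show ?thesis using assms by (meson linorder_neqE_nat)
qed

lemma wake_time_eq:
  assumes "woken_in A (run A Y s) u t" "t < s"
  shows "wake_time A Y u = t"
proof -
  have *: "woken_in A (run A Y (Suc t)) u t" using assms woken_in_run by blast
  show ?thesis unfolding wake_time_def
  proof (rule Least_equality)
    fix t' assume t': "woken_in A (run A Y (Suc t')) u t'"
    show "t \<le> t'"
      using woken_in_unique[of A "run A Y (Suc (max t t'))" u t t'] * t' woken_in_run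
      by (metis less_Suc_eq_le max.cobounded1 max.cobounded2 order_refl)
  qed fact
qed

text \<open>Success is unique, so the \<open>LEAST\<close> in \<open>latency\<close> is the only
  success slot. The history has length \<open>Suc (t + L)\<close> because it must contain slot
  \<open>t + L\<close> itself. In this form a latency bound is a property of a finite run.\<close>

lemma latency_le_iff:
  assumes "woken_in A (run A Y s) u t" "t < s"
  shows "latency A Y u \<le> enat L \<longleftrightarrow> {u} \<in> set (run A Y (Suc (t + L)))"
proof -
  have wt: "wake_time A Y u = t" by (rule wake_time_eq[OF assms])
  have L: "(LEAST s. succeeds_in A Y u s) = r" if "succeeds_in A Y u r" for r
    using that by (intro Least_equality) (auto dest: succeeds_in_once[of A Y u r])
  show ?thesis
  proof (cases "\<exists>r. succeeds_in A Y u r")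
    case True
    then obtain r where r: "succeeds_in A Y u r" by blast
    then have "latency A Y u = enat (r - t)" using L[OF r] wt unfolding latency_def by auto
    moreover have "(\<exists>s'<Suc (t + L). succeeds_in A Y u s') \<longleftrightarrow> r < Suc (t + L)"
      using r succeeds_in_once by blast
    ultimately show ?thesis unfolding singleton_in_set_run by auto
  next
    case False
    then show ?thesis unfolding singleton_in_set_run latency_def by auto
  qed
qed

section \<open>Measurability of runs\<close>

lemma measurable_next_attempts:
  assumes "\<And>u t i. t + Suc i = length h \<Longrightarrow> (\<lambda>x. y x (u, t) i) \<in> measurable N (count_space UNIV)"
  shows "Measurable.pred N (\<lambda>x. next_attempts A (y x) h = B)"
proof -
  have [measurable]: "Measurable.pred N (\<lambda>x. y x (u, t) (length h - Suc t))" if "t < length h" for u t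
    using that assms by simp
  have [measurable]: "Measurable.pred N (\<lambda>x. u \<in> next_attempts A (y x) h)" for u
  proof -
    have "Measurable.pred N (\<lambda>x. {u} \<notin> set h \<and>
      (\<exists>t\<in>{t. t < length h \<and> woken_in A h u t}. y x (u, t) (length h - Suc t)))"
      by (intro pred_intros_logic pred_intros_finite) auto
    then show ?thesis by (simp add: mem_next_attempts Bex_def conj_assoc)
  qed
  have "Measurable.pred N (\<lambda>x. \<forall>u. u \<in> next_attempts A (y x) h \<longleftrightarrow> u \<in> B)"
    by measurable
  then show ?thesis by (simp add: set_eq_iff)
qed

lemma countable_histories: "countable {h :: history. length h = s \<and> (\<forall>B\<in>set h. finite B)}"
proof (rule countable_subset)
  show "{h :: history. length h = s \<and> (\<forall>B\<in>set h. finite B)} \<subseteq> lists (Collect finite)" by auto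
  show "countable (lists (Collect finite :: nat set set))"
    by (rule countable_lists) (rule countable_Collect_finite)
qed

text \<open>The type of histories is uncountable, but attempt sets are finite, so runs stay in a
  countable set and appending a slot is a countable case distinction. The general \<open>y\<close>
  makes the lemma applicable to draws restricted to some of their entries.\<close>

lemma measurable_run:
  assumes "\<And>u t i. t + Suc i < s \<Longrightarrow> (\<lambda>x. y x (u, t) i) \<in> measurable N (count_space UNIV)"
  shows "(\<lambda>x. run A (y x) s) \<in> measurable N (count_space UNIV)"
proof -
  have "(\<lambda>x. run A (y x) s) \<in> measurable N (count_space {h. length h = s \<and> (\<forall>B\<in>set h. finite B)})"
    using assms
  proof (induction s)
    case 0
    then show ?case by (auto intro!: measurable_const)
  next
    case (Suc s)
    let ?I = "\<lambda>s. {h :: history. length h = s \<and> (\<forall>B\<in>set h. finite B)}"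
    have "(\<lambda>x. h @ [next_attempts A (y x) h]) \<in> measurable N (count_space (?I (Suc s)))" if "h \<in> ?I s" for h
    proof (subst measurable_count_space_eq_countable[OF countable_histories], intro conjI ballI)
      show "(\<lambda>x. h @ [next_attempts A (y x) h]) \<in> space N \<rightarrow> ?I (Suc s)" using that by auto
      fix h' assume "h' \<in> ?I (Suc s)"
      have "Measurable.pred N (\<lambda>x. next_attempts A (y x) h = last h')"
        by (rule measurable_next_attempts) (use Suc.prems that in auto)
      then have "{x \<in> space N. next_attempts A (y x) h = last h'} \<in> sets N" by simp
      moreover have "(\<lambda>x. h @ [next_attempts A (y x) h]) -` {h'} \<inter> space N =
        (if butlast h' = h \<and> h' \<noteq> [] then {x \<in> space N. next_attempts A (y x) h = last h'} else {})"
        by (cases h' rule: rev_cases) auto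
      ultimately show "(\<lambda>x. h @ [next_attempts A (y x) h]) -` {h'} \<inter> space N \<in> sets N"
        by simp
    qed
    then have "(\<lambda>x. (\<lambda>h x. h @ [next_attempts A (y x) h]) (run A (y x) s) x)
        \<in> measurable N (count_space (?I (Suc s)))"
    proof (rule measurable_compose_countable'[OF _ _ countable_histories])
      show "(\<lambda>x. run A (y x) s) \<in> measurable N (count_space (?I s))"
        by (rule Suc.IH) (simp add: Suc.prems)
    qed
    then show ?case by simp
  qed
  from measurable_compose[OF this, of "\<lambda>h. h" "count_space UNIV"] show ?thesis
    by simp
qed

section \<open>The space of draws\<close>

lemma prob_space_draw_space:
  assumes "global_clock_protocol D"
  shows "prob_space (draw_space D)"
  unfolding draw_space_def
  by (rule prob_space_PiM) (use assms in \<open>auto simp: global_clock_protocol_def local_clock_protocol_def\<close>)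

lemma measurable_draw:
  assumes "global_clock_protocol D"
  shows "(\<lambda>Y. Y (u, t)) \<in> measurable (draw_space D) (D t)"
  unfolding draw_space_def
  using measurable_component_singleton[of "(u, t)" UNIV "\<lambda>(u, t). D t"] by simp

lemma measurable_entry:
  assumes "local_clock_protocol D"
  shows "(\<lambda>x. x i) \<in> measurable D (count_space UNIV)"
proof -
  have *: "sets D = sets (PiM UNIV (\<lambda>_. count_space UNIV))"
    using assms by (simp add: local_clock_protocol_def)
  show ?thesis
    unfolding measurable_cong_sets[OF * refl] by (rule measurable_component_singleton) simp
qed

lemma measurable_draw_entry:
  assumes "global_clock_protocol D"
  shows "(\<lambda>Y. Y (u, t) i) \<in> measurable (draw_space D) (count_space UNIV)"
proof -
  have "local_clock_protocol (D t)" using assms by (simp add: global_clock_protocol_def)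
  from measurable_compose[OF measurable_draw[OF assms, of u t] measurable_entry[OF this, of i]]
  show ?thesis .
qed

lemma measurable_run_draw:
  assumes "global_clock_protocol D"
  shows "(\<lambda>Y. run A Y s) \<in> measurable (draw_space D) (count_space UNIV)"
  by (rule measurable_run) (rule measurable_draw_entry[OF assms])

section \<open>Fixed schedules\<close>

text \<open>An adversary acting in slot \<open>t\<close> sees the slots \<open>0\<close> to
  \<open>t\<close>, hence the test \<open>Suc (w u) = length h\<close>.\<close>

definition schedule :: "nat \<Rightarrow> (nat \<Rightarrow> nat) \<Rightarrow> adversary" where
  "schedule n w h = card {u. u < n \<and> Suc (w u) = length h}"

lemma schedule_oblivious: "schedule n w \<in> oblivious"
  by (simp add: oblivious_def schedule_def)

lemma woken_before_schedule:
  "t \<le> length h \<Longrightarrow> woken_before (schedule n w) h t = card {u. u < n \<and> w u < t}"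
proof (induction t)
  case (Suc t)
  have "woken_before (schedule n w) h (Suc t) = card {u. u < n \<and> w u < t} + card {u. u < n \<and> w u = t}"
    using Suc by (simp add: woken_before_def schedule_def min_absorb2)
  also have "\<dots> = card ({u. u < n \<and> w u < t} \<union> {u. u < n \<and> w u = t})"
    by (rule card_Un_disjoint[symmetric]) auto
  also have "{u. u < n \<and> w u < t} \<union> {u. u < n \<and> w u = t} = {u. u < n \<and> w u < Suc t}" by auto
  finally show ?case .
qed (simp add: woken_before_def)

lemma less_card_downward_closed:
  fixes S :: "nat set"
  assumes "finite S" "\<And>x y. x \<in> S \<Longrightarrow> y < x \<Longrightarrow> y \<in> S"
  shows "u < card S \<longleftrightarrow> u \<in> S"
proof
  assume "u \<in> S"
  then have "{..u} \<subseteq> S" using assms(2) by (auto simp: le_less)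
  then have "card {..u} \<le> card S" using assms(1) by (intro card_mono)
  then show "u < card S" by simp
next
  assume *: "u < card S"
  show "u \<in> S"
  proof (rule ccontr)
    assume "u \<notin> S"
    then have "S \<subseteq> {..<u}" using assms(2) by (metis lessThan_iff linorder_neqE_nat subsetI)
    then have "card S \<le> card {..<u}" by (intro card_mono) auto
    then show False using * by simp
  qed
qed

text \<open>Adversaries only announce numbers. As \<open>w\<close> is monotone, the parties woken up
  before a slot form an initial segment of the naturals, so their number determines them.\<close>

lemma woken_in_schedule:
  assumes w: "mono_on {..<n} w" and t: "t < length h"
  shows "woken_in (schedule n w) h u t \<longleftrightarrow> u < n \<and> w u = t"
proof -
  have *: "u < card {u. u < n \<and> w u < t'} \<longleftrightarrow> u < n \<and> w u < t'" for t'
  proof -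
    have "x \<in> {u. u < n \<and> w u < t'} \<Longrightarrow> y < x \<Longrightarrow> y \<in> {u. u < n \<and> w u < t'}" for x y
      using mono_onD[OF w, of y x] by simp
    from less_card_downward_closed[OF _ this] show ?thesis by simp
  qed
  show ?thesis
    unfolding woken_in_def using t *[of t] *[of "Suc t"]
    by (simp add: woken_before_schedule not_less[symmetric] less_Suc_eq) auto
qed

lemma wakes_up_total_schedule: "wakes_up_total (schedule n w) Y n"
  unfolding wakes_up_total_def eventually_sequentially
proof (intro exI allI impI)
  fix t assume t: "Suc (\<Sum>u<n. w u) \<le> t"
  have "w u < t" if "u < n" for u
    using member_le_sum[of u "{..<n}" w] that t by simp
  then have "{u. u < n \<and> w u < t} = {..<n}" by auto
  then show "woken_before (schedule n w) (run (schedule n w) Y t) t = n"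
    by (simp add: woken_before_schedule)
qed

text \<open>The parties of \<open>P\<close> that have succeeded before a slot, if \<open>V u s\<close> tells whether party \<open>u\<close>
  wants to attempt in slot \<open>s\<close> as long as it has not succeeded.\<close>

primrec succeeded :: "nat set \<Rightarrow> (nat \<Rightarrow> nat \<Rightarrow> bool) \<Rightarrow> nat \<Rightarrow> nat set" where
  "succeeded P V 0 = {}"
| "succeeded P V (Suc s) = succeeded P V s \<union> {u. {v \<in> P. V v s \<and> v \<notin> succeeded P V s} = {u}}"

definition wants :: "(nat \<Rightarrow> nat) \<Rightarrow> draws \<Rightarrow> nat \<Rightarrow> nat \<Rightarrow> bool" where
  "wants w Y u s \<longleftrightarrow> w u < s \<and> Y (u, w u) (s - Suc (w u))"

lemma singleton_in_run_schedule:
  assumes w: "mono_on {..<n} w"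
  shows "{u} \<in> set (run (schedule n w) Y s) \<longleftrightarrow> u \<in> succeeded {..<n} (wants w Y) s"
proof (induction s arbitrary: u)
  case (Suc s)
  have "next_attempts (schedule n w) Y (run (schedule n w) Y s) =
      {v \<in> {..<n}. wants w Y v s \<and> v \<notin> succeeded {..<n} (wants w Y) s}"
  proof -
    have "(\<exists>t<s. woken_in (schedule n w) (run (schedule n w) Y s) x t \<and> Y (x, t) (s - Suc t)) \<longleftrightarrow>
        x < n \<and> wants w Y x s" for x
      using woken_in_schedule[OF w, of _ "run (schedule n w) Y s" x]
      by (auto simp: wants_def cong: conj_cong)
    then show ?thesis by (auto simp: mem_next_attempts Suc.IH)
  qed
  then show ?case using Suc.IH by auto
qed simp

lemma succeeded_Suc_cases:
  assumes "u \<in> succeeded P V s"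
  obtains r where "r < s" "{v \<in> P. V v r \<and> v \<notin> succeeded P V r} = {u}"
  using assms by (induction s) (auto intro: less_SucI)

lemma succeeded_wants:
  assumes "u \<in> succeeded P V s"
  shows "u \<in> P" "\<exists>r<s. V u r"
  using assms by (auto elim!: succeeded_Suc_cases)

lemma finite_succeeded: "finite (succeeded P V s)"
  and card_succeeded_le: "card (succeeded P V s) \<le> s"
proof -
  have "finite (succeeded P V s) \<and> card (succeeded P V s) \<le> s"
  proof (induction s)
    case (Suc s)
    define X where "X = {u. {v \<in> P. V v s \<and> v \<notin> succeeded P V s} = {u}}"
    have "X = {} \<or> (\<exists>u. X = {u})" unfolding X_def by auto
    then have "finite X \<and> card X \<le> 1" by auto
    then show ?case using Suc card_Un_le[of "succeeded P V s" X] by (auto simp flip: X_def)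
  qed simp
  then show "finite (succeeded P V s)" "card (succeeded P V s) \<le> s" by auto
qed

text \<open>Removing competitors never hurts: by induction, whoever has not succeeded among
  \<open>Q\<close> has not succeeded among \<open>P\<close> either, so a slot that isolates
  \<open>u\<close> within \<open>P\<close> still isolates it within \<open>Q\<close>.\<close>

lemma succeeded_antimono:
  assumes "Q \<subseteq> P" "u \<in> Q" "u \<in> succeeded P V s"
  shows "u \<in> succeeded Q V s"
  using assms(2,3)
proof (induction s arbitrary: u)
  case (Suc s)
  then consider "u \<in> succeeded P V s" | "{v \<in> P. V v s \<and> v \<notin> succeeded P V s} = {u}" by auto
  then show ?case
  proof cases
    case 2
    then have "{v \<in> Q. V v s \<and> v \<notin> succeeded Q V s} \<subseteq> {u}"
      using Suc.IH assms(1) by blast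
    then show ?thesis using 2 Suc.prems by auto
  qed (use Suc in auto)
qed simp

lemma succeeded_cong:
  assumes "\<And>u r. u \<in> P \<Longrightarrow> r < s \<Longrightarrow> V u r = V' u r"
  shows "succeeded P V s = succeeded P V' s"
  using assms
proof (induction s)
  case (Suc s)
  then have "succeeded P V s = succeeded P V' s" by simp
  moreover have "{v \<in> P. V v s \<and> v \<notin> A} = {v \<in> P. V' v s \<and> v \<notin> A}" for A
    using Suc.prems by auto
  ultimately show ?case by simp
qed simp

text \<open>At most \<open>Suc t0\<close> parties have succeeded in the slots up to \<open>t0\<close>, so \<open>t0 + 3\<close> requests leave
  two contenders.\<close>

lemma succeeded_jammed:
  assumes "finite P" "\<And>r. t0 < r \<Longrightarrow> r \<le> T \<Longrightarrow> t0 + 3 \<le> card {u \<in> P. V u r}"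
    and "t0 < s" "s \<le> Suc T"
  shows "succeeded P V s = succeeded P V (Suc t0)"
  using assms(3,4)
proof (induction s)
  case (Suc s)
  show ?case
  proof (cases "s = t0")
    case False
    then have s: "t0 < s" "s \<le> T" using Suc.prems by auto
    then have IH: "succeeded P V s = succeeded P V (Suc t0)" using Suc.IH by simp
    have "{v \<in> P. V v s \<and> v \<notin> succeeded P V s} \<noteq> {u}" for u
    proof
      assume *: "{v \<in> P. V v s \<and> v \<notin> succeeded P V s} = {u}"
      have "{v \<in> P. V v s} \<subseteq> insert u (succeeded P V (Suc t0))" using * IH by auto
      then have "card {v \<in> P. V v s} \<le> card (insert u (succeeded P V (Suc t0)))"
        by (intro card_mono) (auto simp: finite_succeeded simp del: succeeded.simps)
      also have "\<dots> \<le> Suc (card (succeeded P V (Suc t0)))" by (rule card_insert_le_m1) auto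
      also have "\<dots> \<le> t0 + 2" using card_succeeded_le[of P V "Suc t0"] by simp
      finally show False using assms(2)[OF s] by simp
    qed
    then show ?thesis using IH by (simp del: succeeded.simps(2) add: succeeded.simps(2)[of P V s])
  qed simp
qed simp

section \<open>Reliability of a LocalClock protocol\<close>

text \<open>What a latency bound yields for fixed schedules, with adversaries and histories
  eliminated. Both constructions of the lower bound start from this property.\<close>

definition reliable :: "(nat \<Rightarrow> bool) measure \<Rightarrow> nat \<Rightarrow> nat \<Rightarrow> bool" where
  "reliable D n L \<longleftrightarrow> (\<forall>w u. mono_on {..<n} w \<longrightarrow> u < n \<longrightarrow>
     1 - 1 / real n ^ 2 \<le> \<P>(Y in draw_space (\<lambda>_. D). u \<in> succeeded {..<n} (wants w Y) (Suc (w u + L))))"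

lemma global_clock_const: "local_clock_protocol D \<Longrightarrow> global_clock_protocol (\<lambda>_. D)"
  by (simp add: global_clock_protocol_def)

text \<open>\<open>enat\<close> is well-ordered and \<open>\<infinity>\<close> always qualifies, so
  the least latency has its defining property.\<close>

lemma protocol_latency_attained:
  assumes D: "global_clock_protocol D" "0 \<le> q"
    and "protocol_latency \<A> D n q = enat L" "A \<in> \<A>" "AE Y in draw_space D. wakes_up_total A Y n" "u < n"
  shows "1 - q \<le> \<P>(Y in draw_space D. latency A Y u \<le> enat L)"
proof -
  let ?P = "\<lambda>L. \<forall>A\<in>\<A>. (AE Y in draw_space D. wakes_up_total A Y n) \<longrightarrow>
        (\<forall>u<n. \<P>(Y in draw_space D. latency A Y u \<le> L) \<ge> 1 - q)"
  interpret prob_space "draw_space D" by (rule prob_space_draw_space[OF D(1)])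
  have "?P \<infinity>" using D(2) by (simp add: prob_space)
  then have "?P (LEAST L. ?P L)" by (rule LeastI)
  then show ?thesis using assms unfolding protocol_latency_def by simp
qed

lemma reliable_whp_latency:
  assumes D: "local_clock_protocol D" and L: "whp_latency oblivious (\<lambda>_. D) n = enat L"
  shows "reliable D n L"
  unfolding reliable_def
proof (intro allI impI)
  fix w :: "nat \<Rightarrow> nat" and u
  assume w: "mono_on {..<n} w" and u: "u < n"
  have "latency (schedule n w) Y u \<le> enat L \<longleftrightarrow> u \<in> succeeded {..<n} (wants w Y) (Suc (w u + L))" for Y
    using latency_le_iff[of "schedule n w" Y "Suc (w u)" u "w u" L] u
    by (simp add: woken_in_schedule[OF w] singleton_in_run_schedule[OF w] del: run.simps succeeded.simps)
  then show "1 - 1 / (real n)\<^sup>2 \<le> \<P>(Y in draw_space (\<lambda>_. D). u \<in> succeeded {..<n} (wants w Y) (Suc (w u + L)))"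
    using protocol_latency_attained[OF global_clock_const[OF D] _ L[unfolded whp_latency_def]
        schedule_oblivious[of n w] _ u] wakes_up_total_schedule by simp
qed

lemma events_succeeded:
  assumes D: "local_clock_protocol D" and w: "mono_on {..<n} w"
  shows "{Y \<in> space (draw_space (\<lambda>_. D)). u \<in> succeeded {..<n} (wants w Y) s} \<in> sets (draw_space (\<lambda>_. D))"
proof -
  have "Measurable.pred (draw_space (\<lambda>_. D)) (\<lambda>Y. {u} \<in> set (run (schedule n w) Y s))"
    using measurable_compose[OF measurable_run_draw[OF global_clock_const[OF D], where A = "schedule n w" and s = s],
        of "\<lambda>h. {u} \<in> set h" "count_space UNIV"] by simp
  then show ?thesis by (simp add: singleton_in_run_schedule[OF w] pred_def)
qed

lemma succeeded_mono: "s \<le> s' \<Longrightarrow> succeeded P V s \<subseteq> succeeded P V s'"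
  by (rule lift_Suc_mono_le[where f = "succeeded P V"]) auto

lemma reliable_mono:
  assumes D: "local_clock_protocol D" and "reliable D n L" "L \<le> L'"
  shows "reliable D n L'"
  unfolding reliable_def
proof (intro allI impI)
  fix w :: "nat \<Rightarrow> nat" and u
  assume w: "mono_on {..<n} w" and u: "u < n"
  interpret prob_space "draw_space (\<lambda>_. D)" by (rule prob_space_draw_space[OF global_clock_const[OF D]])
  have "1 - 1 / (real n)\<^sup>2 \<le> \<P>(Y in draw_space (\<lambda>_. D). u \<in> succeeded {..<n} (wants w Y) (Suc (w u + L)))"
    using assms(2) w u unfolding reliable_def by blast
  also have "\<dots> \<le> \<P>(Y in draw_space (\<lambda>_. D). u \<in> succeeded {..<n} (wants w Y) (Suc (w u + L')))"
    using assms(3) succeeded_mono[of "Suc (w u + L)" "Suc (w u + L')" "{..<n}"]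
    by (intro finite_measure_mono events_succeeded[OF D w]) (auto simp del: succeeded.simps)
  finally show "1 - 1 / (real n)\<^sup>2 \<le> \<P>(Y in draw_space (\<lambda>_. D). u \<in> succeeded {..<n} (wants w Y) (Suc (w u + L')))" .
qed

section \<open>Jamming a LocalClock protocol\<close>

locale local_protocol =
  fixes D :: "(nat \<Rightarrow> bool) measure"
  assumes D: "local_clock_protocol D"
begin

abbreviation draws :: "draws measure" where "draws \<equiv> draw_space (\<lambda>_. D)"

sublocale D: prob_space D
  using D by (simp add: local_clock_protocol_def)

sublocale prob_space draws
  by (rule prob_space_draw_space[OF global_clock_const[OF D]])

lemma space_D: "space D = UNIV"
proof -
  have "sets D = sets (PiM UNIV (\<lambda>_. count_space UNIV))"
    using D by (simp add: local_clock_protocol_def)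
  from sets_eq_imp_space_eq[OF this] show ?thesis by (simp add: space_PiM PiE_def)
qed

lemma space_draws: "space draws = UNIV"
  by (auto simp: draw_space_def space_PiM PiE_def space_D case_prod_beta)

lemma draw_space_const: "draws = PiM UNIV (\<lambda>_. D)"
  unfolding draw_space_def by (rule PiM_cong) auto

lemma distr_draw: "distr draws D (\<lambda>Y. Y k) = D"
  unfolding draw_space_const by (rule distr_PiM_component) (auto intro: D.prob_space_axioms)

lemma measurable_draw_D [measurable]: "(\<lambda>Y. Y k) \<in> measurable draws D"
  unfolding draw_space_const by (rule measurable_component_singleton) simp

lemma measurable_entry_D [measurable]: "(\<lambda>x. x i) \<in> measurable D (count_space UNIV)"
  by (rule measurable_entry[OF D])

lemma events_draw: "E \<in> sets D \<Longrightarrow> {Y. Y k \<in> E} \<in> events"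
  using measurable_sets[OF measurable_draw_D[of k], of E] by (simp add: space_draws vimage_def)

lemma prob_draw: "E \<in> sets D \<Longrightarrow> prob {Y. Y k \<in> E} = D.prob E"
  using measure_distr[OF measurable_draw_D[of k], of E] distr_draw[of k] by (simp add: space_draws vimage_def)

lemma indep_draws: "indep_vars (\<lambda>_. D) (\<lambda>u Y. Y (u, w u)) UNIV"
proof (subst indep_vars_iff_distr_eq_PiM)
  have "distr (PiM UNIV (\<lambda>_. D)) (PiM UNIV (\<lambda>_. D)) (\<lambda>Y. \<lambda>u\<in>UNIV. Y (u, w u)) = PiM UNIV (\<lambda>_. D)"
    by (rule distr_PiM_reindex[where f = "\<lambda>u. (u, w u)" and M = "\<lambda>_. D"])
      (auto simp: inj_on_def D.prob_space_axioms)
  then show "distr draws (PiM UNIV (\<lambda>_. D)) (\<lambda>Y. \<lambda>u\<in>UNIV. Y (u, w u)) =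
      PiM UNIV (\<lambda>u. distr draws D (\<lambda>Y. Y (u, w u)))"
    by (simp only: distr_draw) (simp only: draw_space_const)
qed (auto simp: measurable_draw_D)

definition attempt_prob :: "nat \<Rightarrow> real" where
  "attempt_prob i = D.prob {x. x i}"

lemma attempt_prob_bounds: "0 \<le> attempt_prob i" "attempt_prob i \<le> 1"
  by (auto simp: attempt_prob_def)

definition want_prob :: "nat \<Rightarrow> nat \<Rightarrow> real" where
  "want_prob t s = (if t < s then attempt_prob (s - Suc t) else 0)"

lemma want_prob_bounds: "0 \<le> want_prob t s" "want_prob t s \<le> 1"
  by (auto simp: want_prob_def attempt_prob_bounds)

lemma sets_entry: "{x. x i} \<in> sets D"
proof -
  have "{x \<in> space D. x i} \<in> sets D" by measurable
  then show ?thesis by (simp add: space_D)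
qed

lemma events_wants: "{Y. wants w Y u s} \<in> events"
  using events_draw[OF sets_entry, of "(u, w u)" "s - Suc (w u)"] by (cases "w u < s") (auto simp: wants_def)

lemma prob_wants: "prob {Y. wants w Y u s} = want_prob (w u) s"
  using prob_draw[OF sets_entry, of "(u, w u)" "s - Suc (w u)"]
  by (cases "w u < s") (auto simp: wants_def want_prob_def attempt_prob_def)

lemma indep_wants:
  "indep_vars (\<lambda>_. count_space UNIV) (\<lambda>u Y. wants w Y u s) UNIV"
proof -
  have "indep_vars (\<lambda>_. count_space UNIV) (\<lambda>u Y. w u < s \<and> Y (u, w u) (s - Suc (w u))) UNIV"
    by (rule indep_vars_compose2[OF indep_draws, where Y = "\<lambda>u x. w u < s \<and> x (s - Suc (w u))"]) measurable
  then show ?thesis by (simp add: wants_def)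
qed

text \<open>Markov's inequality for \<open>exp (- Z)\<close>, where \<open>Z\<close> is the number of parties that want slot \<open>s\<close>.\<close>

lemma prob_few_wants_le:
  "prob {Y. card {u \<in> {..<n}. wants w Y u s} < k} \<le> exp (real k) * (\<Prod>u<n. 1 - want_prob (w u) s / 2)"
proof -
  let ?f = "\<lambda>b. if b then exp (-1) else 1 :: real"
  let ?Z = "\<lambda>Y. card {u \<in> {..<n}. wants w Y u s}"
  let ?E = "{Y. ?Z Y < k}"
  have [measurable]: "Measurable.pred draws (\<lambda>Y. wants w Y u s)" for u
    using events_wants[of w u s] by (simp add: pred_def space_draws)
  have E: "?E \<in> events"
  proof -
    have "{Y \<in> space draws. card {u \<in> {..<n}. wants w Y u s} < k} \<in> events" by measurable
    then show ?thesis by (simp add: space_draws)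
  qed
  have prod: "(\<Prod>u<n. ?f (wants w Y u s)) = exp (- real (?Z Y))" for Y
  proof -
    have "(\<Prod>u<n. ?f (wants w Y u s)) = (\<Prod>u\<in>{u \<in> {..<n}. wants w Y u s}. exp (-1))"
      by (subst prod.inter_filter) auto
    then show ?thesis by (simp flip: exp_of_nat_mult)
  qed
  have indep: "indep_vars (\<lambda>_. borel) (\<lambda>u Y. ?f (wants w Y u s)) {..<n}"
    by (rule indep_vars_subset[OF indep_vars_compose2[OF indep_wants[of w s], where Y = "\<lambda>_. ?f"]]) auto
  have int: "integrable draws (\<lambda>Y. ?f (wants w Y u s))" for u
    by (rule integrable_const_bound[where B = 1]) auto
  have "expectation (\<lambda>Y. ?f (wants w Y u s)) \<le> 1 - want_prob (w u) s / 2" for u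
  proof -
    have "expectation (\<lambda>Y. ?f (wants w Y u s)) = expectation (\<lambda>Y. 1 - (1 - exp (-1)) * indicator {Y. wants w Y u s} Y)"
      by (rule Bochner_Integration.integral_cong) auto
    also have "\<dots> = 1 - (1 - exp (-1)) * want_prob (w u) s"
    proof -
      have "integrable draws (indicat_real {Y. wants w Y u s})"
        using events_wants by (simp add: integrable_real_indicator emeasure_eq_measure)
      moreover have "expectation (indicat_real {Y. wants w Y u s}) = want_prob (w u) s"
        using events_wants by (simp add: prob_wants)
      ultimately show ?thesis by (subst Bochner_Integration.integral_diff) (auto simp: prob_space)
    qed
    also have "\<dots> \<le> 1 - (1 / 2) * want_prob (w u) s"
    proof -
      have "exp (-1 :: real) \<le> 1 / 2"
        using exp_ge_add_one_self[of "1 :: real"] by (simp add: exp_minus field_simps)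
      then show ?thesis using want_prob_bounds[of "w u" s] by (intro diff_left_mono mult_right_mono) auto
    qed
    finally show ?thesis by simp
  qed
  moreover have "0 \<le> expectation (\<lambda>Y. ?f (wants w Y u s))" for u
    by (rule Bochner_Integration.integral_nonneg) auto
  ultimately have "(\<Prod>u<n. expectation (\<lambda>Y. ?f (wants w Y u s))) \<le> (\<Prod>u<n. 1 - want_prob (w u) s / 2)"
    by (intro prod_mono) auto
  moreover have "(\<Prod>u<n. expectation (\<lambda>Y. ?f (wants w Y u s))) = expectation (\<lambda>Y. \<Prod>u<n. ?f (wants w Y u s))"
    by (rule indep_vars_lebesgue_integral[symmetric, OF _ indep int]) simp
  moreover have "prob ?E = expectation (indicator ?E)" using E by simp
  moreover have "expectation (indicator ?E) \<le> expectation (\<lambda>Y. exp (real k) * (\<Prod>u<n. ?f (wants w Y u s)))"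
  proof (rule integral_mono)
    show "integrable draws (\<lambda>Y. exp (real k) * (\<Prod>u<n. ?f (wants w Y u s)))"
      by (intro integrable_mult_right indep_vars_integrable[OF _ indep int]) simp
    show "integrable draws (indicator ?E :: _ \<Rightarrow> real)" using E by (simp add: emeasure_eq_measure)
    show "indicator ?E Y \<le> exp (real k) * (\<Prod>u<n. ?f (wants w Y u s))" for Y
      unfolding prod by (auto simp: indicator_def simp flip: exp_add)
  qed
  ultimately show ?thesis by (simp add: mult_left_mono order.trans)
qed

text \<open>If each slot in \<open>{t0<..T}\<close> gets \<open>t0 + 3\<close> requests, then nobody
  succeeds there, in particular not \<open>u\<close>, which wakes up no earlier than
  \<open>t0\<close>. A union bound over the slots makes success less likely than 1/2, whereas
  reliability demands at least 3/4.\<close>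

lemma not_reliable_if_jammed:
  assumes w: "mono_on {..<n} w" and n: "2 \<le> n"
    and u: "u < n" "t0 \<le> w u" "w u + L \<le> T"
    and jam: "(\<Sum>s\<in>{t0<..T}. \<Prod>u<n. 1 - want_prob (w u) s / 2) < exp (- real (t0 + 3)) / 2"
  shows "\<not> reliable D n L"
proof
  assume rel: "reliable D n L"
  let ?Z = "\<lambda>Y s. card {u \<in> {..<n}. wants w Y u s}"
  let ?S = "{Y. u \<in> succeeded {..<n} (wants w Y) (Suc (w u + L))}"
  have E: "{Y. ?Z Y s < t0 + 3} \<in> events" for s
  proof -
    have [measurable]: "Measurable.pred draws (\<lambda>Y. wants w Y u s)" for u
      using events_wants[of w u s] by (simp add: pred_def space_draws)
    have "{Y \<in> space draws. card {u \<in> {..<n}. wants w Y u s} < t0 + 3} \<in> events" by measurable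
    then show ?thesis by (simp add: space_draws)
  qed
  have "?S \<subseteq> (\<Union>s\<in>{t0<..T}. {Y. ?Z Y s < t0 + 3})"
  proof
    fix Y assume Y: "Y \<in> ?S"
    show "Y \<in> (\<Union>s\<in>{t0<..T}. {Y. ?Z Y s < t0 + 3})"
    proof (rule ccontr)
      assume "Y \<notin> (\<Union>s\<in>{t0<..T}. {Y. ?Z Y s < t0 + 3})"
      then have *: "t0 + 3 \<le> ?Z Y r" if "t0 < r" "r \<le> T" for r using that by (simp add: not_less[symmetric])
      have "u \<in> succeeded {..<n} (wants w Y) (Suc T)"
        using Y succeeded_mono[of "Suc (w u + L)" "Suc T" "{..<n}" "wants w Y"] u(3)
        by (auto simp del: succeeded.simps)
      then have "u \<in> succeeded {..<n} (wants w Y) (Suc t0)"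
        using succeeded_jammed[of "{..<n}" t0 T "wants w Y" "Suc T"] * u by (simp del: succeeded.simps)
      then obtain r where "r < Suc t0" "wants w Y u r" using succeeded_wants(2) by blast
      then show False using u(2) by (simp add: wants_def)
    qed
  qed
  then have "prob ?S \<le> prob (\<Union>s\<in>{t0<..T}. {Y. ?Z Y s < t0 + 3})"
    using E by (intro finite_measure_mono sets.finite_UN) auto
  also have "\<dots> \<le> (\<Sum>s\<in>{t0<..T}. prob {Y. ?Z Y s < t0 + 3})"
    using E by (intro finite_measure_subadditive_finite) auto
  also have "\<dots> \<le> (\<Sum>s\<in>{t0<..T}. exp (real (t0 + 3)) * (\<Prod>u<n. 1 - want_prob (w u) s / 2))"
    by (intro sum_mono prob_few_wants_le)
  also have "\<dots> = exp (real (t0 + 3)) * (\<Sum>s\<in>{t0<..T}. \<Prod>u<n. 1 - want_prob (w u) s / 2)"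
    by (simp only: sum_distrib_left)
  also have "\<dots> < exp (real (t0 + 3)) * (exp (- real (t0 + 3)) / 2)"
    using jam by (intro mult_strict_left_mono) auto
  also have "\<dots> = 1 / 2" by (simp flip: exp_add)
  finally have "prob ?S < 1 / 2" .
  moreover have "1 - 1 / real n ^ 2 \<le> prob ?S"
    using rel w u(1) unfolding reliable_def by (simp add: space_draws del: succeeded.simps)
  moreover have "1 / real n ^ 2 \<le> 1 / 2 ^ 2"
    using n by (intro divide_left_mono power_mono) auto
  ultimately show False by (simp add: power2_eq_square)
qed

end

lemma sum_div_blocks:
  fixes f :: "nat \<Rightarrow> real"
  assumes "0 < \<rho>"
  shows "(\<Sum>u<\<rho> * b. f (u div \<rho>)) = real \<rho> * (\<Sum>a<b. f a)"
proof -
  have "(\<Sum>u<b * \<rho>. f (u div \<rho>)) = (\<Sum>a<b. \<Sum>u\<in>{a * \<rho>..<a * \<rho> + \<rho>}. f (u div \<rho>))"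
    by (rule sum.nat_group[symmetric])
  also have "\<dots> = (\<Sum>a<b. \<Sum>u\<in>{a * \<rho>..<a * \<rho> + \<rho>}. f a)"
  proof (intro sum.cong refl)
    fix a u assume "u \<in> {a * \<rho>..<a * \<rho> + \<rho>}"
    then have "u div \<rho> = a" by (intro div_nat_eqI) (auto simp: mult.commute)
    then show "f (u div \<rho>) = f a" by simp
  qed
  finally show ?thesis by (simp add: sum_distrib_left mult.commute)
qed

context local_protocol
begin

definition expected_attempts :: "nat \<Rightarrow> real" where
  "expected_attempts t = (\<Sum>i<t. attempt_prob i)"

lemma expected_attempts_mono: "s \<le> t \<Longrightarrow> expected_attempts s \<le> expected_attempts t"
  unfolding expected_attempts_def by (intro sum_mono2) (auto simp: attempt_prob_bounds)

text \<open>If one party wakes up per slot, then slot \<open>s\<close> meets every age from 1 to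
  \<open>s\<close> exactly once.\<close>

lemma sum_want_prob:
  assumes "s \<le> m"
  shows "(\<Sum>a<m. want_prob a s) = expected_attempts s"
proof -
  have "(\<Sum>a<m. want_prob a s) = (\<Sum>a<s. want_prob a s)"
    using assms by (intro sum.mono_neutral_right) (auto simp: want_prob_def)
  also have "\<dots> = (\<Sum>a<s. attempt_prob (s - Suc a))"
    by (intro sum.cong) (auto simp: want_prob_def)
  finally show ?thesis by (simp add: expected_attempts_def sum.nat_diff_reindex)
qed

text \<open>The schedule wakes up \<open>\<rho>\<close> parties per slot before slot \<open>b\<close> and then one party per stratum of
  \<open>h\<close> slots. Averaging over the position of each party within its stratum gives a schedule under which
  every slot is requested by many parties.\<close>

lemma not_reliable_stratified:
  fixes \<rho> b h n t0 L T :: nat and c :: real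
  assumes n: "2 \<le> n" "\<rho> * b \<le> n" and \<rho>: "0 < \<rho>" and h: "0 < h" and t0: "t0 < b"
    and T: "T = b + (n - \<rho> * b) * h" "t0 + L \<le> T"
    and c: "c \<le> \<rho> * expected_attempts t0" "c \<le> expected_attempts b / h"
    and small: "real T * exp (- c / 2) < exp (- real (t0 + 3)) / 2"
  shows "\<not> reliable D n L"
proof -
  define J where "J = {\<rho> * b..<n}"
  define w where "w \<omega> u = (if u < \<rho> * b then u div \<rho> else b + (u - \<rho> * b) * h + \<omega> u)" for \<omega> :: "nat \<Rightarrow> nat" and u
  define \<Omega> where "\<Omega> = PiE J (\<lambda>_. {..<h})"
  let ?F = "\<lambda>s x. 1 - want_prob x s / 2"
  have F: "0 \<le> ?F s x" "?F s x \<le> exp (- want_prob x s / 2)" for s x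
    using want_prob_bounds[of x s] exp_ge_add_one_self[of "- want_prob x s / 2"] by auto
  have mono: "mono_on {..<n} (w \<omega>)" if "\<omega> \<in> \<Omega>" for \<omega>
  proof (rule mono_onI)
    fix x y assume xy: "x \<in> {..<n}" "y \<in> {..<n}" "x \<le> y"
    have \<omega>: "\<omega> u < h" if "u \<in> J" for u using that \<open>\<omega> \<in> \<Omega>\<close> by (auto simp: \<Omega>_def PiE_iff)
    consider "y < \<rho> * b" | "x < \<rho> * b" "\<rho> * b \<le> y" | "\<rho> * b \<le> x" by linarith
    then show "w \<omega> x \<le> w \<omega> y"
    proof cases
      case 2
      have "x div \<rho> < b" using 2(1) by (simp add: less_mult_imp_div_less mult.commute)
      then show ?thesis using 2 by (simp add: w_def)
    next
      case 3
      show ?thesis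
      proof (cases "x = y")
        case False
        then have "Suc (x - \<rho> * b) * h \<le> (y - \<rho> * b) * h" using 3 xy by (intro mult_right_mono) auto
        then show ?thesis using 3 xy \<omega>[of x] by (simp add: w_def J_def)
      qed simp
    qed (use xy in \<open>auto simp: w_def div_le_mono\<close>)
  qed
  \<comment> \<open>The mean factor of a party placed uniformly in its stratum;
    \<open>1 + x \<le> exp x\<close> turns it into an exponential of the mean request
    probability.\<close>
  have avg: "(\<Sum>x<h. ?F s (y + x)) \<le> real h * exp (- (\<Sum>x<h. want_prob (y + x) s) / (2 * real h))" for s y
  proof -
    have "(\<Sum>x<h. ?F s (y + x)) = real h * (1 + - (\<Sum>x<h. want_prob (y + x) s) / (2 * real h))"
      using h by (simp add: sum_subtractf sum_divide_distrib[symmetric] field_simps)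
    also have "\<dots> \<le> real h * exp (- (\<Sum>x<h. want_prob (y + x) s) / (2 * real h))"
      by (intro mult_left_mono exp_ge_add_one_self) auto
    finally show ?thesis .
  qed
  \<comment> \<open>The strata are filled independently, so the sum over all placements factorises,
    and half the expected number of requests appears in the exponent.\<close>
  have slot: "(\<Sum>\<omega>\<in>\<Omega>. \<Prod>u<n. ?F s (w \<omega> u)) \<le> real h ^ card J * exp (- c / 2)" if s: "s \<in> {t0<..T}" for s
  proof -
    let ?A = "\<Sum>a<b. want_prob a s" and ?B = "\<Sum>a\<in>{b..<T}. want_prob a s"
    have "(\<Sum>\<omega>\<in>\<Omega>. \<Prod>u<n. ?F s (w \<omega> u)) =
        (\<Sum>\<omega>\<in>\<Omega>. (\<Prod>u<\<rho> * b. ?F s (u div \<rho>)) * (\<Prod>u\<in>J. ?F s (b + (u - \<rho> * b) * h + \<omega> u)))"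
    proof (intro sum.cong refl)
      fix \<omega>
      have n_eq: "{..<n} = {..<\<rho> * b} \<union> J" using n(2) by (auto simp: J_def)
      have "(\<Prod>u<n. ?F s (w \<omega> u)) = (\<Prod>u<\<rho> * b. ?F s (w \<omega> u)) * (\<Prod>u\<in>J. ?F s (w \<omega> u))"
        unfolding n_eq by (rule prod.union_disjoint) (auto simp: J_def)
      then show "(\<Prod>u<n. ?F s (w \<omega> u)) =
          (\<Prod>u<\<rho> * b. ?F s (u div \<rho>)) * (\<Prod>u\<in>J. ?F s (b + (u - \<rho> * b) * h + \<omega> u))"
        by (simp add: w_def J_def)
    qed
    also have "\<dots> = (\<Prod>u<\<rho> * b. ?F s (u div \<rho>)) * (\<Prod>u\<in>J. \<Sum>x<h. ?F s (b + (u - \<rho> * b) * h + x))"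
      unfolding \<Omega>_def by (subst prod_sum_PiE) (auto simp: J_def sum_distrib_left)
    also have "\<dots> \<le> (\<Prod>u<\<rho> * b. exp (- want_prob (u div \<rho>) s / 2)) *
        (\<Prod>u\<in>J. real h * exp (- (\<Sum>x<h. want_prob (b + (u - \<rho> * b) * h + x) s) / (2 * real h)))"
      by (intro mult_mono prod_mono conjI F avg sum_nonneg prod_nonneg) auto
    also have "(\<Prod>u<\<rho> * b. exp (- want_prob (u div \<rho>) s / 2)) = exp (- (real \<rho> * ?A) / 2)"
      by (simp add: exp_sum[symmetric] sum_negf sum_divide_distrib[symmetric]
          sum_div_blocks[OF \<rho>, of "\<lambda>a. want_prob a s"])
    also have "(\<Prod>u\<in>J. real h * exp (- (\<Sum>x<h. want_prob (b + (u - \<rho> * b) * h + x) s) / (2 * real h))) =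
        real h ^ card J * exp (- ?B / (2 * real h))"
    proof -
      have "(\<Sum>u\<in>J. \<Sum>x<h. want_prob (b + (u - \<rho> * b) * h + x) s) =
          (\<Sum>j<n - \<rho> * b. \<Sum>x<h. want_prob (b + j * h + x) s)"
        unfolding J_def
        by (rule sum.reindex_bij_witness[of _ "\<lambda>j. j + \<rho> * b" "\<lambda>u. u - \<rho> * b"]) auto
      also have "\<dots> = (\<Sum>j<n - \<rho> * b. \<Sum>x\<in>{j * h..<j * h + h}. want_prob (b + x) s)"
      proof (rule sum.cong[OF refl])
        fix j show "(\<Sum>x<h. want_prob (b + j * h + x) s) = (\<Sum>x\<in>{j * h..<j * h + h}. want_prob (b + x) s)"
          by (rule sum.reindex_bij_witness[of _ "\<lambda>x. x - j * h" "\<lambda>x. x + j * h"]) (auto simp: algebra_simps)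
      qed
      also have "\<dots> = (\<Sum>x<(n - \<rho> * b) * h. want_prob (b + x) s)" by (rule sum.nat_group)
      also have "\<dots> = ?B"
        unfolding T(1) by (rule sum.reindex_bij_witness[of _ "\<lambda>x. x - b" "\<lambda>x. b + x"]) auto
      finally show ?thesis
        by (simp add: prod.distrib exp_sum[symmetric] sum_negf sum_divide_distrib[symmetric] J_def)
    qed
    also have "exp (- (real \<rho> * ?A) / 2) * (real h ^ card J * exp (- ?B / (2 * real h))) =
        real h ^ card J * exp (- (real \<rho> * ?A + ?B / real h) / 2)"
      using h by (simp add: field_simps flip: exp_add)
    also have "\<dots> \<le> real h ^ card J * exp (- c / 2)"
    proof -
      have nonneg: "0 \<le> ?A" "0 \<le> ?B" by (auto intro!: sum_nonneg simp: want_prob_bounds)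
      have "c \<le> real \<rho> * ?A + ?B / real h"
      \<comment> \<open>Up to slot \<open>b\<close> the dense part alone suffices, as it sees all
        ages up to \<open>s\<close> with weight \<open>\<rho>\<close>. Later, reducing the weight of
        the dense part to \<open>1 / h\<close> leaves a uniform density of \<open>1 / h\<close>
        parties per slot, and these request slot \<open>s\<close> in expectation
        \<open>expected_attempts s / h\<close> times.\<close>
      proof (cases "s \<le> b")
        case True
        have "c \<le> real \<rho> * expected_attempts s"
          using c(1) s expected_attempts_mono[of t0 s] by (meson greaterThanAtMost_iff less_imp_le mult_left_mono of_nat_0_le_iff order_trans)
        then show ?thesis using sum_want_prob[OF True] nonneg by (simp add: add_increasing2)
      next
        case False
        have "?A + ?B = expected_attempts s"
        proof -
          have "?A + ?B = (\<Sum>a<T. want_prob a s)"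
            unfolding T(1) lessThan_atLeast0 by (rule sum.atLeastLessThan_concat) auto
          then show ?thesis using sum_want_prob[of s T] s by simp
        qed
        moreover have "?A / real h \<le> real \<rho> * ?A"
        proof -
          have "?A / real h \<le> ?A / 1" using nonneg h by (intro divide_left_mono) auto
          also have "\<dots> \<le> real \<rho> * ?A" using nonneg \<rho> by (simp add: mult_le_cancel_right1)
          finally show ?thesis .
        qed
        moreover have "expected_attempts b / real h \<le> expected_attempts s / real h"
          using False by (intro divide_right_mono expected_attempts_mono) auto
        moreover have "(?A + ?B) / real h = ?A / real h + ?B / real h" by (rule add_divide_distrib)
        ultimately show ?thesis using c(2) by simp
      qed
      then show ?thesis by (intro mult_left_mono) auto
    qed
    finally show ?thesis .
  qed
  have fin: "finite \<Omega>" unfolding \<Omega>_def by (intro finite_PiE) (auto simp: J_def)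
  have card: "card \<Omega> = h ^ card J" unfolding \<Omega>_def by (subst card_PiE) (auto simp: J_def)
  \<comment> \<open>Some placement is at least as good as the average one.\<close>
  have "\<exists>\<omega>\<in>\<Omega>. (\<Sum>s\<in>{t0<..T}. \<Prod>u<n. ?F s (w \<omega> u)) < exp (- real (t0 + 3)) / 2"
  proof (rule ccontr)
    assume "\<not> ?thesis"
    then have "real (card \<Omega>) * (exp (- real (t0 + 3)) / 2) \<le> (\<Sum>\<omega>\<in>\<Omega>. \<Sum>s\<in>{t0<..T}. \<Prod>u<n. ?F s (w \<omega> u))"
      by (intro sum_bounded_below) (auto simp: not_less)
    also have "\<dots> = (\<Sum>s\<in>{t0<..T}. \<Sum>\<omega>\<in>\<Omega>. \<Prod>u<n. ?F s (w \<omega> u))" by (rule sum.swap)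
    also have "\<dots> \<le> (\<Sum>s\<in>{t0<..T}. real h ^ card J * exp (- c / 2))" by (intro sum_mono slot)
    also have "\<dots> \<le> real (card \<Omega>) * (real T * exp (- c / 2))"
      using h by (simp add: card mult_left_mono)
    finally have "exp (- real (t0 + 3)) / 2 \<le> real T * exp (- c / 2)"
      using h by (simp add: card)
    then show False using small by simp
  qed
  then obtain \<omega> where \<omega>: "\<omega> \<in> \<Omega>" "(\<Sum>s\<in>{t0<..T}. \<Prod>u<n. ?F s (w \<omega> u)) < exp (- real (t0 + 3)) / 2" by blast
  \<comment> \<open>The victim is party \<open>\<rho> * t0\<close>, the first one woken up in slot
    \<open>t0\<close>.\<close>
  have "\<rho> * t0 < \<rho> * b" using \<rho> t0 by simp
  then have "w \<omega> (\<rho> * t0) = t0" using \<rho> by (simp add: w_def)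
  moreover have "\<rho> * t0 < n" using \<open>\<rho> * t0 < \<rho> * b\<close> n(2) by (rule less_le_trans)
  ultimately show ?thesis
    using not_reliable_if_jammed[OF mono[OF \<omega>(1)] n(1), of "\<rho> * t0" t0 L T] \<omega>(2) T(2) by simp
qed

end

section \<open>Attempts in an epoch\<close>

lemma binomial_diff_antimono:
  assumes "k \<le> m" "m \<le> R" "R \<le> N"
  shows "(N - m) choose (R - m) \<le> (N - k) choose (R - k)"
  using assms
proof (induction m rule: dec_induct)
  case (step m)
  then have "Suc (N - Suc m) = N - m" "Suc (R - Suc m) = R - m" by auto
  then have "(N - m) choose (R - m) = ((N - Suc m) choose (R - Suc m)) + ((N - Suc m) choose (R - m))"
    by (metis binomial_Suc_Suc)
  then show ?case using step by simp
qed simp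

text \<open>A random \<open>R\<close>-subset of \<open>N\<close> elements contains \<open>k\<close>
  given ones with probability \<open>\<Prod>j<k. (R - j) / (N - j)\<close>, and each factor is at
  least \<open>(R - m) / N\<close>. The fractions are cleared to stay within the naturals.\<close>

lemma binomial_ratio:
  assumes "k \<le> m" "m \<le> R" "R \<le> N"
  shows "(N choose R) * (R - m) ^ k \<le> ((N - k) choose (R - k)) * N ^ k"
  using assms
proof (induction k)
  case (Suc k)
  have absorb: "(R - k) * ((N - k) choose (R - k)) = (N - k) * ((N - Suc k) choose (R - Suc k))"
    using Suc.prems binomial_absorption[of "R - Suc k" "N - k"] by (simp add: Suc_diff_Suc)
  have "(N choose R) * (R - m) ^ Suc k \<le> ((N - k) choose (R - k)) * N ^ k * (R - m)"
    using Suc by (simp add: mult.assoc[symmetric] mult_right_mono mult.commute[of "R - m"])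
  also have "\<dots> = (R - m) * ((N - k) choose (R - k)) * N ^ k" by (simp add: ac_simps)
  also have "\<dots> \<le> (R - k) * ((N - k) choose (R - k)) * N ^ k"
    using Suc.prems by (intro mult_right_mono) auto
  also have "\<dots> = (N - k) * ((N - Suc k) choose (R - Suc k)) * N ^ k" using absorb by (simp add: mult.assoc)
  also have "\<dots> \<le> N * ((N - Suc k) choose (R - Suc k)) * N ^ k" by (intro mult_right_mono) auto
  finally show ?case by (simp add: ac_simps)
qed simp

text \<open>Fewer prescribed elements leave at least as many supersets, so the count for exactly
  \<open>m\<close> elements is a lower bound that is uniform in \<open>A\<close>.\<close>

lemma card_supersets_ge:
  assumes "finite X" "A \<subseteq> X" "card A \<le> m" "m \<le> R" "R \<le> card X"
  shows "(card X - m) choose (R - m) \<le> card {C. C \<subseteq> X \<and> card C = R \<and> A \<subseteq> C}"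
proof -
  have fA: "finite A" using assms finite_subset by blast
  have "(card X - m) choose (R - m) \<le> (card X - card A) choose (R - card A)"
    using assms by (intro binomial_diff_antimono) auto
  also have "\<dots> = card {B. B \<subseteq> X - A \<and> card B = R - card A}"
    using assms fA by (simp add: n_subsets card_Diff_subset)
  also have "\<dots> \<le> card {C. C \<subseteq> X \<and> card C = R \<and> A \<subseteq> C}"
  proof (rule card_inj_on_le[where f = "\<lambda>B. B \<union> A"])
    show "inj_on (\<lambda>B. B \<union> A) {B. B \<subseteq> X - A \<and> card B = R - card A}" by (auto simp: inj_on_def)
    show "(\<lambda>B. B \<union> A) ` {B. B \<subseteq> X - A \<and> card B = R - card A} \<subseteq> {C. C \<subseteq> X \<and> card C = R \<and> A \<subseteq> C}"
    proof safe
      fix B assume B: "B \<subseteq> X - A" "card B = R - card A"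
      then have "finite B" "B \<inter> A = {}" using assms(1) finite_subset[of B X] by auto
      then show "card (B \<union> A) = R" using B fA assms by (simp add: card_Un_disjoint)
    qed (use assms in auto)
    show "finite {C. C \<subseteq> X \<and> card C = R \<and> A \<subseteq> C}" using assms by simp
  qed
  finally show ?thesis .
qed

lemma measurable_succeeded:
  assumes "finite P" "\<And>v r. v \<in> P \<Longrightarrow> r < s \<Longrightarrow> Measurable.pred N (\<lambda>x. V x v r)"
  shows "Measurable.pred N (\<lambda>x. u \<in> succeeded P (V x) s)"
  using assms(2)
proof (induction s arbitrary: u)
  case (Suc s)
  have [measurable]: "Measurable.pred N (\<lambda>x. v \<in> succeeded P (V x) s)" for v
    using Suc by simp
  have V: "Measurable.pred N (\<lambda>x. V x v s)" if "v \<in> P" for v using Suc.prems that by simp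
  have "Measurable.pred N (\<lambda>x. u \<in> succeeded P (V x) s \<or>
      u \<in> P \<and> (\<forall>v\<in>P. (V x v s \<and> v \<notin> succeeded P (V x) s) = (v = u)))"
    using assms(1) V by (intro pred_intros_logic pred_intros_finite) auto
  moreover have "u \<in> succeeded P (V x) (Suc s) \<longleftrightarrow> u \<in> succeeded P (V x) s \<or>
      u \<in> P \<and> (\<forall>v\<in>P. (V x v s \<and> v \<notin> succeeded P (V x) s) = (v = u))" for x
    by auto
  ultimately show ?case by simp
qed simp

section \<open>Bursts, blockers and the attempts they enforce\<close>

context local_protocol
begin

definition attempts_in :: "nat \<Rightarrow> nat \<Rightarrow> (nat \<Rightarrow> bool) \<Rightarrow> nat set" where
  "attempts_in a L x = {i \<in> {a..<L}. x i}"

definition first_attempt :: "nat \<Rightarrow> (nat \<Rightarrow> bool) \<Rightarrow> bool" where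
  "first_attempt f x \<longleftrightarrow> x f \<and> (\<forall>i<f. \<not> x i)"

lemma sets_attempts_in: "{x. P (attempts_in a L x)} \<in> sets D"
proof -
  have "{x. attempts_in a L x = A} \<in> sets D" for A
  proof -
    have "{x \<in> space D. \<forall>i. (i \<in> {a..<L} \<and> x i) = (i \<in> A)} \<in> sets D" by measurable
    then show ?thesis by (simp add: space_D attempts_in_def set_eq_iff)
  qed
  then have "(\<Union>A\<in>{A \<in> Pow {a..<L}. P A}. {x. attempts_in a L x = A}) \<in> sets D"
    by (intro sets.finite_UN) auto
  also have "(\<Union>A\<in>{A \<in> Pow {a..<L}. P A}. {x. attempts_in a L x = A}) = {x. P (attempts_in a L x)}"
    by (auto simp: attempts_in_def)
  finally show ?thesis .
qed

lemma sets_first_attempt: "{x. first_attempt f x} \<in> sets D"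
proof -
  have "{x \<in> space D. x f \<and> (\<forall>i\<in>{..<f}. \<not> x i)} \<in> sets D" by measurable
  then show ?thesis by (simp add: space_D first_attempt_def Ball_def)
qed

text \<open>The parties of a burst at slot 0, run on their own.\<close>

definition lucky :: "nat \<Rightarrow> nat \<Rightarrow> draws \<Rightarrow> nat set" where
  "lucky B a Y = succeeded {..<B} (wants (\<lambda>_. 0) Y) (Suc a)"

lemma events_lucky: "{Y. u \<in> lucky B a Y} \<in> events"
  using events_succeeded[OF D, of B "\<lambda>_. 0" u "Suc a"]
  by (simp add: lucky_def space_draws mono_on_def del: succeeded.simps)

text \<open>At most \<open>Suc a\<close>, hence at most half, of the burst succeeds up to slot
  \<open>a\<close>, so the average probability of being lucky is at most 1/2. Subtracting it from
  3/4 leaves 1/4 for some party.\<close>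

lemma ex_unlucky:
  assumes B: "2 * Suc a \<le> B" and q: "3 / 4 \<le> D.prob {x. card (attempts_in a L x) \<le> m}"
  shows "\<exists>u<B. 1 / 4 \<le> prob {Y. u \<notin> lucky B a Y \<and> card (attempts_in a L (Y (u, 0))) \<le> m}"
proof (rule ccontr)
  assume "\<not> ?thesis"
  then have less: "prob {Y. u \<notin> lucky B a Y \<and> card (attempts_in a L (Y (u, 0))) \<le> m} < 1 / 4" if "u < B" for u
    using that by force
  let ?F = "\<lambda>u. {Y. card (attempts_in a L (Y (u, 0))) \<le> m}"
  have F: "?F u \<in> events" "prob (?F u) = D.prob {x. card (attempts_in a L x) \<le> m}" for u
    using events_draw[OF sets_attempts_in[where P = "\<lambda>A. card A \<le> m"], of "(u, 0)"]
      prob_draw[OF sets_attempts_in[where P = "\<lambda>A. card A \<le> m"], of "(u, 0)"] by simp_all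
  have "3 / 4 - prob {Y. u \<in> lucky B a Y} \<le> prob {Y. u \<notin> lucky B a Y \<and> card (attempts_in a L (Y (u, 0))) \<le> m}" for u
  proof -
    have "{Y. u \<notin> lucky B a Y \<and> card (attempts_in a L (Y (u, 0))) \<le> m} = ?F u - {Y. u \<in> lucky B a Y}" by auto
    then have ev: "{Y. u \<notin> lucky B a Y \<and> card (attempts_in a L (Y (u, 0))) \<le> m} \<in> events"
      using F(1) events_lucky by auto
    have "prob (?F u) \<le> prob ({Y. u \<in> lucky B a Y} \<union> {Y. u \<notin> lucky B a Y \<and> card (attempts_in a L (Y (u, 0))) \<le> m})"
      using events_lucky ev by (intro finite_measure_mono) auto
    also have "\<dots> \<le> prob {Y. u \<in> lucky B a Y} + prob {Y. u \<notin> lucky B a Y \<and> card (attempts_in a L (Y (u, 0))) \<le> m}"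
      using events_lucky ev by (rule measure_Un_le)
    finally show ?thesis using F(2)[of u] q by linarith
  qed
  then have "(\<Sum>u<B. 3 / 4 - prob {Y. u \<in> lucky B a Y}) \<le>
      (\<Sum>u<B. prob {Y. u \<notin> lucky B a Y \<and> card (attempts_in a L (Y (u, 0))) \<le> m})"
    by (intro sum_mono)
  also have "\<dots> < (\<Sum>u<B. 1 / 4)"
  proof (rule sum_strict_mono)
    have "0 \<in> {..<B}" using B by simp
    then show "{..<B} \<noteq> {}" by blast
  qed (use less in auto)
  finally have "real B / 2 < (\<Sum>u<B. prob {Y. u \<in> lucky B a Y})"
    by (simp add: sum_subtractf)
  also have "\<dots> = expectation (\<lambda>Y. \<Sum>u<B. indicat_real {Y. u \<in> lucky B a Y} Y)"
    using events_lucky by (subst Bochner_Integration.integral_sum) (auto simp: emeasure_eq_measure)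
  also have "\<dots> \<le> expectation (\<lambda>_. real (Suc a))"
  proof (rule integral_mono)
    show "integrable draws (\<lambda>Y. \<Sum>u<B. indicat_real {Y. u \<in> lucky B a Y} Y)"
      using events_lucky by (intro Bochner_Integration.integrable_sum) (auto simp: emeasure_eq_measure)
    fix Y
    have "(\<Sum>u<B. indicat_real {Y. u \<in> lucky B a Y} Y) = real (card {u \<in> {..<B}. u \<in> lucky B a Y})"
      by (simp add: indicator_def of_bool_def sum.If_cases Int_def)
    also have "\<dots> \<le> real (card (lucky B a Y))"
      unfolding of_nat_le_iff lucky_def by (intro card_mono finite_succeeded) auto
    also have "\<dots> \<le> real (Suc a)"
      unfolding of_nat_le_iff lucky_def by (rule card_succeeded_le)
    finally show "(\<Sum>u<B. indicat_real {Y. u \<in> lucky B a Y} Y) \<le> real (Suc a)" .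
  qed simp
  finally show False using B by (simp add: prob_space)
qed

text \<open>Each slot \<open>Suc i\<close> with \<open>i \<in> C\<close> gets one blocker, which requests it with its first attempt, a fixed
  number \<open>f\<close> of steps after its wake-up, with constant probability.\<close>

definition blockers :: "nat \<Rightarrow> nat \<Rightarrow> nat set \<Rightarrow> nat \<Rightarrow> nat" where
  "blockers B f C u = (if u < B then 0 else sorted_list_of_set C ! (u - B) - f)"

lemma mono_blockers:
  assumes "finite C" "n \<le> B + card C"
  shows "mono_on {..<n} (blockers B f C)"
proof (rule mono_onI)
  fix x y assume "x \<in> {..<n}" "y \<in> {..<n}" "x \<le> y"
  then show "blockers B f C x \<le> blockers B f C y"
    unfolding blockers_def using assms
    by (auto intro!: diff_le_mono sorted_nth_mono simp: sorted_sorted_list_of_set)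
qed

definition blocker :: "nat \<Rightarrow> nat set \<Rightarrow> nat \<Rightarrow> nat" where
  "blocker B C i = B + (SOME j. j < card C \<and> sorted_list_of_set C ! j = i)"

lemma blocker:
  assumes "finite C" "i \<in> C"
  shows "B \<le> blocker B C i" "blocker B C i < B + card C" "blockers B f C (blocker B C i) = i - f"
    "sorted_list_of_set C ! (blocker B C i - B) = i"
proof -
  have "\<exists>j. j < card C \<and> sorted_list_of_set C ! j = i"
    using assms by (metis in_set_conv_nth length_sorted_list_of_set set_sorted_list_of_set)
  from someI_ex[OF this] show "B \<le> blocker B C i" "blocker B C i < B + card C"
    "blockers B f C (blocker B C i) = i - f" "sorted_list_of_set C ! (blocker B C i - B) = i"
    by (auto simp: blocker_def blockers_def)
qed

text \<open>Up to slot \<open>a\<close> the additional parties cannot help \<open>u\<close>, by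
  \<open>succeeded_antimono\<close>. A later slot \<open>r\<close> that \<open>u\<close> requests
  belongs to entry \<open>r - 1\<close>; its blocker was woken up in slot \<open>r - 1 - f\<close>
  and makes its very first attempt in slot \<open>r\<close>, so it cannot have succeeded before and
  collides with \<open>u\<close>.\<close>

lemma not_succeeded_if_blocked:
  assumes C: "finite C" "C \<subseteq> {a..<L}" "n = B + card C" and f: "f \<le> a" and u: "u < B"
    and unlucky: "u \<notin> lucky B a Y" and A: "attempts_in a L (Y (u, 0)) \<subseteq> C"
    and blocked: "\<And>i. i \<in> attempts_in a L (Y (u, 0)) \<Longrightarrow> first_attempt f (Y (blocker B C i, blockers B f C (blocker B C i)))"
  shows "u \<notin> succeeded {..<n} (wants (blockers B f C) Y) (Suc L)"
proof
  let ?w = "blockers B f C" and ?S = "\<lambda>s. succeeded {..<n} (wants (blockers B f C) Y) s"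
  assume "u \<in> ?S (Suc L)"
  then obtain r where r: "r < Suc L" "{v \<in> {..<n}. wants ?w Y v r \<and> v \<notin> ?S r} = {u}"
    by (rule succeeded_Suc_cases)
  show False
  proof (cases "r \<le> a")
    case True
    have "u \<in> ?S (Suc r)" using r(2) by auto
    then have "u \<in> ?S (Suc a)" using True succeeded_mono[of "Suc r" "Suc a" "{..<n}"] by (auto simp del: succeeded.simps)
    then have "u \<in> succeeded {..<B} (wants ?w Y) (Suc a)"
      using succeeded_antimono[of "{..<B}" "{..<n}" u] C(3) u by (auto simp del: succeeded.simps)
    also have "succeeded {..<B} (wants ?w Y) (Suc a) = lucky B a Y"
      unfolding lucky_def by (rule succeeded_cong) (simp add: wants_def blockers_def)
    finally show False using unlucky by simp
  next
    case False
    have "wants ?w Y u r" using r(2) by blast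
    then have "Y (u, 0) (r - 1)" using u by (simp add: wants_def blockers_def)
    then have i: "r - 1 \<in> attempts_in a L (Y (u, 0))" using False r(1) by (auto simp: attempts_in_def)
    define v where "v = blocker B C (r - 1)"
    have v: "B \<le> v" "v < n" "?w v = r - 1 - f"
      using blocker[OF C(1), of "r - 1" B] i A C(3) by (auto simp: v_def)
    have first: "first_attempt f (Y (v, ?w v))" using blocked[OF i] by (simp add: v_def)
    have "wants ?w Y v r" using first False f by (auto simp: wants_def v(3) first_attempt_def)
    moreover have "v \<notin> ?S r"
    proof
      assume "v \<in> ?S r"
      then obtain r' where r': "r' < r" "wants ?w Y v r'" using succeeded_wants(2) by blast
      then have "r' - Suc (r - 1 - f) < f" using False f by (auto simp: wants_def v(3))
      then show False using r'(2) first by (auto simp: wants_def v(3) first_attempt_def)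
    qed
    ultimately have "v \<in> {u}" using r(2) v(2) by blast
    then show False using v(1) u by simp
  qed
qed

text \<open>The first condition depends only on the draws of the burst, and each blocker contributes
  a condition on its own draw. The independent groups are indexed by options: \<open>None\<close> is
  the burst, \<open>Some i\<close> the blocker for entry \<open>i\<close>.\<close>

lemma prob_blocked:
  fixes B C f a L u A
  defines "E \<equiv> {Y. (u \<notin> lucky B a Y \<and> attempts_in a L (Y (u, 0)) = A) \<and>
      (\<forall>i\<in>A. first_attempt f (Y (blocker B C i, blockers B f C (blocker B C i))))}"
  assumes C: "finite C" "A \<subseteq> C" and u: "u < B"
  shows "prob E = prob {Y. u \<notin> lucky B a Y \<and> attempts_in a L (Y (u, 0)) = A} *
      D.prob {x. first_attempt f x} ^ card A"
    and "E \<in> events"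
proof -
  let ?w = "blockers B f C" and ?v = "blocker B C"
  let ?I = "insert None (Some ` A)"
  let ?K = "\<lambda>j. case j of None \<Rightarrow> {..<B} | Some i \<Rightarrow> {?v i}"
  let ?X = "\<lambda>j Y. \<lambda>u\<in>?K j. Y (u, ?w u)"
  have fA: "finite A" using C finite_subset by blast
  have v: "B \<le> ?v i" if "i \<in> A" for i
    using blocker(1)[OF C(1), of i B] C(2) that by blast
  have v_inj: "i = i'" if "?v i = ?v i'" "i \<in> A" "i' \<in> A" for i i'
    using blocker(4)[OF C(1), of i B] blocker(4)[OF C(1), of i' B] C(2) that by auto
  have ind: "indep_vars (\<lambda>j. PiM (?K j) (\<lambda>_. D)) ?X ?I"
    by (rule indep_vars_restrict[OF indep_draws])
      (auto simp: disjoint_family_on_def dest: v v_inj split: option.splits)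
  let ?G = "\<lambda>g. u \<notin> succeeded {..<B} (\<lambda>v s. 0 < s \<and> g v (s - Suc 0)) (Suc a) \<and> attempts_in a L (g u) = A"
  let ?S = "\<lambda>j. case j of None \<Rightarrow> {g \<in> space (PiM {..<B} (\<lambda>_. D)). ?G g}
    | Some i \<Rightarrow> {g \<in> space (PiM {?v i} (\<lambda>_. D)). first_attempt f (g (?v i))}"
  have S: "?S j \<in> sets (PiM (?K j) (\<lambda>_. D))" for j
  proof (cases j)
    case None
    have "Measurable.pred (PiM {..<B} (\<lambda>_. D)) (\<lambda>g. u \<in> succeeded {..<B} (\<lambda>v s. 0 < s \<and> g v (s - Suc 0)) (Suc a))"
    proof (rule measurable_succeeded)
      fix v r assume "v \<in> {..<B}"
      then have "Measurable.pred (PiM {..<B} (\<lambda>_. D)) (\<lambda>g. g v (r - Suc 0))"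
        using measurable_compose[OF measurable_component_singleton[of v "{..<B}" "\<lambda>_. D"] measurable_entry_D[of "r - Suc 0"]]
        by simp
      then show "Measurable.pred (PiM {..<B} (\<lambda>_. D)) (\<lambda>g. 0 < r \<and> g v (r - Suc 0))"
        by (cases "0 < r") auto
    qed simp
    moreover have "Measurable.pred (PiM {..<B} (\<lambda>_. D)) (\<lambda>g. attempts_in a L (g u) = A)"
    proof -
      have "Measurable.pred D (\<lambda>x. attempts_in a L x = A)"
        using sets_attempts_in[where P = "\<lambda>X. X = A"] by (simp add: pred_def space_D)
      from measurable_compose[OF measurable_component_singleton[of u "{..<B}" "\<lambda>_. D"] this] u
      show ?thesis by simp
    qed
    ultimately have "Measurable.pred (PiM {..<B} (\<lambda>_. D)) ?G" by (intro pred_intros_logic)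
    then show ?thesis using None by (simp add: pred_def)
  next
    case (Some i)
    have "Measurable.pred D (first_attempt f)"
      using sets_first_attempt[of f] by (simp add: pred_def space_D)
    from measurable_compose[OF measurable_component_singleton[of "?v i" "{?v i}" "\<lambda>_. D"] this]
    show ?thesis using Some by (simp add: pred_def)
  qed
  have sp: "(\<lambda>u\<in>K. Y (u, ?w u)) \<in> space (PiM K (\<lambda>_. D))" for K and Y :: draws
    by (auto simp: space_PiM space_D)
  have w0: "?w v = 0" if "v < B" for v using that by (simp add: blockers_def)
  have None: "?X None -` ?S None \<inter> space draws = {Y. u \<notin> lucky B a Y \<and> attempts_in a L (Y (u, 0)) = A}"
  proof -
    have s: "succeeded {..<B} (\<lambda>v s. 0 < s \<and> (\<lambda>u\<in>{..<B}. Y (u, ?w u)) v (s - Suc 0)) (Suc a) = lucky B a Y" for Y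
      unfolding lucky_def by (rule succeeded_cong) (auto simp: wants_def w0)
    have u0: "(\<lambda>u\<in>{..<B}. Y (u, ?w u)) u = Y (u, 0)" for Y :: draws using u by (simp add: w0)
    show ?thesis
      unfolding vimage_def option.case
      by (simp only: mem_Collect_eq sp s u0 simp_thms space_draws Int_UNIV_right)
  qed
  have Some: "?X (Some i) -` ?S (Some i) \<inter> space draws = {Y. first_attempt f (Y (?v i, ?w (?v i)))}" for i
    using sp by (auto simp: space_draws)
  have ev: "?X j -` ?S j \<inter> space draws \<in> events" if "j \<in> ?I" for j
  proof -
    have "?X j \<in> measurable draws (PiM (?K j) (\<lambda>_. D))"
      using ind that unfolding indep_vars_def by blast
    from measurable_sets[OF this S[of j]] show ?thesis .
  qed
  have E: "E = (\<Inter>j\<in>?I. ?X j -` ?S j \<inter> space draws)"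
  proof -
    have I: "(\<Inter>j\<in>?I. Q j) = Q None \<inter> (\<Inter>i\<in>A. Q (Some i))" for Q :: "nat option \<Rightarrow> draws set"
      by auto
    show ?thesis unfolding I None Some E_def by auto
  qed
  show "E \<in> events" unfolding E using fA by (intro sets.finite_INT ev) auto
  have "prob E = (\<Prod>j\<in>?I. prob (?X j -` ?S j \<inter> space draws))"
    unfolding E using fA by (intro indep_varsD[OF ind] S) auto
  also have "\<dots> = prob (?X None -` ?S None \<inter> space draws) * (\<Prod>i\<in>A. prob (?X (Some i) -` ?S (Some i) \<inter> space draws))"
    using fA by (subst prod.insert) (auto simp: prod.reindex)
  also have "\<dots> = prob {Y. u \<notin> lucky B a Y \<and> attempts_in a L (Y (u, 0)) = A} * D.prob {x. first_attempt f x} ^ card A"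
    unfolding None Some using prob_draw[OF sets_first_attempt] by simp
  finally show "prob E = prob {Y. u \<notin> lucky B a Y \<and> attempts_in a L (Y (u, 0)) = A} *
      D.prob {x. first_attempt f x} ^ card A" .
qed

lemma events_unlucky: "{Y. u \<notin> lucky B a Y \<and> P (attempts_in a L (Y (u, 0)))} \<in> events"
proof -
  have "{Y. P (attempts_in a L (Y (u, 0)))} - {Y. u \<in> lucky B a Y} \<in> events"
    using events_draw[OF sets_attempts_in[where P = P], of "(u, 0)"] events_lucky by (intro sets.Diff) auto
  moreover have "{Y. P (attempts_in a L (Y (u, 0)))} - {Y. u \<in> lucky B a Y} =
      {Y. u \<notin> lucky B a Y \<and> P (attempts_in a L (Y (u, 0)))}" by auto
  ultimately show ?thesis by simp
qed

text \<open>If few attempts were likely, some party \<open>u\<close> of the burst would be unlucky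
  and have an attempt set \<open>A\<close> of size at most \<open>m\<close> with probability at
  least 1/4. The \<open>R\<close> remaining parties can guard only \<open>R\<close> of the
  \<open>L - a\<close> slots, but a random choice \<open>C\<close> of guarded slots contains
  \<open>A\<close> with probability at least about \<open>((R - m) / (L - a)) ^ m\<close>, and then
  all of \<open>A\<close> is blocked with probability at least \<open>\<eta> ^ m\<close>. The
  product exceeds the failure probability that reliability allows.\<close>

lemma attempts_in_epoch:
  fixes n a L m f :: nat
  defines "\<eta> \<equiv> D.prob {x. first_attempt f x}" and "R \<equiv> n - n div 2"
  assumes rel: "reliable D n L" and a: "2 * Suc a \<le> n div 2" "f \<le> a"
    and R: "m \<le> R" "R \<le> L - a"
    and large: "4 / real n ^ 2 < (\<eta> * (real (R - m) / real (L - a))) ^ m"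
  shows "D.prob {x. card (attempts_in a L x) \<le> m} < 3 / 4"
proof (rule ccontr)
  assume neg: "\<not> ?thesis"
  define B where "B = n div 2"
  let ?X = "{a..<L}" and ?N = "L - a"
  obtain u where u: "u < B" and quarter: "1 / 4 \<le> prob {Y. u \<notin> lucky B a Y \<and> card (attempts_in a L (Y (u, 0))) \<le> m}"
    using ex_unlucky[of a B L m] a(1) neg by (auto simp: B_def)
  define g where "g A = prob {Y. u \<notin> lucky B a Y \<and> attempts_in a L (Y (u, 0)) = A}" for A
  define \<A> where "\<A> = {A. A \<subseteq> ?X \<and> card A \<le> m}"
  define \<C> where "\<C> = {C. C \<subseteq> ?X \<and> card C = R}"
  have fin: "finite \<A>" "finite \<C>" by (auto simp: \<A>_def \<C>_def)
  have \<eta>: "0 \<le> \<eta>" "\<eta> \<le> 1" by (auto simp: \<eta>_def)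
  have sum_g: "1 / 4 \<le> (\<Sum>A\<in>\<A>. g A)"
  proof -
    have "{Y. u \<notin> lucky B a Y \<and> card (attempts_in a L (Y (u, 0))) \<le> m} =
        (\<Union>A\<in>\<A>. {Y. u \<notin> lucky B a Y \<and> attempts_in a L (Y (u, 0)) = A})"
      by (auto simp: \<A>_def attempts_in_def)
    also have "prob \<dots> = (\<Sum>A\<in>\<A>. g A)"
      unfolding g_def using fin events_unlucky[where P = "\<lambda>X. X = _"]
      by (intro finite_measure_finite_Union) (auto simp: disjoint_family_on_def)
    finally show ?thesis using quarter by simp
  qed
  \<comment> \<open>For one fixed \<open>C\<close>: the events for different attempt sets are
    disjoint, and in each of them \<open>u\<close> fails.\<close>
  have schedule: "(\<Sum>A\<in>{A \<in> \<A>. A \<subseteq> C}. g A) * \<eta> ^ m \<le> 1 / real n ^ 2" if C: "C \<in> \<C>" for C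
  proof -
    have fC: "finite C" "C \<subseteq> ?X" "n = B + card C"
      using C finite_subset[of C ?X] by (auto simp: \<C>_def R_def B_def)
    let ?w = "blockers B f C"
    let ?E = "\<lambda>A. {Y. (u \<notin> lucky B a Y \<and> attempts_in a L (Y (u, 0)) = A) \<and>
      (\<forall>i\<in>A. first_attempt f (Y (blocker B C i, ?w (blocker B C i))))}"
    let ?S = "{Y. u \<in> succeeded {..<n} (wants ?w Y) (Suc L)}"
    have mono: "mono_on {..<n} ?w" using fC by (intro mono_blockers) auto
    have S: "?S \<in> events"
      using events_succeeded[OF D mono, of u "Suc L"] by (simp add: space_draws del: succeeded.simps)
    have "(\<Sum>A\<in>{A \<in> \<A>. A \<subseteq> C}. g A) * \<eta> ^ m = (\<Sum>A\<in>{A \<in> \<A>. A \<subseteq> C}. g A * \<eta> ^ m)"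
      by (rule sum_distrib_right)
    also have "\<dots> \<le> (\<Sum>A\<in>{A \<in> \<A>. A \<subseteq> C}. prob (?E A))"
    proof (rule sum_mono)
      fix A assume A: "A \<in> {A \<in> \<A>. A \<subseteq> C}"
      have "g A * \<eta> ^ m \<le> g A * \<eta> ^ card A"
        using A \<eta> by (intro mult_left_mono power_decreasing) (auto simp: \<A>_def g_def)
      also have "\<dots> = prob (?E A)"
        unfolding g_def \<eta>_def using A by (intro prob_blocked(1)[symmetric] fC(1) u) auto
      finally show "g A * \<eta> ^ m \<le> prob (?E A)" .
    qed
    also have "\<dots> = prob (\<Union>A\<in>{A \<in> \<A>. A \<subseteq> C}. ?E A)"
    proof (rule finite_measure_finite_Union[symmetric])
      show "?E ` {A \<in> \<A>. A \<subseteq> C} \<subseteq> events"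
        using prob_blocked(2)[OF fC(1) _ u] by blast
    qed (use fin in \<open>auto simp: disjoint_family_on_def\<close>)
    also have "\<dots> \<le> prob (space draws - ?S)"
    proof (rule finite_measure_mono)
      show "(\<Union>A\<in>{A \<in> \<A>. A \<subseteq> C}. ?E A) \<subseteq> space draws - ?S"
      proof
        fix Y assume "Y \<in> (\<Union>A\<in>{A \<in> \<A>. A \<subseteq> C}. ?E A)"
        then have "u \<notin> lucky B a Y" "attempts_in a L (Y (u, 0)) \<subseteq> C"
          "\<And>i. i \<in> attempts_in a L (Y (u, 0)) \<Longrightarrow> first_attempt f (Y (blocker B C i, ?w (blocker B C i)))"
          by auto
        from not_succeeded_if_blocked[OF fC a(2) u this]
        show "Y \<in> space draws - ?S" by (simp add: space_draws del: succeeded.simps)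
      qed
    qed (use S in auto)
    also have "\<dots> = 1 - prob ?S" using S by (rule prob_compl)
    also have "\<dots> \<le> 1 / real n ^ 2"
    proof -
      have "u < n" using u by (simp add: B_def)
      moreover have "?w u = 0" using u by (simp add: blockers_def)
      ultimately have "1 - 1 / real n ^ 2 \<le> prob ?S"
        using rel mono unfolding reliable_def by (metis (no_types, lifting) Collect_cong add_0 space_draws UNIV_I)
      then show ?thesis by simp
    qed
    finally show ?thesis .
  qed
  have card_\<C>: "card \<C> = ?N choose R" unfolding \<C>_def by (simp add: n_subsets)
  \<comment> \<open>Double counting of the pairs \<open>A \<subseteq> C\<close>, weighted by
    \<open>g A\<close>, replaces the random choice of \<open>C\<close>.\<close>
  have "1 / 4 * real ((?N - m) choose (R - m)) \<le> (\<Sum>A\<in>\<A>. g A) * real ((?N - m) choose (R - m))"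
    using sum_g by (intro mult_right_mono) auto
  also have "\<dots> \<le> (\<Sum>A\<in>\<A>. g A * real (card {C \<in> \<C>. A \<subseteq> C}))"
    unfolding sum_distrib_right
  proof (intro sum_mono mult_left_mono)
    fix A assume "A \<in> \<A>"
    then show "real ((?N - m) choose (R - m)) \<le> real (card {C \<in> \<C>. A \<subseteq> C})"
      using card_supersets_ge[of ?X A m R] R by (simp add: \<A>_def \<C>_def conj_assoc)
  qed (simp add: g_def)
  also have "\<dots> = (\<Sum>A\<in>\<A>. \<Sum>C\<in>{C \<in> \<C>. A \<subseteq> C}. g A)" by (simp add: mult.commute)
  also have "\<dots> = (\<Sum>C\<in>\<C>. \<Sum>A\<in>{A \<in> \<A>. A \<subseteq> C}. g A)"
    using fin by (rule sum.swap_restrict)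
  finally have "1 / 4 * real ((?N - m) choose (R - m)) * \<eta> ^ m \<le> (\<Sum>C\<in>\<C>. \<Sum>A\<in>{A \<in> \<A>. A \<subseteq> C}. g A) * \<eta> ^ m"
    using \<eta> by (intro mult_right_mono) auto
  also have "\<dots> = (\<Sum>C\<in>\<C>. (\<Sum>A\<in>{A \<in> \<A>. A \<subseteq> C}. g A) * \<eta> ^ m)"
    by (rule sum_distrib_right)
  also have "\<dots> \<le> (\<Sum>C\<in>\<C>. 1 / real n ^ 2)" by (intro sum_mono schedule)
  also have "\<dots> = real (?N choose R) / real n ^ 2" by (simp add: card_\<C>)
  finally have ub: "real ((?N - m) choose (R - m)) * \<eta> ^ m \<le> 4 / real n ^ 2 * real (?N choose R)"
    by (simp add: mult.commute)
  have ratio: "real (?N choose R) * real (R - m) ^ m \<le> real ((?N - m) choose (R - m)) * real ?N ^ m"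
  proof -
    have "real ((?N choose R) * (R - m) ^ m) \<le> real (((?N - m) choose (R - m)) * ?N ^ m)"
      unfolding of_nat_le_iff using R by (intro binomial_ratio) auto
    then show ?thesis by (simp only: of_nat_mult of_nat_power)
  qed
  have N: "0 < ?N" using a R by (auto simp: R_def)
  have pos: "0 < real (?N choose R)" using R by (simp add: zero_less_binomial)
  have "real (?N choose R) * (\<eta> * (real (R - m) / real ?N)) ^ m =
      (real (?N choose R) * real (R - m) ^ m) * \<eta> ^ m / real ?N ^ m"
    by (simp add: power_mult_distrib power_divide)
  also have "\<dots> \<le> (real ((?N - m) choose (R - m)) * real ?N ^ m) * \<eta> ^ m / real ?N ^ m"
    using ratio \<eta> by (intro divide_right_mono mult_right_mono) auto
  also have "\<dots> = real ((?N - m) choose (R - m)) * \<eta> ^ m" using N by simp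
  also note ub
  also have "4 / real n ^ 2 * real (?N choose R) = real (?N choose R) * (4 / real n ^ 2)" by (rule mult.commute)
  finally have "(\<eta> * (real (R - m) / real ?N)) ^ m \<le> 4 / real n ^ 2"
    using pos by (rule mult_left_le_imp_le)
  then show False using large by simp
qed

end

section \<open>The LocalClock lower bound\<close>

definition bound :: "nat \<Rightarrow> real" where
  "bound n = real n * ln (real n) / (ln (ln (real n)))\<^sup>2"

context local_protocol
begin

text \<open>A party that succeeds within \<open>L\<close> slots has attempted at least once, and one
  of the finitely many positions below \<open>L\<close> must be its first attempt with positive
  probability.\<close>

lemma reliable_attempts:
  assumes rel: "reliable D n L" and n: "2 \<le> n"
  shows "1 / 2 \<le> expected_attempts L" "\<exists>f. 0 < D.prob {x. first_attempt f x}"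
proof -
  let ?S = "{Y. 0 \<in> succeeded {..<n} (wants (\<lambda>_. 0) Y) (Suc L)}"
  have ev: "{x. \<exists>i<L. x i} \<in> D.events"
  proof -
    have "{x \<in> space D. \<exists>i\<in>{..<L}. x i} \<in> D.events" by measurable
    then show ?thesis by (simp add: space_D Bex_def)
  qed
  have "mono_on {..<n} (\<lambda>_. 0 :: nat)" by (simp add: mono_on_def)
  then have "1 - 1 / real n ^ 2 \<le> prob ?S"
    using rel n unfolding reliable_def by (force simp: space_draws simp del: succeeded.simps)
  moreover have "1 / real n ^ 2 \<le> 1 / 2 ^ 2"
    using n by (intro divide_left_mono power_mono) auto
  moreover have "prob ?S \<le> prob {Y. Y (0, 0) \<in> {x. \<exists>i<L. x i}}"
  proof (rule finite_measure_mono)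
    show "?S \<subseteq> {Y. Y (0, 0) \<in> {x. \<exists>i<L. x i}}"
    proof
      fix Y assume "Y \<in> ?S"
      then obtain r where r: "r < Suc L" "wants (\<lambda>_. 0) Y 0 r" using succeeded_wants(2) by blast
      then have "r - 1 < L \<and> Y (0, 0) (r - 1)" by (auto simp: wants_def)
      then show "Y \<in> {Y. Y (0, 0) \<in> {x. \<exists>i<L. x i}}" by blast
    qed
  qed (rule events_draw[OF ev])
  ultimately have half: "1 / 2 \<le> D.prob {x. \<exists>i<L. x i}"
    by (simp only: prob_draw[OF ev]) (simp add: power2_eq_square)
  have "{x. \<exists>i<L. x i} = (\<Union>i<L. {x. x i})" by auto
  then have "D.prob {x. \<exists>i<L. x i} \<le> expected_attempts L"
    unfolding expected_attempts_def attempt_prob_def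
    using sets_entry by (simp only:) (intro D.finite_measure_subadditive_finite, auto)
  then show "1 / 2 \<le> expected_attempts L" using half by simp
  show "\<exists>f. 0 < D.prob {x. first_attempt f x}"
  proof (rule ccontr)
    assume "\<not> ?thesis"
    then have zero: "D.prob {x. first_attempt f x} = 0" for f
      by (meson linorder_not_less measure_nonneg order.antisym)
    have "{x. \<exists>i<L. x i} \<subseteq> (\<Union>f<L. {x. first_attempt f x})"
    proof safe
      fix x :: "nat \<Rightarrow> bool" and i assume i: "i < L" "x i"
      then have "first_attempt (LEAST i. x i) x" "(LEAST i. x i) \<le> i"
        unfolding first_attempt_def by (auto intro: LeastI Least_le dest: not_less_Least)
      then show "x \<in> (\<Union>f<L. {x. first_attempt f x})" using i(1) by auto
    qed
    then have "D.prob {x. \<exists>i<L. x i} \<le> D.prob (\<Union>f<L. {x. first_attempt f x})"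
      using sets_first_attempt by (intro D.finite_measure_mono) auto
    also have "\<dots> \<le> (\<Sum>f<L. D.prob {x. first_attempt f x})"
      using sets_first_attempt by (intro D.finite_measure_subadditive_finite) auto
    finally show False using half zero by simp
  qed
qed

text \<open>Markov's inequality: more than \<open>m\<close> attempts occur with probability above
  1/4, so their expectation is at least \<open>(m + 1) / 4\<close>.\<close>

lemma sum_attempt_prob_ge:
  assumes "D.prob {x. card (attempts_in a L x) \<le> m} < 3 / 4"
  shows "real (m + 1) / 4 \<le> (\<Sum>i\<in>{a..<L}. attempt_prob i)"
proof -
  let ?E = "{x. \<not> card (attempts_in a L x) \<le> m}"
  have ev: "?E \<in> D.events" by (rule sets_attempts_in[where P = "\<lambda>A. \<not> card A \<le> m"])
  have "?E = space D - {x. card (attempts_in a L x) \<le> m}" by (auto simp: space_D)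
  then have "D.prob ?E = 1 - D.prob {x. card (attempts_in a L x) \<le> m}"
    using sets_attempts_in[where P = "\<lambda>A. card A \<le> m"] by (simp add: D.prob_compl)
  then have "1 / 4 \<le> D.prob ?E" using assms by simp
  then have "real (m + 1) / 4 \<le> real (m + 1) * D.prob ?E"
    using mult_left_mono[of "1 / 4" "D.prob ?E" "real (m + 1)"] by simp
  also have "\<dots> = D.expectation (\<lambda>x. real (m + 1) * indicat_real ?E x)"
    using ev by simp
  also have "\<dots> \<le> D.expectation (\<lambda>x. \<Sum>i\<in>{a..<L}. indicat_real {x. x i} x)"
  proof (rule integral_mono)
    show "integrable D (\<lambda>x. \<Sum>i\<in>{a..<L}. indicat_real {x. x i} x)"
      using sets_entry by (intro Bochner_Integration.integrable_sum) (auto simp: D.emeasure_eq_measure)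
    show "integrable D (\<lambda>x. real (m + 1) * indicat_real ?E x)"
      using ev by (intro integrable_mult_right) (auto simp: D.emeasure_eq_measure)
    fix x
    have "(\<Sum>i\<in>{a..<L}. indicat_real {x. x i} x) = real (card (attempts_in a L x))"
      by (simp add: indicator_def of_bool_def sum.If_cases Int_def attempts_in_def)
    then show "real (m + 1) * indicat_real ?E x \<le> (\<Sum>i\<in>{a..<L}. indicat_real {x. x i} x)"
      by (auto simp: indicator_def)
  qed
  also have "\<dots> = (\<Sum>i\<in>{a..<L}. attempt_prob i)"
    unfolding attempt_prob_def using sets_entry
    by (subst Bochner_Integration.integral_sum) (auto simp: D.emeasure_eq_measure)
  finally show ?thesis .
qed

text \<open>The position \<open>f\<close> is taken from a single reliable size and then kept while
  \<open>n\<close> grows, so that \<open>\<eta>\<close> is a positive constant.\<close>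

lemma eventually_many_attempts:
  assumes rel: "\<forall>\<^sub>F n in sequentially. reliable D n (nat \<lfloor>bound n\<rfloor>)"
  shows "\<forall>\<^sub>F n in sequentially. ln (real n) / (16 * ln (ln (real n))) \<le>
    (\<Sum>i\<in>{n div 8..<nat \<lfloor>bound n\<rfloor>}. attempt_prob i)"
proof -
  have "\<exists>n\<ge>2. reliable D n (nat \<lfloor>bound n\<rfloor>)"
    using eventually_conj[OF rel eventually_ge_at_top[of 2]] by (auto simp: eventually_sequentially)
  then obtain f where "0 < D.prob {x. first_attempt f x}" using reliable_attempts(2) by blast
  define \<eta> where "\<eta> = D.prob {x. first_attempt f x}"
  have \<eta>: "0 < \<eta>" using \<open>0 < D.prob {x. first_attempt f x}\<close> by (simp add: \<eta>_def)
  have "\<forall>\<^sub>F n :: nat in sequentially. ln (real n) / (4 * ln (ln (real n))) \<le> real n / 4"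
    "\<forall>\<^sub>F n :: nat in sequentially. 2 * real n + 1 \<le> real n * ln (real n) / (ln (ln (real n)))\<^sup>2"
    "\<forall>\<^sub>F n :: nat in sequentially. 1 / ln (real n) ^ 2 \<le> \<eta> * ((ln (ln (real n)))\<^sup>2 / (4 * ln (real n)))"
    "\<forall>\<^sub>F n :: nat in sequentially. 4 / real n ^ 2 < exp (- (ln (real n) / 2))"
    "\<forall>\<^sub>F n :: nat in sequentially. 1 \<le> ln (real n)"
    "\<forall>\<^sub>F n :: nat in sequentially. 1 \<le> ln (ln (real n))"
    using \<eta> by real_asymp+
  then show ?thesis
    using rel eventually_ge_at_top[of 16] eventually_ge_at_top[of "8 * f"]
  proof eventually_elim
    case (elim n)
    define a where "a = n div 8"
    define L where "L = nat \<lfloor>bound n\<rfloor>"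
    \<comment> \<open>The assumed latency makes the base of the power in
      \<open>attempts_in_epoch\<close> at least \<open>1 / ln n ^ 2\<close>, with room to absorb
      \<open>\<eta>\<close>. With this \<open>m\<close> its power is at least
      \<open>n powr (- 1 / 2)\<close>, far above \<open>4 / n\<^sup>2\<close>.\<close>
    define m where "m = nat \<lfloor>ln (real n) / (4 * ln (ln (real n)))\<rfloor>"
    define R where "R = n - n div 2"
    have pos: "0 \<le> ln (real n) / (4 * ln (ln (real n)))" using elim(5,6) by simp
    have m: "real m \<le> ln (real n) / (4 * ln (ln (real n)))" "ln (real n) / (4 * ln (ln (real n))) \<le> real (m + 1)"
      using pos unfolding m_def by linarith+
    have "2 * real n + 1 \<le> bound n" using elim(2) by (simp add: bound_def)
    then have L: "real L \<le> bound n" "2 * real n \<le> real L"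
      unfolding L_def by linarith+
    have R: "real n / 2 \<le> real R" unfolding R_def by linarith
    have mR: "m \<le> R" "real n / 4 \<le> real (R - m)" using m(1) R elim(1) by (auto simp: of_nat_diff)
    have n0: "0 < n" using elim(8) by simp
    have RL: "R \<le> L - a"
    proof -
      have "2 * n \<le> L" using L(2) by linarith
      then show ?thesis by (simp add: R_def a_def)
    qed
    have La: "0 < L - a" using RL n0 by (simp add: R_def)
    have "D.prob {x. card (attempts_in a L x) \<le> m} < 3 / 4"
    proof (rule attempts_in_epoch[where f = f and n = n])
      show "reliable D n L" using elim(7) by (simp add: L_def)
      show "2 * Suc a \<le> n div 2" using elim(8) unfolding a_def by presburger
      show "f \<le> a" using div_le_mono[OF elim(9), of 8] by (simp add: a_def)
      show "m \<le> n - n div 2" "n - n div 2 \<le> L - a" using mR(1) RL by (simp_all only: R_def)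
      have "(ln (ln (real n)))\<^sup>2 / (4 * ln (real n)) = (real n / 4) / bound n"
        using elim(5,6) n0 by (simp add: bound_def field_simps)
      also have "\<dots> \<le> real (R - m) / real (L - a)"
        using mR(2) L La by (intro frac_le) auto
      finally have "1 / ln (real n) ^ 2 \<le> \<eta> * (real (R - m) / real (L - a))"
        using elim(3) \<eta> by (meson less_imp_le mult_left_mono order_trans)
      then have "(1 / ln (real n) ^ 2) ^ m \<le> (\<eta> * (real (R - m) / real (L - a))) ^ m"
        by (intro power_mono) auto
      moreover have "(1 / ln (real n) ^ 2) ^ m = exp (- (2 * ln (ln (real n)) * real m))"
      proof -
        have "1 / ln (real n) ^ 2 = exp (- (2 * ln (ln (real n))))"
          using elim(5) by (simp add: exp_minus exp_of_nat_mult[of 2, simplified] inverse_eq_divide)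
        then show ?thesis by (simp add: exp_of_nat_mult[symmetric] mult.commute)
      qed
      moreover have "exp (- (ln (real n) / 2)) \<le> exp (- (2 * ln (ln (real n)) * real m))"
        using m(1) elim(6) by (simp add: field_simps)
      ultimately have "4 / (real n)\<^sup>2 < (\<eta> * (real (R - m) / real (L - a))) ^ m"
        using elim(4) by linarith
      then show "4 / (real n)\<^sup>2 < (D.prob {x. first_attempt f x} * (real (n - n div 2 - m) / real (L - a))) ^ m"
        by (simp only: \<eta>_def R_def)
    qed
    from sum_attempt_prob_ge[OF this] have sum: "real (m + 1) / 4 \<le> (\<Sum>i\<in>{a..<L}. attempt_prob i)" .
    have "ln (real n) / (16 * ln (ln (real n))) = ln (real n) / (4 * ln (ln (real n))) / 4" by simp
    also have "\<dots> \<le> real (m + 1) / 4" using m(2) by (rule divide_right_mono) simp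
    also note sum
    finally show ?case by (simp only: a_def L_def)
  qed
qed

text \<open>The epochs of geometrically growing sizes between \<open>N powr (1 / 4)\<close> and \<open>sqrt N\<close> are disjoint.\<close>

lemma eventually_expected_attempts:
  assumes rel: "\<forall>\<^sub>F n in sequentially. reliable D n (nat \<lfloor>bound n\<rfloor>)"
  shows "\<forall>\<^sub>F N :: nat in sequentially. \<exists>b. real N powr (1 / 4) \<le> real b \<and> real b \<le> 2 * sqrt (real N) \<and>
    (ln (real N))\<^sup>2 / (1024 * (ln (ln (real N)))\<^sup>2) \<le> expected_attempts b"
proof -
  from eventually_many_attempts[OF rel] obtain n1 where n1:
    "\<And>n. n1 \<le> n \<Longrightarrow> ln (real n) / (16 * ln (ln (real n))) \<le> (\<Sum>i\<in>{n div 8..<nat \<lfloor>bound n\<rfloor>}. attempt_prob i)"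
    by (auto simp: eventually_sequentially)
  have "\<forall>\<^sub>F N :: nat in sequentially. max (real n1) 1 \<le> real N powr (1 / 4)"
    "\<forall>\<^sub>F N :: nat in sequentially. 2 * sqrt (real N) \<le> real N"
    "\<forall>\<^sub>F N :: nat in sequentially. 17 \<le> ln (real N)"
    "\<forall>\<^sub>F N :: nat in sequentially. 1 \<le> ln (ln (real N powr (1 / 4)))"
    "\<forall>\<^sub>F N :: nat in sequentially. 1 \<le> ln (ln (real N))"
    "\<forall>\<^sub>F N :: nat in sequentially. 2 \<le> ln (real N) / (8 * ln (ln (real N)))"
    by real_asymp+
  then show ?thesis
    using eventually_gt_at_top[of 1]
  proof eventually_elim
    case (elim N)
    \<comment> \<open>The ratio \<open>r\<close> is large enough for the epoch of size
      \<open>x\<close> to end before \<open>x * r / 8\<close>, where the next one starts. As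
      \<open>r \<le> (ln N)\<^sup>2\<close>, \<open>J\<close> epochs enlarge the size by at most
      \<open>N powr (1 / 4)\<close>. All sizes are at least \<open>N powr (1 / 4)\<close>, so
      \<open>ln x \<ge> ln N / 4\<close> and each epoch yields at least \<open>?y\<close>.\<close>
    define n0 where "n0 = nat \<lceil>real N powr (1 / 4)\<rceil>"
    define r where "r = nat \<lceil>16 * ln (real N)\<rceil>"
    define J where "J = nat \<lfloor>ln (real N) / (8 * ln (ln (real N)))\<rfloor>"
    let ?n = "\<lambda>k. n0 * r ^ k"
    let ?y = "ln (real N) / (64 * ln (ln (real N)))"
    have n0: "real N powr (1 / 4) \<le> real n0" "real n0 \<le> 2 * real N powr (1 / 4)"
      using elim(1) unfolding n0_def by linarith+
    have r: "16 * ln (real N) \<le> real r" "real r \<le> 17 * ln (real N)"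
      using elim(3) unfolding r_def by linarith+
    have J: "real J \<le> ln (real N) / (8 * ln (ln (real N)))" "ln (real N) / (16 * ln (ln (real N))) \<le> real J"
      using elim(6) unfolding J_def by linarith+
    have r1: "1 \<le> r" using r(1) elim(3) by linarith
    have "17 * ln (real N) \<le> ln (real N) * ln (real N)" using elim(3) by (intro mult_right_mono) auto
    then have "real r \<le> ln (real N) ^ 2" using r(2) by (simp add: power2_eq_square)
    then have "real (r ^ J) \<le> (ln (real N) ^ 2) ^ J"
      unfolding of_nat_power by (intro power_mono) auto
    also have "\<dots> = exp (2 * ln (ln (real N)) * real J)"
    proof -
      have "ln (real N) ^ 2 = exp (2 * ln (ln (real N)))"
        using elim(3) by (simp add: exp_of_nat_mult[of 2, simplified])
      then show ?thesis by (simp add: exp_of_nat2_mult)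
    qed
    also have "\<dots> \<le> exp (ln (real N) / 4)"
      using J(1) elim(5) by (simp add: field_simps)
    also have "\<dots> = real N powr (1 / 4)" using elim(7) by (simp add: powr_def)
    finally have rJ: "real (r ^ J) \<le> real N powr (1 / 4)" .
    have "real (?n J) \<le> 2 * real N powr (1 / 4) * real N powr (1 / 4)"
      unfolding of_nat_mult using n0(2) rJ by (intro mult_mono) auto
    also have "\<dots> = 2 * sqrt (real N)" by (simp add: powr_add[symmetric] powr_half_sqrt)
    finally have b: "real (?n J) \<le> 2 * sqrt (real N)" .
    have n_le: "real N powr (1 / 4) \<le> real (?n k)" "real (?n k) \<le> real N" if "k \<le> J" for k
    proof -
      have "n0 * 1 \<le> ?n k" using r1 by (intro mult_left_mono) auto
      then have "real n0 \<le> real (?n k)" by (simp only: mult_1_right of_nat_le_iff)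
      then show "real N powr (1 / 4) \<le> real (?n k)" using n0(1) by linarith
      have "?n k \<le> ?n J" using r1 that by (intro mult_left_mono power_increasing) auto
      then have "real (?n k) \<le> real (?n J)" by (simp only: of_nat_le_iff)
      then show "real (?n k) \<le> real N" using b elim(2) by linarith
    qed
    have "real k * ?y \<le> expected_attempts (?n k div 8)" if "k \<le> J" for k
      using that
    proof (induction k)
      case (Suc k)
      let ?L = "nat \<lfloor>bound (?n k)\<rfloor>"
      define x where "x = real (?n k)"
      have x: "real N powr (1 / 4) \<le> x" "x \<le> real N" using n_le[of k] Suc.prems by (auto simp: x_def)
      have x1: "1 \<le> x" using x(1) elim(1) by simp
      have lnx: "ln (real N) / 4 \<le> ln x" "ln x \<le> ln (real N)"
        using ln_mono[of "real N powr (1 / 4)" x] x x1 elim(7) by (auto simp: ln_powr)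
      have "ln (ln (real N) / 4) \<le> ln (ln x)" by (rule ln_mono) (use lnx elim(3) in auto)
      moreover have "1 \<le> ln (ln (real N) / 4)" using elim(4,7) by (simp add: ln_powr)
      ultimately have "1 \<le> ln (ln x)" by linarith
      moreover have "ln (ln x) \<le> ln (ln (real N))" by (rule ln_mono) (use lnx elim(3) in auto)
      ultimately have llx: "1 \<le> ln (ln x)" "ln (ln x) \<le> ln (ln (real N))" by auto
      have "?y = (ln (real N) / 4) / (16 * ln (ln (real N)))" by simp
      also have "\<dots> \<le> ln x / (16 * ln (ln x))"
        using lnx llx elim(3) by (intro frac_le) auto
      also have "\<dots> \<le> (\<Sum>i\<in>{?n k div 8..<?L}. attempt_prob i)"
      proof -
        have "real n1 \<le> real (?n k)" using x(1) elim(1) by (simp add: x_def)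
        then show ?thesis unfolding x_def of_nat_le_iff by (rule n1)
      qed
      finally have y: "?y \<le> (\<Sum>i\<in>{?n k div 8..<?L}. attempt_prob i)" .
      moreover have "0 < ?y" using elim(3,5) by simp
      \<comment> \<open>A positive sum excludes an empty epoch; this gives the order of the end
        points needed to concatenate the sums.\<close>
      ultimately have "{?n k div 8..<?L} \<noteq> {}" by (metis not_less sum.empty)
      then have "expected_attempts ?L = expected_attempts (?n k div 8) + (\<Sum>i\<in>{?n k div 8..<?L}. attempt_prob i)"
        unfolding expected_attempts_def lessThan_atLeast0
        by (intro sum.atLeastLessThan_concat[symmetric]) auto
      moreover have "real (Suc k) * ?y = ?y + real k * ?y" by (simp only: of_nat_Suc distrib_right mult_1)
      moreover have "real k * ?y \<le> expected_attempts (?n k div 8)" using Suc by simp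
      ultimately have "real (Suc k) * ?y \<le> expected_attempts ?L" using y by linarith
      also have "\<dots> \<le> expected_attempts (?n (Suc k) div 8)"
      proof (rule expected_attempts_mono)
        have "bound (?n k) = x * ln x / (ln (ln x))\<^sup>2" by (simp add: bound_def x_def)
        also have "\<dots> \<le> x * ln x / 1"
          using x1 lnx elim(3) llx by (intro divide_left_mono) auto
        also have "\<dots> \<le> x * ln (real N)" using x1 lnx by (simp add: mult_left_mono)
        also have "\<dots> \<le> x * real r / 8 - 1"
        proof -
          have "x * (16 * ln (real N)) \<le> x * real r" using r(1) x1 by (intro mult_left_mono) auto
          moreover have "1 * 1 \<le> x * ln (real N)" using x1 elim(3) by (intro mult_mono) auto
          ultimately show ?thesis by simp
        qed
        also have "x * real r = real (?n (Suc k))" by (simp add: x_def)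
        also have "real (?n (Suc k)) / 8 - 1 \<le> real (?n (Suc k) div 8)" by linarith
        finally show "?L \<le> ?n (Suc k) div 8" by linarith
      qed
      finally show ?case .
    qed (simp add: expected_attempts_def sum_nonneg attempt_prob_bounds)
    from this[of J] have "real J * ?y \<le> expected_attempts (?n J div 8)" by simp
    also have "\<dots> \<le> expected_attempts (?n J)" by (rule expected_attempts_mono) simp
    finally have "real J * ?y \<le> expected_attempts (?n J)" .
    moreover have "ln (real N) / (16 * ln (ln (real N))) * ?y \<le> real J * ?y"
      using J(2) elim(3,5) by (intro mult_right_mono) auto
    moreover have "ln (real N) / (16 * ln (ln (real N))) * ?y = (ln (real N))\<^sup>2 / (1024 * (ln (ln (real N)))\<^sup>2)"
      by (simp add: power2_eq_square)
    ultimately show ?case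
      using n_le(1)[of J] b by (intro exI[of _ "?n J"]) auto
  qed
qed

text \<open>The assumption is used with two constants: \<open>\<epsilon> = 1\<close> suffices to
  enforce many attempts, and \<open>\<epsilon> = 1 / 65536\<close> makes the latency shorter than
  the time for which these attempts allow jamming.\<close>

lemma not_eventually_fast:
  assumes fast: "\<And>\<epsilon>. 0 < \<epsilon> \<Longrightarrow> \<forall>\<^sub>F n in sequentially. \<exists>L. reliable D n L \<and> real L \<le> \<epsilon> * bound n"
  shows False
proof -
  have rel: "\<forall>\<^sub>F n in sequentially. reliable D n (nat \<lfloor>bound n\<rfloor>)"
    using fast[of 1]
  proof (rule eventually_mono)
    fix n assume "\<exists>L. reliable D n L \<and> real L \<le> 1 * bound n"
    then obtain L where L: "reliable D n L" "real L \<le> 1 * bound n" by blast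
    have "L \<le> nat \<lfloor>bound n\<rfloor>" using L(2) by linarith
    with L(1) show "reliable D n (nat \<lfloor>bound n\<rfloor>)" by (rule reliable_mono[OF D])
  qed simp
  then have "\<exists>n\<ge>2. reliable D n (nat \<lfloor>bound n\<rfloor>)"
    using eventually_conj[OF rel eventually_ge_at_top[of 2]] by (auto simp: eventually_sequentially)
  then obtain t0 where t0: "1 / 2 \<le> expected_attempts t0" using reliable_attempts(1) by blast
  have fast': "\<forall>\<^sub>F n in sequentially. \<exists>L. reliable D n L \<and> real L \<le> 1 / 65536 * bound n"
    by (rule fast) simp
  have "\<forall>\<^sub>F N :: nat in sequentially. real t0 < real N powr (1 / 4)"
    "\<forall>\<^sub>F N :: nat in sequentially. 17 \<le> ln (real N)"
    "\<forall>\<^sub>F N :: nat in sequentially. 17 * ln (real N) * (2 * sqrt (real N)) \<le> real N / 2"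
    "\<forall>\<^sub>F N :: nat in sequentially. 1 \<le> ln (ln (real N))"
    "\<forall>\<^sub>F N :: nat in sequentially. 1 \<le> ln (real N) / (8192 * (ln (ln (real N)))\<^sup>2)"
    "\<forall>\<^sub>F N :: nat in sequentially. real t0 \<le> real N * ln (real N) / (ln (ln (real N)))\<^sup>2 / 65536"
    "\<forall>\<^sub>F N :: nat in sequentially. (2 * sqrt (real N) + real N * ln (real N)) * exp (- (8 * ln (real N)) / 2) < exp (- real (t0 + 3)) / 2"
    by real_asymp+
  then have "\<forall>\<^sub>F N :: nat in sequentially. False"
    using eventually_expected_attempts[OF rel] fast' eventually_ge_at_top[of 2]
  proof eventually_elim
    case (elim N)
    from elim(9) obtain L where L: "reliable D N L" "real L \<le> 1 / 65536 * bound N" by blast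
    from elim(8) obtain b where b: "real N powr (1 / 4) \<le> real b" "real b \<le> 2 * sqrt (real N)"
      "(ln (real N))\<^sup>2 / (1024 * (ln (ln (real N)))\<^sup>2) \<le> expected_attempts b" by blast
    \<comment> \<open>At least half an attempt is expected within the fixed age \<open>t0\<close>,
      so \<open>\<rho>\<close> gives \<open>8 * ln N\<close> expected requests already in slot
      \<open>t0\<close>; \<open>h\<close> is the largest spacing that keeps this number when
      \<open>expected_attempts b\<close> is at least
      \<open>(ln N)\<^sup>2 / (1024 * (ln (ln N))\<^sup>2)\<close>. The error per slot is then
      \<open>exp (- 4 * ln N)\<close>, which beats the number of slots. At least
      \<open>N / 2\<close> parties remain for the strata and rounding \<open>h\<close> costs another
      factor 2, so jamming lasts for \<open>bound N / 32768\<close> slots.\<close>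
    define \<rho> where "\<rho> = nat \<lceil>16 * ln (real N)\<rceil>"
    define h where "h = nat \<lfloor>ln (real N) / (8192 * (ln (ln (real N)))\<^sup>2)\<rfloor>"
    define T where "T = b + (N - \<rho> * b) * h"
    have \<rho>: "16 * ln (real N) \<le> real \<rho>" "real \<rho> \<le> 17 * ln (real N)" "0 < \<rho>"
      using elim(2) unfolding \<rho>_def by linarith+
    have floor: "real (nat \<lfloor>z\<rfloor>) \<le> z \<and> z / 2 \<le> real (nat \<lfloor>z\<rfloor>) \<and> 0 < nat \<lfloor>z\<rfloor>"
      if "1 \<le> z" for z :: real
    proof -
      have "1 \<le> \<lfloor>z\<rfloor>" using that by (simp add: le_floor_iff)
      then show ?thesis by linarith
    qed
    have h: "real h \<le> ln (real N) / (8192 * (ln (ln (real N)))\<^sup>2)"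
      "ln (real N) / (16384 * (ln (ln (real N)))\<^sup>2) \<le> real h" "0 < h"
    proof -
      have half: "ln (real N) / (16384 * (ln (ln (real N)))\<^sup>2) = ln (real N) / (8192 * (ln (ln (real N)))\<^sup>2) / 2" by simp
      show "real h \<le> ln (real N) / (8192 * (ln (ln (real N)))\<^sup>2)"
        "ln (real N) / (16384 * (ln (ln (real N)))\<^sup>2) \<le> real h" "0 < h"
        using floor[OF elim(5)] unfolding h_def half by blast+
    qed
    have "real (\<rho> * b) \<le> 17 * ln (real N) * (2 * sqrt (real N))"
      unfolding of_nat_mult using \<rho>(2) b(2) elim(2) by (intro mult_mono) auto
    then have \<rho>b: "real (\<rho> * b) \<le> real N / 2" using elim(3) by linarith
    then have \<rho>bN: "\<rho> * b \<le> N" by linarith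
    have ll: "1 \<le> (ln (ln (real N)))\<^sup>2" using elim(4) by simp
    have "\<not> reliable D N L"
    proof (rule not_reliable_stratified[where \<rho> = \<rho> and b = b and h = h and c = "8 * ln (real N)" and T = T and ?t0.0 = t0])
      show "t0 < b" using b(1) elim(1) by linarith
      have "real t0 + real L \<le> bound N / 32768"
        using L(2) elim(6) by (simp add: bound_def)
      also have "\<dots> = (real N / 2) * (ln (real N) / (16384 * (ln (ln (real N)))\<^sup>2))"
        by (simp add: bound_def)
      also have "\<dots> \<le> real (N - \<rho> * b) * real h"
        using \<rho>b \<rho>bN h(2) elim(2) by (intro mult_mono) (auto simp: of_nat_diff)
      also have "\<dots> \<le> real T" by (simp add: T_def)
      finally show "t0 + L \<le> T" by linarith
      have "16 * ln (real N) * (1 / 2) \<le> real \<rho> * expected_attempts t0"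
        using \<rho>(1) t0 elim(2) by (intro mult_mono) auto
      then show "8 * ln (real N) \<le> real \<rho> * expected_attempts t0" by simp
      have "8 * ln (real N) * real h \<le> 8 * ln (real N) * (ln (real N) / (8192 * (ln (ln (real N)))\<^sup>2))"
        using h(1) elim(2) by (intro mult_left_mono) auto
      also have "\<dots> = (ln (real N))\<^sup>2 / (1024 * (ln (ln (real N)))\<^sup>2)" by (simp add: power2_eq_square)
      also note b(3)
      finally show "8 * ln (real N) \<le> expected_attempts b / real h"
        using h(3) by (simp add: field_simps)
      have "real h \<le> ln (real N) / 1"
        using h(1) by (rule order_trans) (use ll elim(2) in \<open>intro divide_left_mono, auto\<close>)
      then have "real (N - \<rho> * b) * real h \<le> real N * ln (real N)"
        by (intro mult_mono) auto
      then have "real T \<le> 2 * sqrt (real N) + real N * ln (real N)"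
        unfolding T_def using b(2) by simp
      then have "real T * exp (- (8 * ln (real N)) / 2) \<le>
          (2 * sqrt (real N) + real N * ln (real N)) * exp (- (8 * ln (real N)) / 2)"
        by (intro mult_right_mono) auto
      then show "real T * exp (- (8 * ln (real N)) / 2) < exp (- real (t0 + 3)) / 2"
        using elim(7) by linarith
    qed (use elim \<rho> \<rho>bN h T_def in auto)
    then show False using L(1) by blast
  qed
  then show False by simp
qed

end

theorem local_clock_lower_bound:
  "\<not> (\<exists>(D :: (nat \<Rightarrow> bool) measure) (f :: nat \<Rightarrow> real).
      local_clock_protocol D \<and>
      (\<forall>\<^sub>F n in sequentially. ereal_of_enat (whp_latency oblivious (\<lambda>_. D) n) = ereal (f n)) \<and>
      f \<in> o(\<lambda>n. real n * ln (real n) / (ln (ln (real n)))\<^sup>2))"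
proof safe
  fix D :: "(nat \<Rightarrow> bool) measure" and f :: "nat \<Rightarrow> real"
  assume D: "local_clock_protocol D"
    and latency: "\<forall>\<^sub>F n in sequentially. ereal_of_enat (whp_latency oblivious (\<lambda>_. D) n) = ereal (f n)"
    and f: "f \<in> o(\<lambda>n. real n * ln (real n) / (ln (ln (real n)))\<^sup>2)"
  interpret local_protocol D by standard (rule D)
  have "\<forall>\<^sub>F n in sequentially. \<exists>L. reliable D n L \<and> real L \<le> \<epsilon> * bound n" if \<epsilon>: "0 < \<epsilon>" for \<epsilon> :: real
  proof -
    have nonneg: "\<forall>\<^sub>F n in sequentially. 0 \<le> bound n" unfolding bound_def by real_asymp
    have "\<forall>\<^sub>F n in sequentially. norm (f n) \<le> \<epsilon> * norm (bound n)"
      using landau_o.smallD[OF f \<epsilon>] by (simp add: bound_def)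
    then show ?thesis using latency nonneg
    proof eventually_elim
      case (elim n)
      from elim(2) obtain L where L: "whp_latency oblivious (\<lambda>_. D) n = enat L" "real L = f n"
        by (cases "whp_latency oblivious (\<lambda>_. D) n") auto
      then show ?case using reliable_whp_latency[OF D L(1)] elim(1,3) by auto
    qed
  qed
  then show False by (rule not_eventually_fast)
qed

section \<open>Memoryless protocols\<close>

definition bernoulli_protocol :: "(nat \<Rightarrow> nat \<Rightarrow> real) \<Rightarrow> nat \<Rightarrow> (nat \<Rightarrow> bool) measure" where
  "bernoulli_protocol p t = PiM UNIV (\<lambda>i. measure_pmf (bernoulli_pmf (p t i)))"

lemma global_clock_bernoulli_protocol: "global_clock_protocol (bernoulli_protocol p)"
  unfolding global_clock_protocol_def local_clock_protocol_def bernoulli_protocol_def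
  by (auto intro!: prob_space_PiM sets_PiM_cong prob_space_measure_pmf)

text \<open>A finite tree containing every run, so that expectations over runs become finite
  sums.\<close>

primrec reach :: "adversary \<Rightarrow> nat \<Rightarrow> history set" where
  "reach A 0 = {[]}"
| "reach A (Suc s) = (\<Union>h\<in>reach A s. (\<lambda>B. h @ [B]) ` Pow {..<woken_before A h s})"

lemma length_reach: "h \<in> reach A s \<Longrightarrow> length h = s"
  by (induction s arbitrary: h) auto

lemma finite_reach: "finite (reach A s)"
  by (induction s) auto

lemma run_in_reach: "run A Y s \<in> reach A s"
proof (induction s)
  case (Suc s)
  have "next_attempts A Y (run A Y s) \<subseteq> {..<woken_before A (run A Y s) s}"
    using next_attempts_subset[of A Y "run A Y s"] by simp
  with Suc show ?case by auto
qed simp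

locale memoryless_protocol =
  fixes p :: "nat \<Rightarrow> nat \<Rightarrow> real"
  assumes p01: "\<And>t i. 0 \<le> p t i" "\<And>t i. p t i \<le> 1"
begin

sublocale prob_space "draw_space (bernoulli_protocol p)"
  by (rule prob_space_draw_space[OF global_clock_bernoulli_protocol])

lemma space_draw_space: "space (draw_space (bernoulli_protocol p)) = UNIV"
  by (auto simp: draw_space_def bernoulli_protocol_def space_PiM PiE_def)

text \<open>The space is a product of products: the finite index set is grouped by the outer index
  \<open>(u, t)\<close>, and each group is evaluated in its inner product.\<close>

lemma prob_entries:
  assumes "finite J"
  shows "prob {Y. \<forall>k\<in>J. Y (fst k) (snd k) \<in> S k}
    = (\<Prod>k\<in>J. measure_pmf.prob (bernoulli_pmf (p (snd (fst k)) (snd k))) (S k))"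
proof -
  let ?D = "bernoulli_protocol p"
  interpret outer: product_prob_space "\<lambda>(u :: nat, t). ?D t" UNIV
    by (rule product_prob_spaceI) (use global_clock_bernoulli_protocol[of p]
        in \<open>auto simp: global_clock_protocol_def local_clock_protocol_def\<close>)
  let ?E = "\<lambda>j. {x. \<forall>i\<in>{i. (j, i) \<in> J}. x i \<in> S (j, i)}"
  have fin: "finite {i. (j, i) \<in> J}" for j
    using finite_imageI[OF assms, of snd] by (rule rev_finite_subset) force
  have space_D: "space (?D t) = UNIV" for t
    by (auto simp: bernoulli_protocol_def space_PiM PiE_def)
  have inner: "emeasure (?D t) (?E j) =
      (\<Prod>i\<in>{i. (j, i) \<in> J}. emeasure (bernoulli_pmf (p t i)) (S (j, i)))" for j t
  proof -
    interpret inner: product_prob_space "\<lambda>i. measure_pmf (bernoulli_pmf (p t i))" UNIV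
      by (rule product_prob_spaceI) (rule prob_space_measure_pmf)
    show ?thesis
      using inner.emeasure_PiM_Collect[of "{i. (j, i) \<in> J}" "\<lambda>i. S (j, i)"] fin space_D[of t]
      by (simp add: bernoulli_protocol_def)
  qed
  have meas: "?E j \<in> sets (?D t)" for j t
  proof -
    have "{x \<in> space (?D t). \<forall>i\<in>{i. (j, i) \<in> J}. x i \<in> S (j, i)} \<in> sets (?D t)"
      unfolding bernoulli_protocol_def
      by (intro sets.sets_Collect_finite_All fin) measurable
    then show ?thesis by (simp add: space_D)
  qed
  have "emeasure (draw_space ?D) {Y. \<forall>k\<in>J. Y (fst k) (snd k) \<in> S k} =
      emeasure (draw_space ?D) {Y \<in> space (draw_space ?D). \<forall>j\<in>fst ` J. Y j \<in> ?E j}"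
    by (rule arg_cong[where f = "emeasure _"]) (auto simp: space_draw_space)
  also have "\<dots> = (\<Prod>j\<in>fst ` J. emeasure (?D (snd j)) (?E j))"
    unfolding draw_space_def using assms meas
    by (subst outer.emeasure_PiM_Collect) (auto simp: case_prod_beta)
  also have "\<dots> = (\<Prod>j\<in>fst ` J. \<Prod>i\<in>{i. (j, i) \<in> J}. emeasure (bernoulli_pmf (p (snd j) i)) (S (j, i)))"
    by (simp only: inner)
  also have "\<dots> = (\<Prod>(j, i)\<in>(SIGMA j:fst ` J. {i. (j, i) \<in> J}).
      emeasure (bernoulli_pmf (p (snd j) i)) (S (j, i)))"
    using assms fin by (intro prod.Sigma) auto
  also have "(SIGMA j:fst ` J. {i. (j, i) \<in> J}) = J" by force
  finally show ?thesis
    by (simp add: emeasure_eq_measure measure_pmf.emeasure_eq_measure case_prod_beta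
        prod_ennreal prod_nonneg)
qed

lemma indep_entries:
  "indep_vars (\<lambda>_. count_space UNIV) (\<lambda>k Y. Y (fst k) (snd k)) UNIV"
  unfolding indep_vars_def2
proof (intro conjI ballI indep_setsI)
  show *: "random_variable (count_space UNIV) (\<lambda>Y. Y (fst k) (snd k))" for k :: "(nat \<times> nat) \<times> nat"
    using measurable_draw_entry[OF global_clock_bernoulli_protocol, of "fst (fst k)" "snd (fst k)" "snd k" p]
    by simp
  show "{(\<lambda>Y. Y (fst k) (snd k)) -` A \<inter> space (draw_space (bernoulli_protocol p)) |A.
      A \<in> sets (count_space UNIV)} \<subseteq> events" for k :: "(nat \<times> nat) \<times> nat"
    using measurable_sets[OF *[of k]] by auto
  fix A and J :: "((nat \<times> nat) \<times> nat) set"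
  assume J: "finite J" and A: "\<forall>j\<in>J. A j \<in> {(\<lambda>Y. Y (fst j) (snd j)) -` A \<inter>
      space (draw_space (bernoulli_protocol p)) |A. A \<in> sets (count_space UNIV)}"
  have "\<forall>j\<in>J. \<exists>S. A j = {Y. Y (fst j) (snd j) \<in> S}"
  proof
    fix j assume "j \<in> J"
    with A obtain S where "A j = (\<lambda>Y. Y (fst j) (snd j)) -` S" by (auto simp: space_draw_space)
    then have "A j = {Y. Y (fst j) (snd j) \<in> S}" by auto
    then show "\<exists>S. A j = {Y. Y (fst j) (snd j) \<in> S}" ..
  qed
  then obtain S where S: "\<And>j. j \<in> J \<Longrightarrow> A j = {Y. Y (fst j) (snd j) \<in> S j}" by metis
  have "prob (\<Inter>j\<in>J. A j) = prob {Y. \<forall>k\<in>J. Y (fst k) (snd k) \<in> S k}"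
    using S by (intro arg_cong[where f = prob]) auto
  also have "\<dots> = (\<Prod>k\<in>J. prob {Y. \<forall>k\<in>{k}. Y (fst k) (snd k) \<in> S k})"
    by (subst prob_entries) (auto simp: J prob_entries)
  also have "\<dots> = (\<Prod>k\<in>J. prob (A k))"
    using S by (intro prod.cong) auto
  finally show "prob (\<Inter>j\<in>J. A j) = (\<Prod>j\<in>J. prob (A j))" .
qed

lemma prob_entry: "prob {Y. Y (u, t) i} = p t i"
  using prob_entries[of "{((u, t), i)}" "\<lambda>_. {True}"] p01
  by (simp add: measure_pmf_single)

lemma prob_two_entries:
  assumes "u \<noteq> v"
  shows "prob {Y. Y (u, t) i \<and> Y (v, t') j} = p t i * p t' j"
  using prob_entries[of "{((u, t), i), ((v, t'), j)}" "\<lambda>_. {True}"] p01 assms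
  by (simp add: measure_pmf_single)

text \<open>Once \<open>h\<close> is fixed, even an adaptive adversary is deterministic. The events
  then depend on disjoint sets of independent entries: those for slots before \<open>s\<close> and
  those for slot \<open>s\<close>.\<close>

lemma prob_run_Suc:
  assumes "length h = s"
  shows "prob {Y. run A Y (Suc s) = h @ [B]}
    = prob {Y. run A Y s = h} * prob {Y. next_attempts A Y h = B}"
proof -
  let ?P = "{k :: (nat \<times> nat) \<times> nat. snd (fst k) + Suc (snd k) < s}"
  let ?Q = "{k :: (nat \<times> nat) \<times> nat. snd (fst k) + Suc (snd k) = s}"
  let ?M = "\<lambda>K. PiM K (\<lambda>_ :: (nat \<times> nat) \<times> nat. count_space (UNIV :: bool set))"
  let ?Y = "\<lambda>g :: (nat \<times> nat) \<times> nat \<Rightarrow> bool. \<lambda>j i. g (j, i)"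
  let ?X = "\<lambda>K Y. restrict (\<lambda>k. Y (fst k) (snd k)) K :: (nat \<times> nat) \<times> nat \<Rightarrow> bool"
  have ind: "indep_var (?M ?P) (?X ?P) (?M ?Q) (?X ?Q)"
    by (rule indep_var_restrict[OF indep_entries]) auto
  have mP: "{g \<in> space (?M ?P). run A (?Y g) s = h} \<in> sets (?M ?P)"
  proof -
    have "(\<lambda>g. run A (?Y g) s) \<in> measurable (?M ?P) (count_space UNIV)"
      by (rule measurable_run) (rule measurable_component_singleton, simp)
    then have "Measurable.pred (?M ?P) (\<lambda>g. run A (?Y g) s = h)"
      by measurable
    then show ?thesis by simp
  qed
  have mQ: "{g \<in> space (?M ?Q). next_attempts A (?Y g) h = B} \<in> sets (?M ?Q)"
  proof -
    have "Measurable.pred (?M ?Q) (\<lambda>g. next_attempts A (?Y g) h = B)"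
      by (rule measurable_next_attempts) (rule measurable_component_singleton, simp add: assms)
    then show ?thesis by simp
  qed
  have eP: "run A (?Y (?X ?P Y)) s = run A Y s" for Y by (rule run_cong) simp
  have eQ: "next_attempts A (?Y (?X ?Q Y)) h = next_attempts A Y h" for Y
    by (rule next_attempts_cong) (simp add: assms)
  have sp: "?X K Y \<in> space (?M K)" for K Y by (auto simp: space_PiM)
  let ?S = "{g \<in> space (?M ?P). run A (?Y g) s = h}"
  let ?T = "{g \<in> space (?M ?Q). next_attempts A (?Y g) h = B}"
  have S: "?X ?P Y \<in> ?S \<longleftrightarrow> run A Y s = h" for Y
    by (simp only: mem_Collect_eq eP sp simp_thms)
  have T: "?X ?Q Y \<in> ?T \<longleftrightarrow> next_attempts A Y h = B" for Y
    by (simp only: mem_Collect_eq eQ sp simp_thms)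
  have "{Y. run A Y (Suc s) = h @ [B]} = {Y. run A Y s = h \<and> next_attempts A Y h = B}"
    by auto
  also have "\<dots> = (\<lambda>Y. (?X ?P Y, ?X ?Q Y)) -` (?S \<times> ?T) \<inter> space (draw_space (bernoulli_protocol p))"
    by (simp only: vimage_def mem_Times_iff fst_conv snd_conv S T space_draw_space Int_UNIV_right)
  finally have "prob {Y. run A Y (Suc s) = h @ [B]} = prob \<dots>" by simp
  also have "\<dots> = prob (?X ?P -` ?S \<inter> space (draw_space (bernoulli_protocol p))) *
      prob (?X ?Q -` ?T \<inter> space (draw_space (bernoulli_protocol p)))"
    by (rule indep_varD[OF ind mP mQ])
  also have "\<dots> = prob {Y. run A Y s = h} * prob {Y. next_attempts A Y h = B}"
    by (simp only: vimage_def S T space_draw_space Int_UNIV_right)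
  finally show ?thesis .
qed

lemma events_run: "{Y. P (run A Y s)} \<in> events"
proof -
  have "{Y \<in> space (draw_space (bernoulli_protocol p)). P (run A Y s)} \<in> events"
    using measurable_compose[OF measurable_run_draw[OF global_clock_bernoulli_protocol[of p],
        where A = A and s = s], of P "count_space UNIV"]
    by simp
  then show ?thesis by (simp add: space_draw_space)
qed

lemma events_next_attempts: "{Y. P (next_attempts A Y h)} \<in> events"
proof -
  have "{Y. next_attempts A Y h = B} \<in> events" for B
  proof -
    have "Measurable.pred (draw_space (bernoulli_protocol p)) (\<lambda>Y. next_attempts A Y h = B)"
      by (rule measurable_next_attempts) (rule measurable_draw_entry[OF global_clock_bernoulli_protocol])
    then show ?thesis by (simp add: space_draw_space pred_def)
  qed
  then have "(\<Union>B\<in>{B \<in> Pow {..<woken_before A h (length h)}. P B}. {Y. next_attempts A Y h = B}) \<in> events"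
    by (intro sets.finite_UN) auto
  also have "(\<Union>B\<in>{B \<in> Pow {..<woken_before A h (length h)}. P B}. {Y. next_attempts A Y h = B})
      = {Y. P (next_attempts A Y h)}"
    using next_attempts_subset by auto
  finally show ?thesis .
qed

lemma prob_next_attempts_Collect:
  "prob {Y. P (next_attempts A Y h)} =
    (\<Sum>B\<in>{B \<in> Pow {..<woken_before A h (length h)}. P B}. prob {Y. next_attempts A Y h = B})"
proof -
  have "prob (\<Union>B\<in>{B \<in> Pow {..<woken_before A h (length h)}. P B}. {Y. next_attempts A Y h = B}) =
    (\<Sum>B\<in>{B \<in> Pow {..<woken_before A h (length h)}. P B}. prob {Y. next_attempts A Y h = B})"
    by (intro finite_measure_finite_Union) (auto simp: events_next_attempts[where P = "\<lambda>X. X = _"] disjoint_family_on_def)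
  also have "(\<Union>B\<in>{B \<in> Pow {..<woken_before A h (length h)}. P B}. {Y. next_attempts A Y h = B})
      = {Y. P (next_attempts A Y h)}"
    using next_attempts_subset by auto
  finally show ?thesis .
qed

section \<open>Exponential supermartingales along adaptive runs\<close>

lemma sum_supermartingale_le_1:
  assumes g: "\<And>h B. 0 \<le> g h B"
    and step: "\<And>h. (\<Sum>B\<in>Pow {..<woken_before A h (length h)}. prob {Y. next_attempts A Y h = B} * g h B) \<le> 1"
  shows "(\<Sum>h\<in>reach A s. prob {Y. run A Y s = h} * (\<Prod>r<s. g (take r h) (h ! r))) \<le> 1"
proof (induction s)
  case 0
  show ?case by simp
next
  case (Suc s)
  let ?F = "\<lambda>h. \<Prod>r<length h. g (take r h) (h ! r)"
  have F: "?F (h @ [B]) = ?F h * g h B" for h B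
    by (simp add: nth_append)
  have "(\<Sum>h\<in>reach A (Suc s). prob {Y. run A Y (Suc s) = h} * (\<Prod>r<Suc s. g (take r h) (h ! r)))
      = (\<Sum>h\<in>reach A (Suc s). prob {Y. run A Y (Suc s) = h} * ?F h)"
    by (intro sum.cong refl) (simp add: length_reach del: reach.simps run.simps prod.lessThan_Suc)
  also have "\<dots> = (\<Sum>h\<in>reach A s. \<Sum>h'\<in>(\<lambda>B. h @ [B]) ` Pow {..<woken_before A h s}.
      prob {Y. run A Y (Suc s) = h'} * ?F h')"
    unfolding reach.simps by (intro sum.UNION_disjoint) (auto simp: finite_reach)
  also have "\<dots> = (\<Sum>h\<in>reach A s. \<Sum>B\<in>Pow {..<woken_before A h s}.
      prob {Y. run A Y (Suc s) = h @ [B]} * ?F (h @ [B]))"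
    by (intro sum.cong refl, subst sum.reindex) (auto simp: inj_on_def)
  also have "\<dots> = (\<Sum>h\<in>reach A s. prob {Y. run A Y s = h} * ?F h *
      (\<Sum>B\<in>Pow {..<woken_before A h (length h)}. prob {Y. next_attempts A Y h = B} * g h B))"
    by (intro sum.cong refl)
      (simp only: F length_reach prob_run_Suc sum_distrib_left mult.assoc mult.left_commute)
  also have "\<dots> \<le> (\<Sum>h\<in>reach A s. prob {Y. run A Y s = h} * ?F h)"
    using step by (intro sum_mono mult_left_le mult_nonneg_nonneg prod_nonneg) (auto simp: g)
  also have "\<dots> = (\<Sum>h\<in>reach A s. prob {Y. run A Y s = h} * (\<Prod>r<s. g (take r h) (h ! r)))"
    by (intro sum.cong refl) (simp add: length_reach)
  also have "\<dots> \<le> 1" by (rule Suc.IH)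
  finally show ?case .
qed

text \<open>Markov's inequality for a product of factors whose conditional expectation, given any
  history, is at most 1. Each concentration bound below amounts to a choice of
  \<open>g\<close>.\<close>

lemma prob_run_tail:
  assumes g: "\<And>h B. 0 \<le> g h B"
    and step: "\<And>h. (\<Sum>B\<in>Pow {..<woken_before A h (length h)}. prob {Y. next_attempts A Y h = B} * g h B) \<le> 1"
    and bad: "\<And>h. h \<in> reach A s \<Longrightarrow> P h \<Longrightarrow> c \<le> (\<Prod>r<s. g (take r h) (h ! r))"
    and c: "0 < c"
  shows "prob {Y. P (run A Y s)} \<le> 1 / c"
proof -
  have "prob {Y. P (run A Y s)} = prob (\<Union>h\<in>{h \<in> reach A s. P h}. {Y. run A Y s = h})"
    using run_in_reach by (intro arg_cong[where f = prob]) auto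
  also have "\<dots> = (\<Sum>h\<in>{h \<in> reach A s. P h}. prob {Y. run A Y s = h})"
    by (intro finite_measure_finite_Union) (auto simp: events_run[where P = "\<lambda>X. X = _"] disjoint_family_on_def finite_reach)
  also have "\<dots> * c \<le> (\<Sum>h\<in>{h \<in> reach A s. P h}. prob {Y. run A Y s = h} * (\<Prod>r<s. g (take r h) (h ! r)))"
    unfolding sum_distrib_right using bad by (intro sum_mono mult_left_mono) auto
  also have "\<dots> \<le> (\<Sum>h\<in>reach A s. prob {Y. run A Y s = h} * (\<Prod>r<s. g (take r h) (h ! r)))"
    by (intro sum_mono2 mult_nonneg_nonneg prod_nonneg) (auto simp: g finite_reach)
  also have "\<dots> \<le> 1" by (rule sum_supermartingale_le_1[OF g step])
  finally show ?thesis using c by (simp add: field_simps)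
qed

definition success_prob :: "adversary \<Rightarrow> history \<Rightarrow> real" where
  "success_prob A h = (\<Sum>u<woken_before A h (length h). prob {Y. next_attempts A Y h = {u}})"

lemma sum_prob_next_attempts:
  "(\<Sum>B\<in>Pow {..<woken_before A h (length h)}. prob {Y. next_attempts A Y h = B}) = 1"
  using prob_next_attempts_Collect[of "\<lambda>_. True" A h] prob_space
  by (simp add: space_draw_space Pow_def)

lemma success_prob_eq:
  "success_prob A h = (\<Sum>B\<in>Pow {..<woken_before A h (length h)}.
    prob {Y. next_attempts A Y h = B} * (if card B = 1 then 1 else 0))"
proof -
  let ?N = "{..<woken_before A h (length h)}"
  have "(\<Sum>B\<in>Pow ?N. prob {Y. next_attempts A Y h = B} * (if card B = 1 then 1 else 0)) =
      (\<Sum>B\<in>{B \<in> Pow ?N. card B = 1}. prob {Y. next_attempts A Y h = B})"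
    by (subst sum.inter_filter) (auto intro!: sum.cong)
  also have "{B \<in> Pow ?N. card B = 1} = (\<lambda>u. {u}) ` ?N"
    by (auto simp: card_1_singleton_iff)
  also have "(\<Sum>B\<in>(\<lambda>u. {u}) ` ?N. prob {Y. next_attempts A Y h = B}) = success_prob A h"
    unfolding success_prob_def by (subst sum.reindex) auto
  finally show ?thesis by simp
qed

lemma success_prob_bounds: "0 \<le> success_prob A h" "success_prob A h \<le> 1"
proof -
  show "0 \<le> success_prob A h" unfolding success_prob_def by (simp add: sum_nonneg)
  have "success_prob A h \<le> (\<Sum>B\<in>Pow {..<woken_before A h (length h)}. prob {Y. next_attempts A Y h = B})"
    unfolding success_prob_eq by (intro sum_mono) auto
  then show "success_prob A h \<le> 1" by (simp add: sum_prob_next_attempts)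
qed

text \<open>With \<open>x\<close> the conditional success probability,
  \<open>exp (x / 2 - [success])\<close> has mean
  \<open>exp (x / 2) * (1 - (1 - exp (- 1)) * x) \<le> 1\<close>. In the event, the exponents add up
  to at least \<open>2 * n - n\<close>. As there are never more than \<open>n\<close> successes,
  accumulated success probability \<open>4 * n\<close> is therefore unlikely.\<close>

lemma prob_many_expected_successes:
  "prob {Y. 4 * real n \<le> (\<Sum>r<s. success_prob A (take r (run A Y s))) \<and>
     card {r. r < s \<and> card (run A Y s ! r) = 1} \<le> n} \<le> exp (- real n)"
proof -
  let ?g = "\<lambda>h B. exp (success_prob A h / 2 - (if card B = 1 then 1 else 0))"
  have "prob {Y. 4 * real n \<le> (\<Sum>r<s. success_prob A (take r (run A Y s))) \<and>
     card {r. r < s \<and> card (run A Y s ! r) = 1} \<le> n} \<le> 1 / exp (real n)"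
  proof (rule prob_run_tail[where g = ?g and A = A and s = s and
        P = "\<lambda>h. 4 * real n \<le> (\<Sum>r<s. success_prob A (take r h)) \<and> card {r. r < s \<and> card (h ! r) = 1} \<le> n"])
    fix h
    let ?N = "{..<woken_before A h (length h)}" and ?x = "success_prob A h"
    have "(\<Sum>B\<in>Pow ?N. prob {Y. next_attempts A Y h = B} * ?g h B) =
      (\<Sum>B\<in>Pow ?N. exp (?x / 2) * (prob {Y. next_attempts A Y h = B} -
         (1 - exp (-1)) * (prob {Y. next_attempts A Y h = B} * (if card B = 1 then 1 else 0))))"
    proof (intro sum.cong refl)
      have "exp (?x / 2 - 1) = exp (?x / 2) * exp (- 1)" by (simp flip: exp_add)
      then show "prob {Y. next_attempts A Y h = B} * ?g h B = exp (?x / 2) * (prob {Y. next_attempts A Y h = B} -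
         (1 - exp (-1)) * (prob {Y. next_attempts A Y h = B} * (if card B = 1 then 1 else 0)))" for B
        by (auto simp: algebra_simps)
    qed
    also have "\<dots> = exp (?x / 2) * (1 - (1 - exp (-1)) * ?x)"
      by (simp only: sum_distrib_left[symmetric] sum_subtractf sum_prob_next_attempts success_prob_eq)
    also have "\<dots> \<le> exp (?x / 2) * exp (- (?x / 2))"
    proof (intro mult_left_mono)
      have "exp (-1 :: real) \<le> 1 / 2"
        using exp_ge_add_one_self[of "1 :: real"] by (simp add: exp_minus field_simps)
      then have "(1 / 2) * ?x \<le> (1 - exp (-1)) * ?x"
        using success_prob_bounds[of A h] by (intro mult_right_mono) auto
      then show "1 - (1 - exp (-1)) * ?x \<le> exp (- (?x / 2))"
        using exp_ge_add_one_self[of "- (?x / 2)"] by simp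
    qed simp
    also have "\<dots> = 1" by (simp flip: exp_add)
    finally show "(\<Sum>B\<in>Pow ?N. prob {Y. next_attempts A Y h = B} * ?g h B) \<le> 1" .
  next
    fix h
    assume h: "4 * real n \<le> (\<Sum>r<s. success_prob A (take r h)) \<and> card {r. r < s \<and> card (h ! r) = 1} \<le> n"
    have "(\<Sum>r<s. if card (h ! r) = 1 then 1 else 0 :: real) = real (card {r. r < s \<and> card (h ! r) = 1})"
      by (simp add: sum.If_cases Int_def lessThan_def)
    then have "real n \<le> (\<Sum>r<s. success_prob A (take r h) / 2 - (if card (h ! r) = 1 then 1 else 0))"
      using h by (simp add: sum_subtractf flip: sum_divide_distrib)
    then show "exp (real n) \<le> (\<Prod>r<s. ?g (take r h) (h ! r))"
      by (simp add: exp_sum[symmetric])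
  qed auto
  then show ?thesis by (simp add: exp_minus inverse_eq_divide)
qed

text \<open>The predicate \<open>active\<close> freezes the product, which replaces a stopping time.\<close>

lemma prob_unlucky:
  "prob {Y. x \<le> (\<Sum>r<s. if active (take r (run A Y s)) then prob {Y'. next_attempts A Y' (take r (run A Y s)) = {u}} else 0) \<and>
     (\<forall>r<s. active (take r (run A Y s)) \<longrightarrow> run A Y s ! r \<noteq> {u})} \<le> exp (- x)"
proof -
  let ?t = "\<lambda>h. prob {Y'. next_attempts A Y' h = {u}}"
  let ?g = "\<lambda>h B. if active h then (if B = {u} then 0 else exp (?t h)) else 1"
  have "prob {Y. x \<le> (\<Sum>r<s. if active (take r (run A Y s)) then ?t (take r (run A Y s)) else 0) \<and>
     (\<forall>r<s. active (take r (run A Y s)) \<longrightarrow> run A Y s ! r \<noteq> {u})} \<le> 1 / exp x"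
  proof (rule prob_run_tail[where g = ?g and A = A and s = s and
        P = "\<lambda>h. x \<le> (\<Sum>r<s. if active (take r h) then ?t (take r h) else 0) \<and>
          (\<forall>r<s. active (take r h) \<longrightarrow> h ! r \<noteq> {u})"])
    fix h
    let ?N = "{..<woken_before A h (length h)}"
    show "(\<Sum>B\<in>Pow ?N. prob {Y. next_attempts A Y h = B} * ?g h B) \<le> 1"
    proof (cases "active h")
      case True
      have "(\<Sum>B\<in>Pow ?N. prob {Y. next_attempts A Y h = B} * ?g h B) =
        (\<Sum>B\<in>Pow ?N. exp (?t h) * (prob {Y. next_attempts A Y h = B} - (if B = {u} then ?t h else 0)))"
        using True by (intro sum.cong refl) auto
      also have "\<dots> = exp (?t h) * (1 - ?t h)"
      proof -
        have "{u} \<notin> Pow ?N \<Longrightarrow> {Y'. next_attempts A Y' h = {u}} = {}"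
          using next_attempts_subset[of A _ h] by auto
        then have "(\<Sum>B\<in>Pow ?N. if B = {u} then ?t h else 0) = ?t h"
          by (subst sum.delta) auto
        then show ?thesis
          by (simp only: sum_distrib_left[symmetric] sum_subtractf sum_prob_next_attempts)
      qed
      also have "\<dots> \<le> exp (?t h) * exp (- ?t h)"
        using exp_ge_add_one_self[of "- ?t h"] by (intro mult_left_mono) auto
      also have "\<dots> = 1" by (simp flip: exp_add)
      finally show ?thesis .
    qed (simp add: sum_prob_next_attempts)
  next
    fix h
    assume h: "x \<le> (\<Sum>r<s. if active (take r h) then ?t (take r h) else 0) \<and>
      (\<forall>r<s. active (take r h) \<longrightarrow> h ! r \<noteq> {u})"
    have "(\<Prod>r<s. ?g (take r h) (h ! r)) = (\<Prod>r<s. exp (if active (take r h) then ?t (take r h) else 0))"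
      using h by (intro prod.cong) auto
    then show "exp x \<le> (\<Prod>r<s. ?g (take r h) (h ! r))"
      using h by (simp add: exp_sum[symmetric])
  qed auto
  then show ?thesis by (simp add: exp_minus inverse_eq_divide)
qed

end

section \<open>Live parties and their attempt rates, as functions of the history\<close>

definition live :: "adversary \<Rightarrow> history \<Rightarrow> nat set" where
  "live A h = {u. {u} \<notin> set h \<and> (\<exists>t<length h. woken_in A h u t)}"

definition wake_slot :: "adversary \<Rightarrow> history \<Rightarrow> nat \<Rightarrow> nat" where
  "wake_slot A h u = (THE t. woken_in A h u t)"

lemma wake_slot_eq: "woken_in A h u t \<Longrightarrow> wake_slot A h u = t"
  unfolding wake_slot_def by (rule the_equality) (auto dest: woken_in_unique)

lemma live_subset: "live A h \<subseteq> {..<woken_before A h (length h)}"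
  by (auto simp: live_def intro: woken_in_less)

lemma finite_live [simp]: "finite (live A h)"
  by (rule finite_subset[OF live_subset]) simp

lemma mem_next_attempts_live:
  "u \<in> next_attempts A Y h \<longleftrightarrow>
     u \<in> live A h \<and> Y (u, wake_slot A h u) (length h - Suc (wake_slot A h u))"
  unfolding mem_next_attempts live_def using wake_slot_eq[of A h u] by auto

context memoryless_protocol
begin

definition rate :: "adversary \<Rightarrow> history \<Rightarrow> nat \<Rightarrow> real" where
  "rate A h u = p (wake_slot A h u) (length h - Suc (wake_slot A h u))"

lemma rate_nonneg: "0 \<le> rate A h u"
  by (simp add: rate_def p01)

lemma prob_mem_next_attempts:
  "u \<in> live A h \<Longrightarrow> prob {Y. u \<in> next_attempts A Y h} = rate A h u"
  by (simp add: mem_next_attempts_live prob_entry rate_def)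

lemma prob_two_mem_next_attempts:
  "u \<in> live A h \<Longrightarrow> v \<in> live A h \<Longrightarrow> u \<noteq> v \<Longrightarrow>
    prob {Y. u \<in> next_attempts A Y h \<and> v \<in> next_attempts A Y h} = rate A h u * rate A h v"
  by (simp add: mem_next_attempts_live prob_two_entries rate_def)

text \<open>A union bound over the parties that could collide with \<open>u\<close>. The term for
  \<open>u\<close> itself is subtracted as well, which makes the last factor the same for all
  \<open>u\<close>.\<close>

lemma prob_next_attempts_singleton:
  assumes u: "u \<in> live A h"
  shows "rate A h u * (1 - (\<Sum>v\<in>live A h. rate A h v)) \<le> prob {Y. next_attempts A Y h = {u}}"
proof -
  let ?E = "\<lambda>v. {Y. u \<in> next_attempts A Y h \<and> v \<in> next_attempts A Y h}"
  have m: "?E v \<in> events" for v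
    using events_next_attempts[of "\<lambda>B. u \<in> B \<and> v \<in> B" A h] by simp
  have m1: "{Y. next_attempts A Y h = {u}} \<in> events"
    using events_next_attempts[of "\<lambda>B. B = {u}" A h] by simp
  have m2: "(\<Union>v\<in>live A h - {u}. ?E v) \<in> events"
    using m by (intro sets.finite_UN) auto
  have "rate A h u = prob {Y. u \<in> next_attempts A Y h}"
    using u by (simp add: prob_mem_next_attempts)
  also have "\<dots> \<le> prob ({Y. next_attempts A Y h = {u}} \<union> (\<Union>v\<in>live A h - {u}. ?E v))"
  proof (rule finite_measure_mono)
    show "{Y. u \<in> next_attempts A Y h} \<subseteq> {Y. next_attempts A Y h = {u}} \<union> (\<Union>v\<in>live A h - {u}. ?E v)"
      by (auto simp: mem_next_attempts_live)
    show "{Y. next_attempts A Y h = {u}} \<union> (\<Union>v\<in>live A h - {u}. ?E v) \<in> events"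
      using m1 m2 by (rule sets.Un)
  qed
  also have "\<dots> \<le> prob {Y. next_attempts A Y h = {u}} + prob (\<Union>v\<in>live A h - {u}. ?E v)"
    using m1 m2 by (rule measure_Un_le)
  also have "prob (\<Union>v\<in>live A h - {u}. ?E v) \<le> (\<Sum>v\<in>live A h - {u}. prob (?E v))"
    using m by (intro finite_measure_subadditive_finite) auto
  also have "\<dots> = (\<Sum>v\<in>live A h - {u}. rate A h u * rate A h v)"
    using u by (intro sum.cong prob_two_mem_next_attempts) auto
  also have "\<dots> \<le> (\<Sum>v\<in>live A h. rate A h u * rate A h v)"
    by (intro sum_mono2) (auto simp: rate_nonneg)
  finally show ?thesis by (simp add: sum_distrib_left algebra_simps)
qed

lemma success_prob_ge:
  fixes A h
  defines "x \<equiv> \<Sum>v\<in>live A h. rate A h v"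
  shows "x * (1 - x) \<le> success_prob A h"
proof -
  have "x * (1 - x) = (\<Sum>u\<in>live A h. rate A h u * (1 - x))"
    by (simp add: x_def sum_distrib_right)
  also have "\<dots> \<le> (\<Sum>u\<in>live A h. prob {Y. next_attempts A Y h = {u}})"
    unfolding x_def by (intro sum_mono prob_next_attempts_singleton)
  also have "\<dots> \<le> success_prob A h"
    unfolding success_prob_def by (intro sum_mono2 live_subset) auto
  finally show ?thesis .
qed

end

section \<open>The GlobalClock protocol\<close>

lemma ex_power_2_ivl:
  fixes y :: real
  assumes "1 \<le> y"
  obtains i :: nat where "2 ^ i \<le> y" "y < 2 * 2 ^ i"
proof -
  have "1 \<le> nat \<lfloor>y\<rfloor>" using assms by linarith
  from ex_power_ivl1[OF order_refl this] obtain i where i: "2 ^ i \<le> nat \<lfloor>y\<rfloor>" "nat \<lfloor>y\<rfloor> < 2 ^ (i + 1)"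
    by blast
  have "real (2 ^ i) \<le> real (nat \<lfloor>y\<rfloor>)" "real (nat \<lfloor>y\<rfloor>) + 1 \<le> real (2 ^ (i + 1))"
    using i by (simp_all only: of_nat_le_iff)
  moreover have "real (nat \<lfloor>y\<rfloor>) \<le> y" "y < real (nat \<lfloor>y\<rfloor>) + 1"
    using assms by linarith+
  moreover have "real (2 ^ i) = 2 ^ i" "real (2 ^ (i + 1)) = 2 * 2 ^ i" by simp_all
  ultimately have "2 ^ i \<le> y" "y < 2 * 2 ^ i" by linarith+
  then show ?thesis by (rule that)
qed

text \<open>The multipliers of scale \<open>v\<close> are the \<open>2 ^ v\<^sup>2\<close> powers of
  2 from \<open>2 ^ - half v\<close> up to \<open>2 ^ half v / 2\<close>.\<close>

definition half :: "nat \<Rightarrow> nat" where "half v = 2 ^ v\<^sup>2 div 2"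

lemma half:
  assumes "0 < v"
  shows "2 ^ v\<^sup>2 = 2 * half v" "0 < half v"
proof -
  have "even (2 ^ v\<^sup>2 :: nat)" using assms by simp
  then show *: "2 ^ v\<^sup>2 = 2 * half v" by (simp add: half_def)
  have "0 < (2 :: nat) ^ v\<^sup>2" by simp
  then show "0 < half v" using * by linarith
qed

text \<open>The slots \<open>s\<close> for which \<open>Suc s\<close> has 2-adic valuation \<open>v\<close> cycle through \<open>2 ^ v\<^sup>2\<close> multipliers.
  They have density \<open>2 ^ - (v + 1)\<close>, so a cycle takes only \<open>I powr (1 + o(1))\<close> slots where \<open>I\<close> is the
  number of multipliers.\<close>

definition slot_multiplier :: "nat \<Rightarrow> real" where
  "slot_multiplier s = (let v = multiplicity 2 (Suc s) in
     2 ^ (Suc s div 2 ^ (v + 1) mod 2 ^ v\<^sup>2) / 2 ^ half v)"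

definition window :: "nat \<Rightarrow> nat" where
  "window v = 2 ^ (v + 1) * 2 ^ v\<^sup>2"

lemma window_pos: "0 < window v"
  by (simp add: window_def)

lemma slot_multiplier_pos: "0 < slot_multiplier s"
  by (simp add: slot_multiplier_def Let_def)

text \<open>The slots of valuation \<open>v\<close> are those with
  \<open>Suc s = 2 ^ v * (2 * q + 1)\<close>, and the exponent used there is
  \<open>q mod 2 ^ v\<^sup>2\<close>. Window \<open>k\<close> contains the slots for the
  \<open>2 ^ v\<^sup>2\<close> consecutive values \<open>q\<close> from
  \<open>k * 2 ^ v\<^sup>2\<close> on, hence all residues.\<close>

lemma slot_multiplier_in_window:
  assumes "i < 2 ^ v\<^sup>2"
  obtains s where "k * window v \<le> s" "s < Suc k * window v"
    "slot_multiplier s = 2 ^ i / 2 ^ half v"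
proof
  let ?q = "k * 2 ^ v\<^sup>2 + i" and ?s = "k * window v + 2 ^ (v + 1) * i + (2 ^ v - 1)"
  have Suc_s: "Suc ?s = 2 ^ v * (2 * ?q + 1)"
    by (simp add: window_def algebra_simps)
  have "multiplicity 2 (Suc ?s) = v"
  proof -
    have "multiplicity 2 (2 ^ v * m) = v" if "odd m" for m :: nat
      using that by (intro multiplicity_eqI) (auto simp: mult.commute[of 2])
    then show ?thesis unfolding Suc_s by (metis even_plus_one_iff dvd_triv_left)
  qed
  moreover have "Suc ?s div 2 ^ (v + 1) = ?q"
  proof -
    have "Suc ?s = ?q * 2 ^ (v + 1) + 2 ^ v" unfolding Suc_s by (simp add: algebra_simps)
    then show ?thesis by simp
  qed
  moreover have "?q mod 2 ^ v\<^sup>2 = i" using assms by simp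
  ultimately show "slot_multiplier ?s = 2 ^ i / 2 ^ half v"
    by (simp only: slot_multiplier_def Let_def)
  show "k * window v \<le> ?s" unfolding add.assoc by (rule le_add1)
  have "(2 :: nat) ^ v - 1 < 2 ^ (v + 1)" by (rule le_less_trans[of _ "2 ^ v"]) auto
  then have "2 ^ (v + 1) * i + (2 ^ v - 1) < 2 ^ (v + 1) * (i + 1)"
    by (simp only: distrib_left mult_1_right add_strict_left_mono)
  also have "\<dots> \<le> window v"
    unfolding window_def using assms by (intro mult_left_mono) auto
  finally show "?s < Suc k * window v"
    by (simp only: mult_Suc add.assoc add.commute[of "window v"] add_strict_left_mono)
qed

definition sawtooth_prob :: "nat \<Rightarrow> nat \<Rightarrow> real" where
  "sawtooth_prob t i = min 1 (slot_multiplier (t + Suc i) / real (Suc i))"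

interpretation sawtooth: memoryless_protocol sawtooth_prob
  by standard (auto simp: sawtooth_prob_def slot_multiplier_pos less_imp_le)

lemma sawtooth_rate:
  assumes "x \<in> live A h"
  shows "sawtooth.rate A h x =
    min 1 (slot_multiplier (length h) / (real (length h) - real (wake_slot A h x)))"
proof -
  from assms obtain t where t: "t < length h" "woken_in A h x t" by (auto simp: live_def)
  then have "t + Suc (length h - Suc t) = length h" by simp
  then show ?thesis using t
    by (simp add: sawtooth.rate_def sawtooth_prob_def wake_slot_eq del: add_Suc_right)
qed

section \<open>Windows, contention and progress within one fixed history\<close>

context
  fixes A :: adversary and h :: history and n u t0 v :: nat
  assumes total: "woken_before A h (length h) \<le> n"
    and few_successes: "card {r. r < length h \<and> card (h ! r) = 1} \<le> n"
    and u: "woken_in A h u t0"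
    and v: "0 < v"
begin

definition wk :: "nat \<Rightarrow> nat" where "wk x = wake_slot A h x"

lemma live_take: "s \<le> length h \<Longrightarrow> live A (take s h) =
    {x. {x} \<notin> set (take s h) \<and> (\<exists>t<s. woken_in A h x t)}"
  by (auto simp: live_def woken_in_take)

lemma wake_slot_take:
  assumes "s \<le> length h" "x \<in> live A (take s h)"
  shows "wake_slot A (take s h) x = wk x \<and> wk x < s"
proof -
  from assms obtain t where t: "t < s" "woken_in A h x t" by (auto simp: live_take)
  then have "woken_in A (take s h) x t" by (simp add: woken_in_take)
  with t show ?thesis by (simp add: wk_def wake_slot_eq)
qed

definition contention :: "nat \<Rightarrow> real" where
  "contention s = (\<Sum>x\<in>live A (take s h). 1 / (real s - real (wk x)))"

text \<open>Wake-ups are also excluded from the preceding window, so that every live party is older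
  than a window. The range of \<open>x\<close> is bounded since \<open>wake_slot\<close> is
  unspecified for parties that were not woken up.\<close>

definition quiet :: "nat \<Rightarrow> bool" where
  "quiet k \<longleftrightarrow> (\<forall>x<woken_before A h (length h). wk x < (k - 1) * window v \<or> Suc k * window v \<le> wk x) \<and>
     (\<forall>s. k * window v \<le> s \<and> s < Suc k * window v \<longrightarrow> card (h ! s) \<noteq> 1)"

lemma live_less: "s \<le> length h \<Longrightarrow> x \<in> live A (take s h) \<Longrightarrow> x < woken_before A h (length h)"
  unfolding live_take by (auto intro: order.strict_trans2[OF woken_in_less woken_before_mono])

lemma quiet_live:
  assumes k: "quiet k" "0 < k" and s: "k * window v \<le> s" "s < Suc k * window v" "s \<le> length h"
  shows "live A (take s h) = live A (take (k * window v) h)"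
proof -
  let ?a = "k * window v"
  have a: "?a \<le> length h" using s by simp
  have "x \<in> live A (take ?a h)" if x: "x \<in> live A (take s h)" for x
  proof -
    have "wk x < (k - 1) * window v"
      using k(1) live_less[OF s(3) x] wake_slot_take[OF s(3) x] s unfolding quiet_def by force
    then have *: "wk x < ?a" by (rule less_le_trans) simp
    from x obtain t where t: "t < s" "woken_in A h x t" by (auto simp: live_take[OF s(3)])
    then have "wk x = t" by (simp add: wk_def wake_slot_eq)
    moreover have "set (take ?a h) \<subseteq> set (take s h)" using s by (intro set_take_subset_set_take)
    ultimately show ?thesis using x t * by (auto simp: live_take[OF s(3)] live_take[OF a])
  qed
  moreover have "x \<in> live A (take s h)" if x: "x \<in> live A (take ?a h)" for x
  proof -
    from x obtain t where t: "t < ?a" "woken_in A h x t" by (auto simp: live_take[OF a])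
    have "{x} \<notin> set (take s h)"
    proof
      assume "{x} \<in> set (take s h)"
      then obtain r where "r < length (take s h)" "take s h ! r = {x}"
        by (auto simp only: in_set_conv_nth)
      then have r: "r < s" "h ! r = {x}" "r < length h" by simp_all
      have "{x} \<in> set (take ?a h)" if "r < ?a"
        using that r by (metis length_take min_less_iff_conj nth_mem nth_take)
      moreover have "{x} \<notin> set (take ?a h)" using x by (simp add: live_take[OF a])
      ultimately have "?a \<le> r" by (meson not_less)
      moreover have "card (h ! r) = 1" using r by simp
      moreover have "r < Suc k * window v" using r s by linarith
      ultimately show False using k(1) unfolding quiet_def by blast
    qed
    moreover have "t < s" using t s by linarith
    ultimately show ?thesis using t by (auto simp: live_take[OF s(3)])
  qed
  ultimately show ?thesis by blast
qed

lemma quiet_age: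
  assumes k: "quiet k" "0 < k" "k * window v \<le> length h" and x: "x \<in> live A (take (k * window v) h)"
  shows "wk x + window v < k * window v"
proof -
  have "wk x < (k - 1) * window v"
    using k live_less[OF k(3) x] wake_slot_take[OF k(3) x] unfolding quiet_def by force
  then show ?thesis using k(2) by (cases k) auto
qed

text \<open>In a quiet window all ages are at least the length of the window, so they change by a factor
  of at most 2 within it.\<close>

lemma quiet_rates:
  assumes k: "quiet k" "0 < k" and s: "k * window v \<le> s" "s < Suc k * window v" "s \<le> length h"
    and small: "slot_multiplier s * contention (k * window v) \<le> 1 / 2"
  shows "(\<Sum>x\<in>live A (take s h). sawtooth.rate A (take s h) x) \<le> slot_multiplier s * contention (k * window v)"
    and "slot_multiplier s * contention (k * window v) / 2 \<le> (\<Sum>x\<in>live A (take s h). sawtooth.rate A (take s h) x)"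
    and "x \<in> live A (take s h) \<Longrightarrow> sawtooth.rate A (take s h) x = slot_multiplier s / (real s - real (wk x))"
proof -
  let ?a = "k * window v" and ?\<mu> = "slot_multiplier s"
  have a: "?a \<le> length h" using s by simp
  note live = quiet_live[OF k s]
  have age: "0 < real ?a - real (wk x)" "real ?a - real (wk x) \<le> real s - real (wk x)"
      "real s - real (wk x) \<le> 2 * (real ?a - real (wk x))" if "x \<in> live A (take s h)" for x
  proof -
    have *: "0 < real a - real y \<and> real a - real y \<le> real s - real y \<and>
        real s - real y \<le> 2 * (real a - real y)"
      if "y + b < a" "a \<le> s" "s < a + b" for a b y :: nat
    proof -
      have "real (y + b) < real a" "real a \<le> real s" "real s < real (a + b)"
        using that by (simp_all only: of_nat_less_iff of_nat_le_iff)
      then show ?thesis by auto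
    qed
    have "wk x + window v < ?a" using quiet_age[OF k a] that live by simp
    from *[OF this s(1)] s(2) show "0 < real ?a - real (wk x)" "real ?a - real (wk x) \<le> real s - real (wk x)"
      "real s - real (wk x) \<le> 2 * (real ?a - real (wk x))" by auto
  qed
  have c: "contention ?a = (\<Sum>x\<in>live A (take s h). 1 / (real ?a - real (wk x)))"
    by (simp only: contention_def live)
  have le: "?\<mu> / (real s - real (wk x)) \<le> ?\<mu> * (1 / (real ?a - real (wk x)))"
    and ge: "?\<mu> * (1 / (real ?a - real (wk x))) / 2 \<le> ?\<mu> / (real s - real (wk x))"
    if "x \<in> live A (take s h)" for x
  proof -
    have "m / z \<le> m * (1 / y) \<and> m * (1 / y) / 2 \<le> m / z"
      if "0 < m" "0 < y" "y \<le> z" "z \<le> 2 * y" for m y z :: real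
    proof
      show "m / z \<le> m * (1 / y)" using that by (simp add: frac_le)
      have "m / (2 * y) \<le> m / z" using that by (intro frac_le) auto
      then show "m * (1 / y) / 2 \<le> m / z" by simp
    qed
    from this[OF slot_multiplier_pos age[OF that]]
    show "?\<mu> / (real s - real (wk x)) \<le> ?\<mu> * (1 / (real ?a - real (wk x)))"
      "?\<mu> * (1 / (real ?a - real (wk x))) / 2 \<le> ?\<mu> / (real s - real (wk x))" by blast+
  qed
  have "?\<mu> * (1 / (real ?a - real (wk x))) \<le> ?\<mu> * contention ?a" if "x \<in> live A (take s h)" for x
    unfolding c using slot_multiplier_pos[of s] that age
    by (intro mult_left_mono member_le_sum) (auto simp: less_imp_le)
  then have le_1: "?\<mu> / (real s - real (wk x)) \<le> 1" if "x \<in> live A (take s h)" for x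
    using le[OF that] small that by fastforce
  have rate: "sawtooth.rate A (take s h) x = ?\<mu> / (real s - real (wk x))" if "x \<in> live A (take s h)" for x
    using sawtooth_rate[OF that] wake_slot_take[OF s(3) that] s(3) min_absorb2[OF le_1[OF that]] by simp
  then show "x \<in> live A (take s h) \<Longrightarrow> sawtooth.rate A (take s h) x = ?\<mu> / (real s - real (wk x))" .
  have "(\<Sum>x\<in>live A (take s h). sawtooth.rate A (take s h) x) =
      (\<Sum>x\<in>live A (take s h). ?\<mu> / (real s - real (wk x)))"
    by (intro sum.cong refl rate)
  moreover have "\<dots> \<le> (\<Sum>x\<in>live A (take s h). ?\<mu> * (1 / (real ?a - real (wk x))))"
    by (intro sum_mono le)
  moreover have "(\<Sum>x\<in>live A (take s h). ?\<mu> * (1 / (real ?a - real (wk x))) / 2) \<le>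
      (\<Sum>x\<in>live A (take s h). ?\<mu> / (real s - real (wk x)))"
    by (intro sum_mono ge)
  ultimately show "(\<Sum>x\<in>live A (take s h). sawtooth.rate A (take s h) x) \<le> ?\<mu> * contention ?a"
    "?\<mu> * contention ?a / 2 \<le> (\<Sum>x\<in>live A (take s h). sawtooth.rate A (take s h) x)"
    by (simp_all only: c sum_distrib_left sum_divide_distrib)
qed

text \<open>At successive window starts the age of a party grows by at least one slot, so the ages
  dominate 1, 2, 3 and so on. The index \<open>a\<close> is the first window that can be counted:
  \<open>T + window v < k * window v\<close> forces
  \<open>k \<ge> T div window v + 2\<close>.\<close>

lemma sum_inverse_ages_le:
  "(\<Sum>k\<in>{k \<in> {k0..<k0 + m}. T + window v < k * window v}. 1 / (real (k * window v) - real T)) \<le> harm m"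
proof -
  let ?w = "window v"
  define a where "a = max k0 (T div ?w + 2)"
  let ?S = "{k \<in> {k0..<k0 + m}. T + ?w < k * ?w}"
  have S: "a \<le> k" "real (k - a + 1) \<le> real (k * ?w) - real T" if "k \<in> ?S" for k
  proof -
    have *: "T < Suc (T div ?w) * ?w"
      using dividend_less_div_times[OF window_pos, of T] by simp
    have "Suc (T div ?w) * ?w \<le> T + ?w" by (simp add: div_times_less_eq_dividend)
    also have "\<dots> < k * ?w" using that by simp
    finally have "Suc (T div ?w) < k" by (simp only: mult_less_cancel2)
    then show a: "a \<le> k" using that by (simp add: a_def)
    have "k - a + 1 \<le> k - Suc (T div ?w)" using a unfolding a_def by linarith
    also have "\<dots> \<le> (k - Suc (T div ?w)) * ?w" using window_pos[of v] by simp
    also have "\<dots> \<le> k * ?w - T" unfolding diff_mult_distrib using * by linarith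
    finally have "real (k - a + 1) \<le> real (k * ?w - T)" by (simp only: of_nat_le_iff)
    also have "\<dots> = real (k * ?w) - real T" using that by (intro of_nat_diff) simp
    finally show "real (k - a + 1) \<le> real (k * ?w) - real T" .
  qed
  have "(\<Sum>k\<in>?S. 1 / (real (k * ?w) - real T)) \<le> (\<Sum>k\<in>?S. inverse (real (k - a + 1)))"
    unfolding inverse_eq_divide by (rule sum_mono, rule frac_le) (use S(2) in auto)
  also have "\<dots> = (\<Sum>j\<in>(\<lambda>k. k - a + 1) ` ?S. inverse (real j))"
  proof -
    have "inj_on (\<lambda>k. k - a + 1) ?S"
    proof (rule inj_onI)
      fix x y assume "x \<in> ?S" "y \<in> ?S" "x - a + 1 = y - a + 1"
      then show "x = y" using S(1)[of x] S(1)[of y] by linarith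
    qed
    then show ?thesis by (simp add: sum.reindex)
  qed
  also have "\<dots> \<le> harm m"
    unfolding harm_def
  proof (rule sum_mono2)
    show "(\<lambda>k. k - a + 1) ` ?S \<subseteq> {1..m}" using S(1) by (auto simp: a_def)
  qed auto
  finally show ?thesis .
qed

text \<open>Each wake-up spoils its own window and the next one, each success only its own:
  \<open>2 * n + n\<close>.\<close>

lemma card_not_quiet_le:
  assumes K: "K \<subseteq> {1..}" "\<And>k. k \<in> K \<Longrightarrow> Suc k * window v \<le> length h"
  shows "card {k \<in> K. \<not> quiet k} \<le> 3 * n"
proof -
  let ?w = "window v" and ?N = "woken_before A h (length h)"
  let ?W = "\<Union>x<?N. {wk x div ?w, Suc (wk x div ?w)}"
  let ?R = "{r. r < length h \<and> card (h ! r) = 1}"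
  have div: "s div ?w = k" if "k * ?w \<le> s" "s < Suc k * ?w" for s k
    using that by (intro div_nat_eqI) (auto simp: mult.commute)
  have "{k \<in> K. \<not> quiet k} \<subseteq> ?W \<union> (\<lambda>s. s div ?w) ` ?R"
  proof safe
    fix k assume k: "k \<in> K" "\<not> quiet k" "k \<notin> (\<lambda>s. s div ?w) ` ?R"
    have "card (h ! s) \<noteq> 1" if "k * ?w \<le> s" "s < Suc k * ?w" for s
      using k(3) div[OF that] that(2) K(2)[OF k(1)] by force
    then obtain x where x: "x < ?N" "(k - 1) * ?w \<le> wk x" "wk x < Suc k * ?w"
      using k(2) unfolding quiet_def by (meson not_less)
    have "wk x div ?w = k \<or> Suc (wk x div ?w) = k"
    proof (cases "k * ?w \<le> wk x")
      case True
      then show ?thesis using div x by blast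
    next
      case False
      moreover have "Suc (k - 1) = k" using K(1) k(1) by force
      ultimately show ?thesis using div[of "k - 1" "wk x"] x by simp
    qed
    then show "k \<in> ?W" using x by blast
  qed
  moreover have "finite (?W \<union> (\<lambda>s. s div ?w) ` ?R)" by auto
  ultimately have "card {k \<in> K. \<not> quiet k} \<le> card (?W \<union> (\<lambda>s. s div ?w) ` ?R)"
    by (intro card_mono)
  also have "\<dots> \<le> card ?W + card ((\<lambda>s. s div ?w) ` ?R)" by (rule card_Un_le)
  also have "card ?W \<le> (\<Sum>x<?N. card {wk x div ?w, Suc (wk x div ?w)})"
    by (rule card_UN_le) simp
  also have "\<dots> \<le> (\<Sum>x<?N. 2)" by (intro sum_mono) (auto simp: card_insert_if)
  also have "\<dots> \<le> 2 * n" using total by simp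
  also have "card ((\<lambda>s. s div ?w) ` ?R) \<le> card ?R" by (rule card_image_le) simp
  also note few_successes
  finally show ?thesis by simp
qed

text \<open>Each party adds at most \<open>harm m \<le> c\<close> to the contention summed over all
  quiet windows, so the sum is at most \<open>n * c\<close> and at most \<open>n\<close> windows can
  exceed \<open>c\<close>.\<close>

lemma card_high_contention_le:
  assumes K: "1 \<le> k0" "\<And>k. k \<in> {k0..<k0 + m} \<Longrightarrow> Suc k * window v \<le> length h"
    and c: "0 < c" "harm m \<le> c"
  shows "card {k \<in> {k0..<k0 + m}. quiet k \<and> c < contention (k * window v)} \<le> n"
proof -
  let ?w = "window v" and ?N = "woken_before A h (length h)"
  let ?B = "{k \<in> {k0..<k0 + m}. quiet k \<and> c < contention (k * ?w)}"
  let ?f = "\<lambda>k x. if wk x + ?w < k * ?w then 1 / (real (k * ?w) - real (wk x)) else 0"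
  have "real (card ?B) * c \<le> (\<Sum>k\<in>?B. contention (k * ?w))"
    using sum_bounded_below[of ?B c "\<lambda>k. contention (k * ?w)"] by simp
  also have "\<dots> \<le> (\<Sum>k\<in>?B. \<Sum>x<?N. ?f k x)"
  proof (rule sum_mono)
    fix k assume k: "k \<in> ?B"
    have len: "k * ?w \<le> length h" using K(2)[of k] k by simp
    have "contention (k * ?w) = (\<Sum>x\<in>live A (take (k * ?w) h). ?f k x)"
      unfolding contention_def using quiet_age[OF _ _ len] k K(1) by (intro sum.cong) auto
    also have "\<dots> \<le> (\<Sum>x<?N. ?f k x)"
      using live_less[OF len] by (intro sum_mono2) (auto simp del: of_nat_mult)
    finally show "contention (k * ?w) \<le> (\<Sum>x<?N. ?f k x)" .
  qed
  also have "\<dots> \<le> (\<Sum>k\<in>{k0..<k0 + m}. \<Sum>x<?N. ?f k x)"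
    by (intro sum_mono2) (auto intro!: sum_nonneg simp del: of_nat_mult)
  also have "\<dots> = (\<Sum>x<?N. \<Sum>k\<in>{k0..<k0 + m}. ?f k x)" by (rule sum.swap)
  also have "\<dots> \<le> (\<Sum>x<?N. c)"
  proof (rule sum_mono)
    fix x
    have "(\<Sum>k\<in>{k0..<k0 + m}. ?f k x) = (\<Sum>k\<in>{k \<in> {k0..<k0 + m}. wk x + ?w < k * ?w}. 1 / (real (k * ?w) - real (wk x)))"
      by (subst sum.inter_filter) auto
    also have "\<dots> \<le> harm m" by (rule sum_inverse_ages_le)
    also note c(2)
    finally show "(\<Sum>k\<in>{k0..<k0 + m}. ?f k x) \<le> c" .
  qed
  also have "\<dots> = real ?N * c" by simp
  finally have "card ?B \<le> ?N" using c(1) by simp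
  then show ?thesis using total by simp
qed

text \<open>Either some multiplier of scale \<open>v\<close> brings
  \<open>\<mu> * contention\<close> into the interval from 1/4 to 1/2; the rates then add up to
  between 1/8 and 1/2, and some party succeeds with probability at least
  \<open>1 / 8 * (1 / 2)\<close>. Or the contention is too small for that, and the largest
  multiplier favours \<open>u\<close> itself.\<close>

lemma quiet_progress:
  assumes k: "quiet k" "t0 < k * window v" "Suc k * window v \<le> length h" "Suc k * window v \<le> t0 + L"
    and not_succeeded: "{u} \<notin> set (take (t0 + L) h)"
    and c: "contention (k * window v) \<le> 2 ^ half v / 4"
  shows "\<exists>s. k * window v \<le> s \<and> s < Suc k * window v \<and>
    (1 / 16 \<le> sawtooth.success_prob A (take s h) \<or>
     2 ^ half v / (4 * real L) \<le> sawtooth.prob {Y. next_attempts A Y (take s h) = {u}})"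
proof -
  let ?w = "window v" and ?c = "contention (k * window v)"
  have k0: "0 < k" using k(2) by (cases k) auto
  have kw: "k * ?w \<le> length h" using k(3) by simp
  have "set (take (k * ?w) h) \<subseteq> set (take (t0 + L) h)"
    using k(4) by (intro set_take_subset_set_take) simp
  then have ul: "u \<in> live A (take (k * ?w) h)"
    using not_succeeded u k(2) by (auto simp: live_take[OF kw])
  have wku: "wk u = t0" using u by (simp add: wk_def wake_slot_eq)
  have "0 < 1 / (real (k * ?w) - real (wk u))"
    using k(2) wku by (simp del: of_nat_mult)
  also have "\<dots> \<le> ?c"
    unfolding contention_def using ul
  proof (intro member_le_sum)
    fix x assume "x \<in> live A (take (k * ?w) h) - {u}"
    then have "wk x < k * ?w" using wake_slot_take[OF kw] by blast
    then show "0 \<le> 1 / (real (k * ?w) - real (wk x))"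
      by (simp only: zero_le_divide_1_iff diff_ge_0_iff_ge of_nat_le_iff less_imp_le)
  qed auto
  finally have c0: "0 < ?c" .
  show ?thesis
  proof (cases "1 / 2 ^ half v \<le> ?c")
    case True
    have "1 \<le> 2 ^ half v / (2 * ?c)" using c c0 by (simp add: field_simps)
    then obtain i where i: "2 ^ i \<le> 2 ^ half v / (2 * ?c)" "2 ^ half v / (2 * ?c) < 2 * 2 ^ i"
      by (rule ex_power_2_ivl)
    have "2 ^ half v / (2 * ?c) \<le> 2 ^ half v * 2 ^ half v / 2"
      using True c0 by (simp add: field_simps)
    with i(1) have "(2 :: real) ^ i < 2 ^ (half v + half v)"
      unfolding power_add by (smt (verit) field_sum_of_halves zero_less_mult_iff zero_less_power)
    then have "i < half v + half v" by (rule power_less_imp_less_exp[rotated]) simp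
    then have "i < 2 ^ v\<^sup>2" using half[OF v] by simp
    then obtain s where s: "k * ?w \<le> s" "s < Suc k * ?w" "slot_multiplier s = 2 ^ i / 2 ^ half v"
      by (rule slot_multiplier_in_window)
    have sl: "s \<le> length h" using s k(3) by linarith
    have \<mu>: "slot_multiplier s * ?c \<le> 1 / 2" "1 / 4 \<le> slot_multiplier s * ?c"
      using i c0 unfolding s(3) by (simp_all add: field_simps)
    let ?x = "\<Sum>x\<in>live A (take s h). sawtooth.rate A (take s h) x"
    have "1 / 8 \<le> ?x" "?x \<le> 1 / 2"
      using quiet_rates(1,2)[OF k(1) k0 s(1,2) sl \<mu>(1)] \<mu> by simp_all
    then have "1 / 8 * (1 / 2) \<le> ?x * (1 - ?x)" by (intro mult_mono) auto
    also have "\<dots> \<le> sawtooth.success_prob A (take s h)" by (rule sawtooth.success_prob_ge)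
    finally show ?thesis using s by auto
  next
    case False
    \<comment> \<open>The largest multiplier, \<open>2 ^ half v / 2\<close>: even with it the rates
      add up to at most 1/2, so \<open>u\<close> keeps at least half of its own rate, and its age is
      at most \<open>L\<close>.\<close>
    have "2 * half v - 1 < 2 ^ v\<^sup>2" using half[OF v] by simp
    then obtain s where s: "k * ?w \<le> s" "s < Suc k * ?w" "slot_multiplier s = 2 ^ (2 * half v - 1) / 2 ^ half v"
      by (rule slot_multiplier_in_window)
    have "2 * half v - 1 = half v + (half v - 1)" using half[OF v] by simp
    then have "slot_multiplier s = 2 ^ (half v - 1)" unfolding s(3) by (simp only: power_add) simp
    also have "\<dots> = 2 ^ half v / 2" using half(2)[OF v] by (cases "half v") auto
    finally have \<mu>: "slot_multiplier s = 2 ^ half v / 2" .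
    have sl: "s \<le> length h" using s k(3) by linarith
    have small: "slot_multiplier s * ?c \<le> 1 / 2"
      using False unfolding \<mu> by (simp add: field_simps)
    note rates = quiet_rates[OF k(1) k0 s(1,2) sl small]
    have us: "u \<in> live A (take s h)" using quiet_live[OF k(1) k0 s(1,2) sl] ul by simp
    let ?x = "\<Sum>x\<in>live A (take s h). sawtooth.rate A (take s h) x"
    have t0s: "t0 < s" "s \<le> t0 + L" using k s by linarith+
    have "2 ^ half v / (4 * real L) = (2 ^ half v / 2) / real L * (1 / 2)" by simp
    also have "\<dots> \<le> (2 ^ half v / 2) / (real s - real t0) * (1 - ?x)"
      using rates(1) small t0s by (intro mult_mono divide_left_mono) auto
    also have "\<dots> = sawtooth.rate A (take s h) u * (1 - ?x)"
      using rates(3)[OF us] wku \<mu> by simp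
    also have "\<dots> \<le> sawtooth.prob {Y. next_attempts A Y (take s h) = {u}}"
      by (rule sawtooth.prob_next_attempts_singleton[OF us])
    finally show ?thesis using s by auto
  qed
qed

text \<open>The constant is \<open>69 = 3 + 1 + 64 + 1\<close>: at most \<open>3 * n\<close> windows
  are not quiet and at most \<open>n\<close> have high contention. Of the other
  \<open>65 * n\<close>, either \<open>64 * n\<close> contain a slot with success probability 1/16,
  which add up to \<open>4 * n\<close>, or \<open>n\<close> of them favour \<open>u\<close>.\<close>

lemma progress:
  assumes L: "L = (69 * n + 1) * window v" "t0 + L < length h"
    and not_succeeded: "{u} \<notin> set (take (t0 + L) h)"
    and harm: "4 * harm (69 * n) \<le> (2 :: real) ^ half v"
    and active: "\<And>s. t0 < s \<Longrightarrow> s < t0 + L \<Longrightarrow> active (take s h)"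
  shows "4 * real n \<le> (\<Sum>r<length h. sawtooth.success_prob A (take r h)) \<or>
    real n * (2 ^ half v / (4 * real L)) \<le>
      (\<Sum>r<length h. if active (take r h) then sawtooth.prob {Y. next_attempts A Y (take r h) = {u}} else 0)"
proof -
  let ?w = "window v" and ?m = "69 * n"
  \<comment> \<open>The first window that starts after \<open>t0\<close>; the \<open>+ 1\<close> in
    \<open>L\<close> pays for the partial window before it.\<close>
  define k0 where "k0 = t0 div ?w + 1"
  let ?K = "{k0..<k0 + ?m}"
  let ?\<sigma> = "\<lambda>s. sawtooth.success_prob A (take s h)"
  let ?\<tau> = "\<lambda>s. sawtooth.prob {Y. next_attempts A Y (take s h) = {u}}"
  let ?in = "\<lambda>k s. k * ?w \<le> s \<and> s < Suc k * ?w"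
  have k0: "1 \<le> k0" "t0 < k0 * ?w" "(k0 + ?m) * ?w \<le> t0 + L"
  proof -
    show "1 \<le> k0" by (simp add: k0_def)
    show "t0 < k0 * ?w" using dividend_less_div_times[OF window_pos, of t0] by (simp add: k0_def)
    have "t0 div ?w * ?w \<le> t0" by (rule div_times_less_eq_dividend)
    then show "(k0 + ?m) * ?w \<le> t0 + L" unfolding L(1) k0_def by (simp add: algebra_simps)
  qed
  have K: "t0 < k * ?w" "Suc k * ?w \<le> t0 + L" if "k \<in> ?K" for k
  proof -
    have "k0 * ?w \<le> k * ?w" using that by (intro mult_right_mono) auto
    then show "t0 < k * ?w" using k0 by linarith
    have "Suc k * ?w \<le> (k0 + ?m) * ?w" using that by (intro mult_right_mono) auto
    then show "Suc k * ?w \<le> t0 + L" using k0 by linarith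
  qed
  have Kh: "Suc k * ?w \<le> length h" if "k \<in> ?K" for k using K[OF that] L(2) by linarith
  define G where "G = {k \<in> ?K. quiet k \<and> contention (k * ?w) \<le> 2 ^ half v / 4}"
  have "card ?K \<le> card (G \<union> ({k \<in> ?K. \<not> quiet k} \<union> {k \<in> ?K. quiet k \<and> 2 ^ half v / 4 < contention (k * ?w)}))"
    by (rule card_mono) (auto simp: G_def)
  also have "\<dots> \<le> card G + (card {k \<in> ?K. \<not> quiet k} + card {k \<in> ?K. quiet k \<and> 2 ^ half v / 4 < contention (k * ?w)})"
    by (intro order.trans[OF card_Un_le] add_left_mono card_Un_le)
  also have "card {k \<in> ?K. \<not> quiet k} \<le> 3 * n"
    using k0(1) Kh by (intro card_not_quiet_le) auto
  also have "card {k \<in> ?K. quiet k \<and> 2 ^ half v / 4 < contention (k * ?w)} \<le> n"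
    using harm by (intro card_high_contention_le k0(1) Kh) auto
  finally have cG: "65 * n \<le> card G" by simp
  define M where "M = {k \<in> G. \<exists>s. ?in k s \<and> 1 / 16 \<le> ?\<sigma> s}"
  have finG: "finite G" by (simp add: G_def)
  have MG: "M \<subseteq> G" by (auto simp: M_def)
  \<comment> \<open>Windows are disjoint, so choosing one good slot per window is injective.\<close>
  have sum_ge: "real (card S) * x \<le> (\<Sum>r<length h. f r)"
    if S: "S \<subseteq> G" "\<And>k. k \<in> S \<Longrightarrow> \<exists>s. ?in k s \<and> x \<le> f s" and f: "\<And>s. 0 \<le> f s"
    for S x and f :: "nat \<Rightarrow> real"
  proof -
    from S(2) have "\<forall>k\<in>S. \<exists>s. ?in k s \<and> x \<le> f s" by blast
    then obtain g where g: "\<And>k. k \<in> S \<Longrightarrow> ?in k (g k) \<and> x \<le> f (g k)" by metis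
    have "g k div ?w = k" if "k \<in> S" for k
      using g[OF that] by (intro div_nat_eqI) (auto simp: mult.commute)
    then have inj: "inj_on g S" by (metis inj_onI)
    have "real (card S) * x \<le> (\<Sum>k\<in>S. f (g k))"
      using sum_bounded_below[of S x "\<lambda>k. f (g k)"] g by simp
    also have "\<dots> = (\<Sum>r\<in>g ` S. f r)" using inj by (simp add: sum.reindex)
    also have "\<dots> \<le> (\<Sum>r<length h. f r)"
    proof (rule sum_mono2)
      show "g ` S \<subseteq> {..<length h}"
      proof
        fix r assume "r \<in> g ` S"
        then obtain k where k: "k \<in> S" "r = g k" by blast
        then have "k \<in> ?K" using S(1) by (auto simp: G_def)
        then show "r \<in> {..<length h}" using g[OF k(1)] k(2) Kh[of k] by simp
      qed
    qed (auto simp: f)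
    finally show ?thesis .
  qed
  show ?thesis
  proof (cases "64 * n \<le> card M")
    case True
    have "real (card M) * (1 / 16) \<le> (\<Sum>r<length h. ?\<sigma> r)"
      using MG by (rule sum_ge) (auto simp: M_def sawtooth.success_prob_bounds)
    moreover have "real (64 * n) \<le> real (card M)" using True by (rule of_nat_mono)
    ultimately show ?thesis by simp
  next
    case False
    have "card G = card M + card (G - M)"
      using MG finG by (metis card_Diff_subset card_mono finite_subset le_add_diff_inverse)
    then have "n \<le> card (G - M)" using False cG by linarith
    then have "real n * (2 ^ half v / (4 * real L)) \<le> real (card (G - M)) * (2 ^ half v / (4 * real L))"
      by (intro mult_right_mono) auto
    also have "\<dots> \<le> (\<Sum>r<length h. if active (take r h) then ?\<tau> r else 0)"
    proof (rule sum_ge)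
      fix k assume k: "k \<in> G - M"
      then have kK: "k \<in> ?K" by (simp add: G_def)
      have "\<exists>s. ?in k s \<and> (1 / 16 \<le> ?\<sigma> s \<or> 2 ^ half v / (4 * real L) \<le> ?\<tau> s)"
        using quiet_progress[of k L] K[OF kK] Kh[OF kK] not_succeeded k by (simp add: G_def)
      then obtain s where s: "?in k s" "2 ^ half v / (4 * real L) \<le> ?\<tau> s"
        using k by (auto simp: M_def)
      have "active (take s h)" using s K[OF kK] by (intro active) linarith+
      then show "\<exists>s. ?in k s \<and> 2 ^ half v / (4 * real L) \<le> (if active (take s h) then ?\<tau> s else 0)"
        using s by auto
    qed auto
    finally show ?thesis by blast
  qed
qed

end

section \<open>From fixed histories to the latency\<close>

lemma card_successes_le:
  "card {r. r < s \<and> card (run A Y s ! r) = 1} \<le> woken_before A (run A Y s) s"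
proof -
  let ?R = "{r. r < s \<and> card (run A Y s ! r) = 1}" and ?f = "\<lambda>r. the_elem (run A Y s ! r)"
  have f: "succeeds_in A Y (?f r) r" if "r \<in> ?R" for r
    using that by (auto simp: succeeds_in_def nth_run card_1_singleton_iff)
  have "inj_on ?f ?R"
    by (rule inj_onI) (metis f succeeds_in_once)
  moreover have "?f ` ?R \<subseteq> {..<woken_before A (run A Y s) s}"
  proof
    fix x assume "x \<in> ?f ` ?R"
    then obtain r where r: "r < s" "succeeds_in A Y x r" using f by auto
    then have "x < woken_before A (run A Y r) r"
      using next_attempts_subset[of A Y "run A Y r"] by (auto simp: succeeds_in_def)
    also have "\<dots> \<le> woken_before A (run A Y s) s"
      using r(1) woken_before_run[of r s A Y] woken_before_mono[of r s A "run A Y s"] by simp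
    finally show "x \<in> {..<woken_before A (run A Y s) s}" by simp
  qed
  ultimately show ?thesis
    using card_inj_on_le[of ?f ?R "{..<woken_before A (run A Y s) s}"] by simp
qed

text \<open>Presents the event as a countable union, over \<open>s\<close> and \<open>t\<close>, of
  conditions on finite runs, which makes it measurable.\<close>

lemma latency_le_enat_iff:
  "latency A Y u \<le> enat L \<longleftrightarrow>
    (\<exists>s. \<exists>t<s. woken_in A (run A Y s) u t \<and> {u} \<in> set (run A Y (Suc (t + L))))"
proof
  assume *: "latency A Y u \<le> enat L"
  then obtain s where "succeeds_in A Y u s" unfolding latency_def by (auto split: if_splits)
  then have "u \<in> next_attempts A Y (run A Y s)" by (simp add: succeeds_in_def)
  then obtain t where "t < s" "woken_in A (run A Y s) u t" by (auto simp: mem_next_attempts)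
  then show "\<exists>s. \<exists>t<s. woken_in A (run A Y s) u t \<and> {u} \<in> set (run A Y (Suc (t + L)))"
    using * latency_le_iff by blast
qed (use latency_le_iff in blast)

lemma eventually_woken_before_le:
  assumes "wakes_up_total A Y n"
  shows "woken_before A (run A Y s) s \<le> n"
proof -
  from assms obtain T where T: "\<And>t. T \<le> t \<Longrightarrow> woken_before A (run A Y t) t = n"
    unfolding wakes_up_total_def eventually_sequentially by blast
  have "woken_before A (run A Y s) s = woken_before A (run A Y (max s T)) s"
    by (simp add: woken_before_run[of s "max s T"])
  also have "\<dots> \<le> woken_before A (run A Y (max s T)) (max s T)" by (rule woken_before_mono) simp
  also have "\<dots> = n" by (rule T) simp
  finally show ?thesis .
qed

context memoryless_protocol
begin

lemma events_latency: "{Y. latency A Y u \<le> enat L} \<in> events"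
proof -
  have "{Y. woken_in A (run A Y s) u t \<and> {u} \<in> set (run A Y (Suc (t + L)))} \<in> events" for s t
  proof -
    have "{Y. woken_in A (run A Y s) u t} \<inter> {Y. {u} \<in> set (run A Y (Suc (t + L)))} \<in> events"
      by (rule sets.Int; rule events_run)
    then show ?thesis by (simp only: Int_def mem_Collect_eq)
  qed
  then have "(\<Union>s. \<Union>t\<in>{..<s}. {Y. woken_in A (run A Y s) u t \<and> {u} \<in> set (run A Y (Suc (t + L)))}) \<in> events"
    by (intro sets.countable_UN sets.finite_UN) auto
  also have "(\<Union>s. \<Union>t\<in>{..<s}. {Y. woken_in A (run A Y s) u t \<and> {u} \<in> set (run A Y (Suc (t + L)))}) =
      {Y. latency A Y u \<le> enat L}"
    by (auto simp: latency_le_enat_iff)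
  finally show ?thesis .
qed

text \<open>An adaptive adversary may wake up \<open>u\<close> arbitrarily late, so no single
  horizon \<open>s\<close> captures all failures. A failing outcome is late for all sufficiently
  large horizons, and the sets \<open>B m\<close> of outcomes late from \<open>m\<close> on
  increase, so the uniform bound \<open>q\<close> passes to their union.\<close>

lemma prob_latency_ge:
  assumes late: "\<And>s. prob {Y. \<exists>t. woken_in A (run A Y s) u t \<and> t + L < s \<and>
      {u} \<notin> set (take (t + L) (run A Y s)) \<and> woken_before A (run A Y s) s \<le> n} \<le> q"
    and total: "AE Y in draw_space (bernoulli_protocol p). wakes_up_total A Y n"
    and u: "u < n"
  shows "1 - q \<le> prob {Y. latency A Y u \<le> enat L}"
proof -
  define C where "C s = {Y. \<exists>t. woken_in A (run A Y s) u t \<and> t + L < s \<and>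
      {u} \<notin> set (take (t + L) (run A Y s)) \<and> woken_before A (run A Y s) s \<le> n}" for s
  have C: "C s \<in> events" for s unfolding C_def by (rule events_run)
  define B where "B m = (\<Inter>s\<in>{m..}. C s)" for m
  have B: "B m \<in> events" for m unfolding B_def using C by (intro sets.countable_INT') auto
  have "prob (B m) \<le> q" for m
  proof -
    have "prob (B m) \<le> prob (C m)" by (rule finite_measure_mono) (auto simp: B_def C)
    then show ?thesis using late[of m] by (simp add: C_def)
  qed
  moreover have "incseq B" unfolding B_def incseq_def by force
  then have "(\<lambda>m. prob (B m)) \<longlonglongrightarrow> prob (\<Union>m. B m)"
    using B by (intro finite_Lim_measure_incseq) auto
  ultimately have le_q: "prob (\<Union>m. B m) \<le> q" by (intro LIMSEQ_le_const2) auto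
  have UB: "(\<Union>m. B m) \<in> events" using B by auto
  have "AE Y in draw_space (bernoulli_protocol p). Y \<in> {Y. latency A Y u \<le> enat L} \<union> (\<Union>m. B m)"
    using total
  proof eventually_elim
    case (elim Y)
    show ?case
    proof (rule UnCI)
      assume nB: "Y \<notin> (\<Union>m. B m)"
      from elim obtain T where "woken_before A (run A Y T) T = n"
        unfolding wakes_up_total_def by (auto simp: eventually_sequentially)
      then obtain t where t: "t < T" "woken_in A (run A Y T) u t"
        using ex_woken_in[of u A "run A Y T" T] u by auto
      have w: "woken_in A (run A Y s) u t" if "t < s" for s
        using that t woken_in_run by blast
      have "Y \<notin> B (t + L + 1)" using nB by blast
      then obtain s where s: "t + L + 1 \<le> s" "Y \<notin> C s" by (auto simp: B_def)
      then have "{u} \<in> set (take (t + L) (run A Y s))"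
        using w[of s] eventually_woken_before_le[OF elim, of s] by (auto simp: C_def)
      then have "{u} \<in> set (run A Y (t + L))" using s by (simp add: take_run)
      then have "{u} \<in> set (run A Y (Suc (t + L)))" by simp
      then show "Y \<in> {Y. latency A Y u \<le> enat L}" using t latency_le_iff by blast
    qed
  qed
  moreover have "{Y. latency A Y u \<le> enat L} \<union> (\<Union>m. B m) \<in> events"
    using events_latency UB by (rule sets.Un)
  ultimately have "1 = prob ({Y. latency A Y u \<le> enat L} \<union> (\<Union>m. B m))"
    using prob_eq_1 by metis
  also have "\<dots> \<le> prob {Y. latency A Y u \<le> enat L} + prob (\<Union>m. B m)"
    using UB events_latency by (intro measure_Un_le)
  finally show ?thesis using le_q by linarith
qed

end

text \<open>By \<open>progress\<close>, a late run has accumulated either too much success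
  probability for its at most \<open>n\<close> successes, or at least \<open>3 * ln n\<close> of
  success probability for \<open>u\<close> without a success of \<open>u\<close>.\<close>

lemma prob_late_le:
  fixes n v :: nat
  defines "L \<equiv> (69 * n + 1) * window v"
  assumes v: "0 < v" and n: "0 < n"
    and harm: "4 * harm (69 * n) \<le> (2 :: real) ^ half v"
    and tail: "3 * ln (real n) \<le> real n * (2 ^ half v / (4 * real L))"
  shows "sawtooth.prob {Y. \<exists>t. woken_in A (run A Y s) u t \<and> t + L < s \<and>
      {u} \<notin> set (take (t + L) (run A Y s)) \<and> woken_before A (run A Y s) s \<le> n}
    \<le> exp (- real n) + 1 / real n ^ 3"
proof -
  have L_eq: "L = (69 * n + 1) * window v" by (simp add: L_def)
  \<comment> \<open>The wake-up slot of \<open>u\<close> is random, but whether \<open>u\<close> is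
    within its first \<open>L\<close> slots can be read off the history, as
    \<open>prob_unlucky\<close> requires.\<close>
  define active where "active g \<longleftrightarrow> (\<exists>t<length g. woken_in A g u t \<and> length g < t + L)" for g
  let ?\<tau> = "\<lambda>h. sawtooth.prob {Y'. next_attempts A Y' h = {u}}"
  let ?E1 = "{Y. 4 * real n \<le> (\<Sum>r<s. sawtooth.success_prob A (take r (run A Y s))) \<and>
     card {r. r < s \<and> card (run A Y s ! r) = 1} \<le> n}"
  let ?E2 = "{Y. 3 * ln (real n) \<le> (\<Sum>r<s. if active (take r (run A Y s)) then ?\<tau> (take r (run A Y s)) else 0) \<and>
     (\<forall>r<s. active (take r (run A Y s)) \<longrightarrow> run A Y s ! r \<noteq> {u})}"
  have E: "?E1 \<in> sawtooth.events" "?E2 \<in> sawtooth.events"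
    using sawtooth.events_run[where s = s and A = A and P = "\<lambda>h. 4 * real n \<le> (\<Sum>r<s. sawtooth.success_prob A (take r h)) \<and>
        card {r. r < s \<and> card (h ! r) = 1} \<le> n"]
      sawtooth.events_run[where s = s and A = A and P = "\<lambda>h. 3 * ln (real n) \<le> (\<Sum>r<s. if active (take r h) then ?\<tau> (take r h) else 0) \<and>
        (\<forall>r<s. active (take r h) \<longrightarrow> h ! r \<noteq> {u})"] by simp_all
  have "sawtooth.prob {Y. \<exists>t. woken_in A (run A Y s) u t \<and> t + L < s \<and>
      {u} \<notin> set (take (t + L) (run A Y s)) \<and> woken_before A (run A Y s) s \<le> n} \<le> sawtooth.prob (?E1 \<union> ?E2)"
  proof (rule sawtooth.finite_measure_mono)
    show "?E1 \<union> ?E2 \<in> sawtooth.events" using E by (rule sets.Un)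
    show "{Y. \<exists>t. woken_in A (run A Y s) u t \<and> t + L < s \<and>
      {u} \<notin> set (take (t + L) (run A Y s)) \<and> woken_before A (run A Y s) s \<le> n} \<subseteq> ?E1 \<union> ?E2"
    proof
      fix Y
      let ?h = "run A Y s"
      assume "Y \<in> {Y. \<exists>t. woken_in A (run A Y s) u t \<and> t + L < s \<and>
        {u} \<notin> set (take (t + L) (run A Y s)) \<and> woken_before A (run A Y s) s \<le> n}"
      then obtain t where t: "woken_in A ?h u t" "t + L < length ?h" "{u} \<notin> set (take (t + L) ?h)"
        "woken_before A ?h (length ?h) \<le> n" by auto
      have few: "card {r. r < length ?h \<and> card (?h ! r) = 1} \<le> n"
        using card_successes_le[of s A Y] t(4) by simp
      have act: "active (take r ?h)" if "t < r" "r < t + L" for r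
        unfolding active_def using that t by (intro exI[of _ t]) (simp add: woken_in_take min_absorb2)
      have "run A Y s ! r \<noteq> {u}" if r: "r < s" "active (take r ?h)" for r
      proof
        assume *: "?h ! r = {u}"
        from r obtain t' where t': "t' < r" "woken_in A (take r ?h) u t'" "r < t' + L"
          by (auto simp: active_def min_absorb2)
        then have "t' = t" using t(1) woken_in_unique by (simp add: woken_in_take)
        then have "take (t + L) ?h ! r = {u}" "r < length (take (t + L) ?h)" using * t' r by auto
        then show False using t(3) nth_mem by metis
      qed
      moreover have "4 * real n \<le> (\<Sum>r<length ?h. sawtooth.success_prob A (take r ?h)) \<or>
          real n * (2 ^ half v / (4 * real L)) \<le> (\<Sum>r<length ?h. if active (take r ?h) then ?\<tau> (take r ?h) else 0)"
        by (rule progress[where active = active, OF t(4) few t(1) v L_eq t(2,3) harm act])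
      ultimately show "Y \<in> ?E1 \<union> ?E2" using few tail by auto
    qed
  qed
  also have "\<dots> \<le> sawtooth.prob ?E1 + sawtooth.prob ?E2" using E by (rule measure_Un_le)
  also have "sawtooth.prob ?E1 \<le> exp (- real n)" by (rule sawtooth.prob_many_expected_successes)
  also have "sawtooth.prob ?E2 \<le> exp (- (3 * ln (real n)))" by (rule sawtooth.prob_unlucky)
  also have "exp (- (3 * ln (real n))) = 1 / real n ^ 3"
    using n by (simp add: exp_minus exp_of_nat_mult[of 3, simplified] inverse_eq_divide)
  finally show ?thesis by simp
qed

lemma whp_latency_sawtooth_le:
  fixes n v :: nat
  defines "L \<equiv> (69 * n + 1) * window v"
  assumes v: "0 < v" and n: "0 < n"
    and harm: "4 * harm (69 * n) \<le> (2 :: real) ^ half v"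
    and tail: "3 * ln (real n) \<le> real n * (2 ^ half v / (4 * real L))"
    and q: "exp (- real n) + 1 / real n ^ 3 \<le> 1 / real n ^ 2"
  shows "whp_latency adaptive (bernoulli_protocol sawtooth_prob) n \<le> enat L"
  unfolding whp_latency_def protocol_latency_def
proof (rule Least_le, intro ballI impI allI)
  fix A u
  assume "AE Y in draw_space (bernoulli_protocol sawtooth_prob). wakes_up_total A Y n" "u < n"
  then have "1 - (exp (- real n) + 1 / real n ^ 3) \<le> sawtooth.prob {Y. latency A Y u \<le> enat L}"
    unfolding L_def by (rule sawtooth.prob_latency_ge[OF prob_late_le[OF v n harm tail[unfolded L_def]]])
  then show "1 - 1 / (real n)\<^sup>2 \<le> \<P>(Y in draw_space (bernoulli_protocol sawtooth_prob). latency A Y u \<le> enat L)"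
    using q by (simp add: sawtooth.space_draw_space)
qed

lemma harm_le: "harm n \<le> 1 + ln (real (Suc n))" for n :: nat
proof -
  have "harm (Suc n) - ln (real (Suc n)) \<le> harm (Suc 0) - ln (real (Suc 0))"
    using decseq_harm_diff_ln unfolding decseq_def by blast
  moreover have "harm n \<le> (harm (Suc n) :: real)" by (simp add: harm_Suc)
  moreover have "harm (Suc 0) = (1 :: real)" by (simp add: harm_def)
  ultimately show ?thesis by simp
qed

theorem global_clock_upper_bound:
  "\<exists>(D :: nat \<Rightarrow> (nat \<Rightarrow> bool) measure) (\<epsilon> :: nat \<Rightarrow> real).
      global_clock_protocol D \<and> \<epsilon> \<longlonglongrightarrow> 0 \<and>
      (\<forall>\<^sub>F n in sequentially.
         ereal_of_enat (whp_latency adaptive D n)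
           \<le> ereal (real n * ln (ln (real n)) powr (1 + \<epsilon> n)))"
proof (intro exI conjI)
  \<comment> \<open>\<open>2 ^ v\<^sup>2 \<ge> z n\<close> is what makes \<open>2 ^ half v\<close>
    at least \<open>(ln n)\<^sup>2\<close>, which exceeds the harmonic number and yields the tail
    bound. Without rounding, \<open>b n\<close> would be the right \<open>v\<close>, as
    \<open>2 powr (b n ^ 2) = z n\<close>.\<close>
  define z where "z n = 4 / ln 2 * ln (ln (real n))" for n :: nat
  define b where "b n = sqrt (log 2 (z n))" for n
  \<comment> \<open>Rounding \<open>b n\<close> up to \<open>v\<close> gives a window of at most
    \<open>z n * 2 powr (3 * b n + 3)\<close> slots, and \<open>2240 = 70 * 4 * 8\<close> collects
    the constants. As \<open>b n\<close> has order \<open>sqrt (ln (ln (ln n)))\<close>, the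
    quotient vanishes.\<close>
  define \<epsilon> where "\<epsilon> n = (ln (2240 / ln 2) + 3 * b n * ln 2) / ln (ln (ln (real n)))" for n
  show "global_clock_protocol (bernoulli_protocol sawtooth_prob)"
    by (rule global_clock_bernoulli_protocol)
  show "\<epsilon> \<longlonglongrightarrow> 0" unfolding \<epsilon>_def b_def z_def by real_asymp
  have "\<forall>\<^sub>F n in sequentially. 2 < z n"
    "\<forall>\<^sub>F n in sequentially. 840 * (z n * 2 powr (3 * b n + 3)) \<le> ln (real n)"
    "\<forall>\<^sub>F n in sequentially. 4 * (1 + ln (real (Suc (69 * n)))) \<le> ln (real n) ^ 2"
    "\<forall>\<^sub>F n in sequentially. exp (- real n) + 1 / real n ^ 3 \<le> 1 / real n ^ 2"
    "\<forall>\<^sub>F n in sequentially. 1 < ln (ln (real n))"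
    "\<forall>\<^sub>F n :: nat in sequentially. 1 < ln (real n)"
    unfolding b_def z_def by real_asymp+
  then show "\<forall>\<^sub>F n in sequentially.
       ereal_of_enat (whp_latency adaptive (bernoulli_protocol sawtooth_prob) n)
         \<le> ereal (real n * ln (ln (real n)) powr (1 + \<epsilon> n))"
    using eventually_gt_at_top[of 0]
  proof eventually_elim
    case (elim n)
    define v where "v = nat \<lceil>b n\<rceil>"
    define L where "L = (69 * n + 1) * window v"
    have b: "0 < b n" "b n ^ 2 = log 2 (z n)" using elim(1) by (auto simp: b_def)
    have v: "0 < v" "b n \<le> real v" "real v \<le> b n + 1" using b by (auto simp: v_def)
    have "z n = 2 powr (b n ^ 2)" using elim(1) by (simp add: b)
    also have "\<dots> \<le> 2 powr (real v ^ 2)" using b v by (intro powr_mono power_mono) auto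
    also have "\<dots> = 2 ^ v\<^sup>2" by (simp flip: powr_realpow)
    finally have zv: "z n \<le> 2 ^ v\<^sup>2" .
    have "real v ^ 2 \<le> (b n + 1) ^ 2" using b v by (intro power_mono) auto
    then have "real v + 1 + real v ^ 2 \<le> b n ^ 2 + (3 * b n + 3)"
      using v by (simp add: power2_eq_square algebra_simps)
    moreover have "real (window v) = 2 powr (real v + 1 + real v ^ 2)"
      by (simp add: window_def powr_add flip: powr_realpow)
    ultimately have "real (window v) \<le> 2 powr (b n ^ 2 + (3 * b n + 3))" by simp
    also have "\<dots> = z n * 2 powr (3 * b n + 3)" using elim(1) by (simp add: powr_add b)
    finally have w: "real (window v) \<le> z n * 2 powr (3 * b n + 3)" .
    have "real (2 ^ v\<^sup>2) = 2 * real (half v)" using half(1)[OF v(1)] by (simp flip: of_nat_mult)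
    then have "2 * ln (ln (real n)) \<le> real (half v) * ln 2" using zv by (simp add: z_def field_simps)
    then have "exp (2 * ln (ln (real n))) \<le> exp (real (half v) * ln 2)" by simp
    then have half: "ln (real n) ^ 2 \<le> 2 ^ half v"
      using elim(6) by (simp add: exp_of_nat_mult[of 2, simplified] exp_of_nat_mult)
    have L: "real L \<le> 70 * real n * real (window v)"
    proof -
      have "L \<le> 70 * n * window v" using elim(7) unfolding L_def by (intro mult_right_mono) auto
      then have "real L \<le> real (70 * n * window v)" by (simp only: of_nat_le_iff)
      then show ?thesis by simp
    qed
    have L0: "0 < real L" unfolding L_def of_nat_0_less_iff using window_pos[of v] by simp
    have "whp_latency adaptive (bernoulli_protocol sawtooth_prob) n \<le> enat L"
      unfolding L_def
    proof (rule whp_latency_sawtooth_le[OF v(1) elim(7) _ _ elim(4)])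
      show "4 * harm (69 * n) \<le> (2 :: real) ^ half v"
        using elim(3) half harm_le[of "69 * n"] by simp
      have "3 * ln (real n) * (4 * real L) \<le> 3 * ln (real n) * (4 * (70 * real n * real (window v)))"
        using L elim(6) by (intro mult_left_mono) auto
      also have "\<dots> = real n * ln (real n) * (840 * real (window v))" by simp
      also have "\<dots> \<le> real n * ln (real n) * ln (real n)"
        using w elim(2,6) by (intro mult_left_mono) auto
      also have "\<dots> \<le> real n * 2 ^ half v"
        using half by (simp add: power2_eq_square mult.assoc mult_left_mono)
      finally show "3 * ln (real n) \<le> real n * (2 ^ half v / (4 * real ((69 * n + 1) * window v)))"
        using L0 unfolding L_def by (simp add: field_simps)
    qed
    then have "ereal_of_enat (whp_latency adaptive (bernoulli_protocol sawtooth_prob) n) \<le> ereal (real L)"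
      using ereal_of_enat_le_iff[of _ "enat L"] by simp
    also have "real L \<le> 70 * real n * (z n * 2 powr (3 * b n + 3))"
      using L w elim(7) by (meson mult_left_mono of_nat_0_le_iff order_trans mult_nonneg_nonneg zero_le_numeral)
    also have "\<dots> = real n * (ln (ln (real n)) * (2240 / ln 2 * 2 powr (3 * b n)))"
      by (simp add: z_def powr_add)
    also have "2240 / ln 2 * 2 powr (3 * b n) = exp (ln (2240 / ln 2) + 3 * b n * ln 2)"
      by (simp add: exp_add powr_def)
    also have "\<dots> = ln (ln (real n)) powr \<epsilon> n"
      using elim(5) by (simp add: powr_def \<epsilon>_def)
    also have "ln (ln (real n)) * \<dots> = ln (ln (real n)) powr (1 + \<epsilon> n)"
      using elim(5) by (simp add: powr_add)
    finally show ?case by simp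
  qed
qed

theorem corollary1p2:
  "(\<exists>(D :: nat \<Rightarrow> (nat \<Rightarrow> bool) measure) (\<epsilon> :: nat \<Rightarrow> real).
      global_clock_protocol D \<and> \<epsilon> \<longlonglongrightarrow> 0 \<and>
      (\<forall>\<^sub>F n in sequentially.
         ereal_of_enat (whp_latency adaptive D n)
           \<le> ereal (real n * ln (ln (real n)) powr (1 + \<epsilon> n))))
   \<and>
   \<not> (\<exists>(D :: (nat \<Rightarrow> bool) measure) (f :: nat \<Rightarrow> real).
      local_clock_protocol D \<and>
      (\<forall>\<^sub>F n in sequentially. ereal_of_enat (whp_latency oblivious (\<lambda>_. D) n) = ereal (f n)) \<and>
      f \<in> o(\<lambda>n. real n * ln (real n) / (ln (ln (real n)))\<^sup>2))"
  using global_clock_upper_bound local_clock_lower_bound by (rule conjI)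

end
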